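(* Let $M$ be a smooth manifold of dimension two, let $D \in DO(M)$ be a differential operator, and let $L \in DO(M)$ be a first order homogeneous differential operator which is a simple symmetry operator of $D$, i.e. $[D,L]=DL-LD=0$, and which does not generate $D$. Then there exist a point $m \in M$ and a chart $(U,\psi)$ of $M$ around $m$ such that there exists a non-constant $\psi$-separated solution of $Df=0$.
   Context: $DO(M)$ denotes the ring of complex linear differential operators on the smooth manifold $M$ (with smooth complex-valued coefficients), acting on the space $C^{\infty}(M)$ of smooth complex-valued functions on $M$; multiplication is composition, and $[C,D]=CD-DC$. Operators are restricted to open subsets in the usual way; on an open set $U$, $Df=0$ refers to the restriction of $D$ to $C^\infty(U)$. A first order homogeneous operator is an operator of order one whose homogeneous component of degree zero vanishes (the degree zero component is given by evaluating the operator on the constant function $1$, so it does not depend on coordinates). In local coordinates $(x^1,x^2)$ such an operator has the form $f^1\partial_{x^1}+f^2\partial_{x^2}$ with smooth complex-valued $f^1,f^2$; these operators are vector fields on $M$. Being of order one, such an operator is in particular not identically zero. A differential operator $L$ is a simple symmetry operator of $D$ if $[D,L]=0$. A differential operator $L$ generates a differential operator $D$ if there exist a non-empty open set $U\subseteq M$, a non-negative integer $p$ and smooth complex-valued functions $f_0,\ldots,f_p$ on $U$ such that the restriction of $D$ to $C^{\infty}(U)$ satisfies $D=\sum_{i=0}^p f_i L^i$, where $L^0$ is the identity operator on $C^\infty(U)$. Let $(U,\phi)$ be a chart on a manifold of dimension $n$ and $1\le k\le n$. A function $f\in C^\infty(U)$ does not $\phi$-depend on the first $k$ variables if $(f\circ\phi^{-1})(x_1',\ldots,x_k',x_{k+1},\ldots,x_n)=(f\circ\phi^{-1})(x_1'',\ldots,x_k'',x_{k+1},\ldots,x_n)$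 for any two points $(x_1',\ldots,x_k',x_{k+1},\ldots,x_n)$ and $(x_1'',\ldots,x_k'',x_{k+1},\ldots,x_n)$ of $\phi(U)$; not $\phi$-depending on the last $k$ variables is defined similarly. A solution $f\in C^\infty(U)$ of $Df=0$ is $\phi$-separated if there exist an integer $1\le k<n$ and functions $g,h\in C^\infty(U)$ such that $f=gh$, where $g$ does not $\phi$-depend on the first $k$ variables and $h$ does not $\phi$-depend on the last $n-k$ variables. (For $n=2$ this forces $k=1$.) *)

theory Defs
  imports "HOL-Analysis.Analysis"
begin

section \<open>Smooth maps between Euclidean spaces\<close>

text \<open>Meant for open \<open>S\<close>, where \<open>Ck_on k S f\<close> says that \<open>f\<close> is of class \<open>C\<^sup>k\<close>.\<close>

primrec Ck_on :: "nat \<Rightarrow> 'e::euclidean_space set \<Rightarrow> ('e \<Rightarrow> 'f::real_normed_vector) \<Rightarrow> bool" where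
  "Ck_on 0 S f \<longleftrightarrow> continuous_on S f"
| "Ck_on (Suc k) S f \<longleftrightarrow> (\<forall>x\<in>S. f differentiable (at x)) \<and>
      (\<forall>v. Ck_on k S (\<lambda>x. frechet_derivative f (at x) v))"

definition smooth_on :: "'e::euclidean_space set \<Rightarrow> ('e \<Rightarrow> 'f::real_normed_vector) \<Rightarrow> bool" where
  "smooth_on S f \<longleftrightarrow> (\<forall>k. Ck_on k S f)"

definition partial_deriv :: "'n::finite \<Rightarrow> (real^'n \<Rightarrow> complex) \<Rightarrow> real^'n \<Rightarrow> complex" where
  "partial_deriv i u x = frechet_derivative u (at x) (axis i 1)"

definition partial_derivs :: "'n::finite list \<Rightarrow> (real^'n \<Rightarrow> complex) \<Rightarrow> real^'n \<Rightarrow> complex" where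
  "partial_derivs is u = foldr partial_deriv is u"

section \<open>Smooth manifolds\<close>

text \<open>
  The manifold is the whole type \<open>'a\<close>, which is Hausdorff and second countable by its sort in the
  theorem; its smooth structure is given by an atlas, and its dimension is \<open>CARD('n)\<close>.
  A chart is a pair of its domain and its coordinate map; the values of the map
  outside the domain are irrelevant.
\<close>

type_synonym ('a, 'n) chart = "'a set \<times> ('a \<Rightarrow> real^'n)"

definition is_chart :: "('a::topological_space, 'n::finite) chart \<Rightarrow> bool" where
  "is_chart = (\<lambda>(U, \<phi>). open U \<and> open (\<phi> ` U) \<and> (\<exists>\<phi>'. homeomorphism U (\<phi> ` U) \<phi> \<phi>'))"

definition compatible :: "('a, 'n::finite) chart \<Rightarrow> ('a, 'n) chart \<Rightarrow> bool" where
  "compatible = (\<lambda>(U, \<phi>) (V, \<psi>).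
     smooth_on (\<phi> ` (U \<inter> V)) (\<psi> \<circ> inv_into U \<phi>) \<and>
     smooth_on (\<psi> ` (U \<inter> V)) (\<phi> \<circ> inv_into V \<psi>))"

definition smooth_atlas :: "('a::topological_space, 'n::finite) chart set \<Rightarrow> bool" where
  "smooth_atlas A \<longleftrightarrow> (\<forall>c\<in>A. is_chart c) \<and> (\<Union>c\<in>A. fst c) = UNIV \<and>
     (\<forall>c\<in>A. \<forall>d\<in>A. compatible c d)"

text \<open>The charts of the manifold are those of the maximal atlas containing \<open>A\<close>.\<close>

definition charts_of :: "('a::topological_space, 'n::finite) chart set \<Rightarrow> ('a, 'n) chart set" where
  "charts_of A = {c. is_chart c \<and> (\<forall>d\<in>A. compatible c d)}"

text \<open>
  Elements of \<open>C_inf A U\<close>, for open \<open>U\<close>, are total functions whose values outside \<open>U\<close> are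
  arbitrary; only their values on \<open>U\<close> are ever used.
\<close>

definition C_inf ::
  "('a::topological_space, 'n::finite) chart set \<Rightarrow> 'a set \<Rightarrow> ('a \<Rightarrow> complex) set" where
  "C_inf A U = {f. \<forall>(V, \<phi>) \<in> A. smooth_on (\<phi> ` (U \<inter> V)) (f \<circ> inv_into V \<phi>)}"

section \<open>Differential operators\<close>

text \<open>
  An operator is used only on \<open>C_inf A UNIV\<close>; its values on other functions are irrelevant.
  In a chart with coordinate map \<open>\<phi>\<close>, an operator of order at most \<open>p\<close> has the form
  \<open>\<Sum> a \<partial>\<^sub>i\<^sub>1 \<dots> \<partial>\<^sub>i\<^sub>r\<close> with \<open>r \<le> p\<close> and smooth coefficients. The sum is indexed by lists of
  directions instead of multi-indices. As partial derivatives of smooth functions commute, the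
  lists with the same multi-index contribute the sum of their coefficients, so the same
  operators result.
\<close>

definition DO_le ::
  "('a::topological_space, 'n::finite) chart set \<Rightarrow> nat \<Rightarrow> (('a \<Rightarrow> complex) \<Rightarrow> 'a \<Rightarrow> complex) set" where
  "DO_le A p = {D. \<forall>(U, \<phi>) \<in> charts_of A.
     \<exists>a. (\<forall>is. a is \<in> C_inf A U) \<and>
       (\<forall>f \<in> C_inf A UNIV. \<forall>m\<in>U.
          D f m = (\<Sum>is | length is \<le> p.
                     a is m * partial_derivs is (f \<circ> inv_into U \<phi>) (\<phi> m)))}"

definition DO ::
  "('a::topological_space, 'n::finite) chart set \<Rightarrow> (('a \<Rightarrow> complex) \<Rightarrow> 'a \<Rightarrow> complex) set" where
  "DO A = (\<Union>p. DO_le A p)"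

definition first_order_homogeneous ::
  "('a::topological_space, 'n::finite) chart set \<Rightarrow> (('a \<Rightarrow> complex) \<Rightarrow> 'a \<Rightarrow> complex) \<Rightarrow> bool" where
  "first_order_homogeneous A L \<longleftrightarrow> L \<in> DO_le A 1 \<and> L \<notin> DO_le A 0 \<and> (\<forall>m. L (\<lambda>_. 1) m = 0)"

definition simple_symmetry ::
  "('a::topological_space, 'n::finite) chart set \<Rightarrow> (('a \<Rightarrow> complex) \<Rightarrow> 'a \<Rightarrow> complex) \<Rightarrow>
   (('a \<Rightarrow> complex) \<Rightarrow> 'a \<Rightarrow> complex) \<Rightarrow> bool" where
  "simple_symmetry A D L \<longleftrightarrow> (\<forall>f \<in> C_inf A UNIV. \<forall>m. D (L f) m - L (D f) m = 0)"

text \<open>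
  The restriction of \<open>D\<close> to \<open>C\<^sup>\<infinity>(U)\<close>: at \<open>m \<in> U\<close>, apply \<open>D\<close> to a global smooth function
  with the same germ at \<open>m\<close> as \<open>f\<close>. Such a function exists by multiplying with a bump function,
  and the choice does not matter because differential operators are local. The value \<open>0\<close>
  outside \<open>U\<close> is a dummy.
\<close>

definition restrict_op ::
  "('a::topological_space, 'n::finite) chart set \<Rightarrow> (('a \<Rightarrow> complex) \<Rightarrow> 'a \<Rightarrow> complex) \<Rightarrow> 'a set \<Rightarrow>
   ('a \<Rightarrow> complex) \<Rightarrow> 'a \<Rightarrow> complex" where
  "restrict_op A D U f m =
     (if m \<in> U
      then D (SOME g. g \<in> C_inf A UNIV \<and> (\<exists>W. open W \<and> m \<in> W \<and> W \<subseteq> U \<and> (\<forall>x\<in>W. g x = f x))) m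
      else 0)"

definition generates ::
  "('a::topological_space, 'n::finite) chart set \<Rightarrow> (('a \<Rightarrow> complex) \<Rightarrow> 'a \<Rightarrow> complex) \<Rightarrow>
   (('a \<Rightarrow> complex) \<Rightarrow> 'a \<Rightarrow> complex) \<Rightarrow> bool" where
  "generates A L D \<longleftrightarrow>
     (\<exists>U (p::nat) c. open U \<and> U \<noteq> {} \<and> (\<forall>i\<le>p. c i \<in> C_inf A U) \<and>
        (\<forall>f \<in> C_inf A U. \<forall>m\<in>U.
           restrict_op A D U f m = (\<Sum>i\<le>p. c i m * ((restrict_op A L U ^^ i) f) m)))"

section \<open>Separated solutions\<close>

text \<open>
  For a numeral type \<open>'n\<close>, the coordinates are numbered by \<open>i = 1, \<dots>, CARD('n)\<close> via \<open>x $ of_nat i\<close>;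
  in the type \<open>2\<close> the second index is \<open>2 = 0\<close>.
\<close>

definition indep_first :: "nat \<Rightarrow> ('a, 'n::{finite,comm_ring_1}) chart \<Rightarrow> ('a \<Rightarrow> complex) \<Rightarrow> bool" where
  "indep_first k = (\<lambda>(U, \<phi>) f. \<forall>x \<in> \<phi> ` U. \<forall>y \<in> \<phi> ` U.
     (\<forall>i\<in>{k<..CARD('n)}. x $ of_nat i = y $ of_nat i) \<longrightarrow>
       (f \<circ> inv_into U \<phi>) x = (f \<circ> inv_into U \<phi>) y)"

definition indep_last :: "nat \<Rightarrow> ('a, 'n::{finite,comm_ring_1}) chart \<Rightarrow> ('a \<Rightarrow> complex) \<Rightarrow> bool" where
  "indep_last k = (\<lambda>(U, \<phi>) f. \<forall>x \<in> \<phi> ` U. \<forall>y \<in> \<phi> ` U.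
     (\<forall>i\<in>{1..CARD('n) - k}. x $ of_nat i = y $ of_nat i) \<longrightarrow>
       (f \<circ> inv_into U \<phi>) x = (f \<circ> inv_into U \<phi>) y)"

definition solution ::
  "('a::topological_space, 'n::finite) chart set \<Rightarrow> (('a \<Rightarrow> complex) \<Rightarrow> 'a \<Rightarrow> complex) \<Rightarrow>
   'a set \<Rightarrow> ('a \<Rightarrow> complex) \<Rightarrow> bool" where
  "solution A D U f \<longleftrightarrow> f \<in> C_inf A U \<and> (\<forall>m\<in>U. restrict_op A D U f m = 0)"

definition separated_solution ::
  "('a::topological_space, 'n::{finite,comm_ring_1}) chart set \<Rightarrow>
   (('a \<Rightarrow> complex) \<Rightarrow> 'a \<Rightarrow> complex) \<Rightarrow> ('a, 'n) chart \<Rightarrow> ('a \<Rightarrow> complex) \<Rightarrow> bool" where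
  "separated_solution A D = (\<lambda>(U, \<phi>) f. solution A D U f \<and>
     (\<exists>k g h. 1 \<le> k \<and> k < CARD('n) \<and> g \<in> C_inf A U \<and> h \<in> C_inf A U \<and>
        (\<forall>m\<in>U. f m = g m * h m) \<and>
        indep_first k (U, \<phi>) g \<and> indep_last (CARD('n) - k) (U, \<phi>) h))"

end

theory Submission
  imports Defs
begin

text \<open>
  A non-constant solution of \<open>D f = 0\<close> on any open set is separated after a change of chart: near a
  point where \<open>f\<close> and \<open>df\<close> do not vanish, write \<open>f = c exp (a + i b)\<close> with \<open>a\<close> and \<open>b\<close> real. If \<open>a\<close>
  and \<open>b\<close> are independent somewhere, they are coordinates, and \<open>f\<close> is the product of \<open>exp (i b)\<close> and
  \<open>c exp a\<close>; otherwise \<open>f\<close> is a function of one real coordinate alone (\<open>separated_chart\<close>). So the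
  theorem asks for one local solution with non-zero differential.

  The vector field \<open>L\<close> is complex, and cannot in general be straightened. The commutation with \<open>D\<close>
  is what makes it tractable. Choose \<open>M\<close> with \<open>L, M\<close> a frame, so that \<open>[L, M] = \<alpha> L + \<beta> M\<close>, and write
  \<open>D\<close> as a sum of terms \<open>c\<^sub>i\<^sub>j M\<^sup>i L\<^sup>j\<close>. Comparing principal symbols in \<open>[L, D] = 0\<close> gives
  \<open>L c\<^sub>i\<^sub>j + i \<beta> c\<^sub>i\<^sub>j + (i+1) \<alpha> c\<^sub>i\<^sub>+\<^sub>1\<^sub>,\<^sub>j\<^sub>-\<^sub>1 = 0\<close> for the terms of top order (\<open>commutator_top\<close>). If only
  \<open>c\<^sub>0\<^sub>n\<close> occurs in top order \<open>n\<close>, then \<open>L c\<^sub>0\<^sub>n = 0\<close>, so \<open>c\<^sub>0\<^sub>n L\<^sup>n\<close> commutes with \<open>L\<close>, and \<open>D\<close> can be replaced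
  by the rest, of lower order. As \<open>L\<close> does not generate \<open>D\<close>, one arrives at some \<open>c\<^sub>q\<^sub>j\<close>
  with \<open>q \<ge> 1\<close> maximal. The two equations for \<open>i = q\<close> and \<open>i = q - 1\<close> are exactly what is needed
  to find \<open>r\<close> and \<open>s\<close>, namely a \<open>q\<close>-th root of \<open>c\<^sub>q\<^sub>j\<close> and a function multiple of \<open>c\<^sub>q\<^sub>-\<^sub>1\<^sub>,\<^sub>j\<^sub>+\<^sub>1\<close>, such that
  \<open>r M + s L\<close> commutes with \<open>L\<close> (\<open>commuting_frame_from_top\<close>).

  In a commuting frame all coefficients of \<open>D\<close> satisfy \<open>L c\<^sub>i\<^sub>j = 0\<close>. Look for \<open>f\<close> with
  \<open>L f = \<lambda> f\<close>. Then \<open>D f = 0\<close> becomes the ordinary equation \<open>\<Sum>\<^sub>i C\<^sub>i M\<^sup>i f = 0\<close>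
  with \<open>C\<^sub>i = \<Sum>\<^sub>j c\<^sub>i\<^sub>j \<lambda>\<^sup>j\<close>, of positive order \<open>q\<close> because \<open>L\<close> does not generate \<open>D\<close>. At a
  point where some \<open>c\<^sub>q\<^sub>j\<close> does not vanish, \<open>C\<^sub>q\<close> does not vanish for all but finitely many \<open>\<lambda>\<close>.
  Together with \<open>L f = \<lambda> f\<close> the equation is a first order system for \<open>(f, M f, M\<^sup>2 f, \<dots>)\<close> that
  is solved by Picard iteration: at each step one integrates a one-form that is closed
  because \<open>L C\<^sub>i = 0\<close> (\<open>linear_system_solution\<close>). Since \<open>\<lambda> \<noteq> 0\<close>, the solution has non-zero differential
  where it does not vanish. This treats at one stroke the case that \<open>L\<close> is a multiple of a real field, where
  \<open>D f = 0\<close> amounts to a real ordinary differential equation, and the case of a complex structure,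
  where it amounts to a holomorphic one.
\<close>

section \<open>Calculus of smooth maps\<close>

lemma frechet_derivative_cong_open:
  assumes "open S" "x \<in> S" "\<And>y. y \<in> S \<Longrightarrow> f y = g y"
  shows "frechet_derivative f (at x) = frechet_derivative g (at x)"
    and "f differentiable (at x) \<longleftrightarrow> g differentiable (at x)"
proof -
  have "(f has_derivative f') (at x) \<longleftrightarrow> (g has_derivative f') (at x)" for f'
    using has_derivative_transform_within_open[of f f' x UNIV S g]
      has_derivative_transform_within_open[of g f' x UNIV S f] assms by auto
  then show "frechet_derivative f (at x) = frechet_derivative g (at x)"
    and "f differentiable (at x) \<longleftrightarrow> g differentiable (at x)"
    by (simp_all add: frechet_derivative_def differentiable_def)
qed

lemma Ck_on_cong:
  assumes "open S" "\<And>x. x \<in> S \<Longrightarrow> f x = g x"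
  shows "Ck_on k S f \<longleftrightarrow> Ck_on k S g"
  using assms(2)
proof (induction k arbitrary: f g)
  case 0
  then show ?case by (simp cong: continuous_on_cong)
next
  case (Suc k)
  have "Ck_on k S (\<lambda>x. frechet_derivative f (at x) v)
    \<longleftrightarrow> Ck_on k S (\<lambda>x. frechet_derivative g (at x) v)" for v
    using frechet_derivative_cong_open(1)[OF assms(1) _ Suc.prems] by (intro Suc.IH) simp
  then show ?case
    using frechet_derivative_cong_open(2)[OF assms(1) _ Suc.prems] by simp
qed

lemma Ck_on_subset: "Ck_on k S f \<Longrightarrow> T \<subseteq> S \<Longrightarrow> Ck_on k T f"
  by (induction k arbitrary: f) (auto intro: continuous_on_subset)

lemma Ck_on_SucI:
  assumes "open S" "\<And>x. x \<in> S \<Longrightarrow> (f has_derivative f' x) (at x)"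
    and "\<And>v. Ck_on k S (\<lambda>x. f' x v)"
  shows "Ck_on (Suc k) S f"
proof -
  have "frechet_derivative f (at x) = f' x" if "x \<in> S" for x
    using frechet_derivative_at[OF assms(2)[OF that]] by simp
  then have "Ck_on k S (\<lambda>x. frechet_derivative f (at x) v)" for v
    using Ck_on_cong[OF assms(1), of "\<lambda>x. frechet_derivative f (at x) v" "\<lambda>x. f' x v"] assms(3)
    by simp
  then show ?thesis using assms(2) by (auto simp: differentiable_def)
qed

lemma Ck_on_SucD:
  assumes "Ck_on (Suc k) S f"
  shows "x \<in> S \<Longrightarrow> (f has_derivative frechet_derivative f (at x)) (at x)"
    and "Ck_on k S (\<lambda>x. frechet_derivative f (at x) v)"
  using assms by (auto simp: frechet_derivative_works[symmetric])

lemma Ck_on_Suc_imp: "Ck_on (Suc k) S f \<Longrightarrow> Ck_on k S f"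
proof (induction k arbitrary: f)
  case 0
  then have "f differentiable at x within S" if "x \<in> S" for x
    using that by (simp add: differentiable_at_withinI)
  then show ?case by (simp add: differentiable_imp_continuous_on differentiable_on_def)
next
  case (Suc k)
  have "f differentiable (at x)" if "x \<in> S" for x
    using Suc.prems that by simp
  moreover have "Ck_on k S (\<lambda>x. frechet_derivative f (at x) v)" for v
    by (rule Suc.IH[OF Ck_on_SucD(2)[OF Suc.prems]])
  ultimately show ?case by simp
qed

lemma Ck_on_const: "open S \<Longrightarrow> Ck_on k S (\<lambda>_. c)"
proof (induction k arbitrary: c)
  case (Suc k)
  show ?case by (rule Ck_on_SucI[where f' = "\<lambda>_ _. 0"]) (use Suc in auto)
qed simp

lemma Ck_on_bounded_linear:
  assumes "open S" "bounded_linear h" "Ck_on k S f"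
  shows "Ck_on k S (\<lambda>x. h (f x))"
  using assms(3)
proof (induction k arbitrary: f)
  case 0
  then show ?case using assms(2) by (auto intro: bounded_linear.continuous_on)
next
  case (Suc k)
  show ?case
    by (rule Ck_on_SucI[OF assms(1) bounded_linear.has_derivative[OF assms(2) Ck_on_SucD(1)[OF Suc.prems]]
          Suc.IH[OF Ck_on_SucD(2)[OF Suc.prems]]])
qed

lemma Ck_on_add:
  assumes "open S" "Ck_on k S f" "Ck_on k S g"
  shows "Ck_on k S (\<lambda>x. f x + g x)"
  using assms(2,3)
proof (induction k arbitrary: f g)
  case 0
  then show ?case by (auto intro: continuous_on_add)
next
  case (Suc k)
  show ?case
    by (rule Ck_on_SucI[OF assms(1) has_derivative_add[OF
          Ck_on_SucD(1)[OF Suc.prems(1)] Ck_on_SucD(1)[OF Suc.prems(2)]]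
        Suc.IH[OF Ck_on_SucD(2)[OF Suc.prems(1)] Ck_on_SucD(2)[OF Suc.prems(2)]]])
qed

lemma Ck_on_sum:
  assumes "open S" "\<And>i. i \<in> I \<Longrightarrow> Ck_on k S (f i)"
  shows "Ck_on k S (\<lambda>x. \<Sum>i\<in>I. f i x)"
  using assms(2)
proof (induction I rule: infinite_finite_induct)
  case (insert i I)
  then show ?case using Ck_on_add[OF assms(1)] by auto
qed (auto intro: Ck_on_const assms(1))

lemma Ck_on_bilinear:
  assumes "open S" and "bounded_bilinear pr" and "Ck_on k S f" "Ck_on k S g"
  shows "Ck_on k S (\<lambda>x. pr (f x) (g x))"
  using assms(3,4)
proof (induction k arbitrary: f g)
  case 0
  then show ?case using assms(2) by (auto intro: bounded_bilinear.continuous_on)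
next
  case (Suc k)
  have "Ck_on k S (\<lambda>x. pr (f x) (frechet_derivative g (at x) v)
      + pr (frechet_derivative f (at x) v) (g x))" for v
    by (intro Ck_on_add assms(1) Suc.IH Ck_on_Suc_imp[OF Suc.prems(1)] Ck_on_Suc_imp[OF Suc.prems(2)]
        Ck_on_SucD(2)[OF Suc.prems(1)] Ck_on_SucD(2)[OF Suc.prems(2)])
  then show ?case
    by (intro Ck_on_SucI[OF assms(1) bounded_bilinear.FDERIV[OF assms(2)
          Ck_on_SucD(1)[OF Suc.prems(1)] Ck_on_SucD(1)[OF Suc.prems(2)]]])
qed

lemma Ck_on_local:
  assumes "\<And>x. x \<in> S \<Longrightarrow> \<exists>W. open W \<and> x \<in> W \<and> Ck_on k W f"
  shows "Ck_on k S f"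
  using assms
proof (induction k arbitrary: f)
  case 0
  then have "continuous (at x) f" if "x \<in> S" for x
    using that by (metis Ck_on.simps(1) continuous_on_eq_continuous_at)
  then show ?case by (auto intro: continuous_at_imp_continuous_on)
next
  case (Suc k)
  have "f differentiable (at x)" if "x \<in> S" for x
    using Suc.prems[OF that] by auto
  moreover have "Ck_on k S (\<lambda>x. frechet_derivative f (at x) v)" for v
  proof (rule Suc.IH)
    fix x assume "x \<in> S"
    from Suc.prems[OF this] obtain W where "open W" "x \<in> W" "Ck_on (Suc k) W f" by blast
    then show "\<exists>W. open W \<and> x \<in> W \<and> Ck_on k W (\<lambda>x. frechet_derivative f (at x) v)"
      using Ck_on_SucD(2) by blast
  qed
  ultimately show ?case by simp
qed

text \<open>
  The chain rule expresses the derivative through the directional derivatives of \<open>g\<close> along a basis,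
  which are the ones that the inductive hypothesis covers.
\<close>

lemma Ck_on_compose:
  assumes "open S" "open T" "f ` S \<subseteq> T" "Ck_on k S f" "Ck_on k T g"
  shows "Ck_on k S (\<lambda>x. g (f x))"
  using assms(4,5)
proof (induction k arbitrary: g)
  case 0
  then show ?case using assms(3) by (auto intro: continuous_on_compose2)
next
  case (Suc k)
  have f: "Ck_on k S f" by (rule Ck_on_Suc_imp[OF Suc.prems(1)])
  have der: "((\<lambda>x. g (f x)) has_derivative
      (\<lambda>v. \<Sum>b\<in>Basis. (frechet_derivative f (at x) v \<bullet> b) *\<^sub>R frechet_derivative g (at (f x)) b)) (at x)"
    if "x \<in> S" for x
  proof -
    have g: "(g has_derivative frechet_derivative g (at (f x))) (at (f x))"
      using that assms(3) by (intro Ck_on_SucD(1)[OF Suc.prems(2)]) auto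
    have "linear (frechet_derivative g (at (f x)))"
      using g has_derivative_linear by blast
    then have "frechet_derivative g (at (f x)) w = (\<Sum>b\<in>Basis. (w \<bullet> b) *\<^sub>R frechet_derivative g (at (f x)) b)" for w
      using linear_sum[of "frechet_derivative g (at (f x))" "\<lambda>b. (w \<bullet> b) *\<^sub>R b" Basis]
      by (simp add: linear_cmul euclidean_representation)
    then have "frechet_derivative g (at (f x)) = (\<lambda>w. \<Sum>b\<in>Basis. (w \<bullet> b) *\<^sub>R frechet_derivative g (at (f x)) b)"
      by (rule ext)
    then have "(g has_derivative (\<lambda>w. \<Sum>b\<in>Basis. (w \<bullet> b) *\<^sub>R frechet_derivative g (at (f x)) b)) (at (f x))"
      using g by simp
    from has_derivative_compose[OF Ck_on_SucD(1)[OF Suc.prems(1) that] this]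
    show ?thesis .
  qed
  show ?case
    by (rule Ck_on_SucI[OF assms(1) der], assumption)
      (intro Ck_on_sum Ck_on_bilinear[OF _ bounded_bilinear_scaleR] assms(1)
        Ck_on_bounded_linear[OF _ bounded_linear_inner_left] Ck_on_SucD(2)[OF Suc.prems(1)]
        Suc.IH[OF f Ck_on_SucD(2)[OF Suc.prems(2)]])
qed

lemma smooth_on_cong:
  "open S \<Longrightarrow> (\<And>x. x \<in> S \<Longrightarrow> f x = g x) \<Longrightarrow> smooth_on S f \<longleftrightarrow> smooth_on S g"
  unfolding smooth_on_def by (intro arg_cong[where f = All] ext Ck_on_cong)

lemma smooth_on_subset: "smooth_on S f \<Longrightarrow> T \<subseteq> S \<Longrightarrow> smooth_on T f"
  by (simp add: smooth_on_def Ck_on_subset[of _ S f T])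

lemma smooth_on_const: "open S \<Longrightarrow> smooth_on S (\<lambda>_. c)"
  by (simp add: smooth_on_def Ck_on_const)

lemma smooth_on_bounded_linear:
  "open S \<Longrightarrow> bounded_linear h \<Longrightarrow> smooth_on S f \<Longrightarrow> smooth_on S (\<lambda>x. h (f x))"
  by (simp add: smooth_on_def Ck_on_bounded_linear)

lemma smooth_on_id: "open S \<Longrightarrow> smooth_on S (\<lambda>x. x)"
  unfolding smooth_on_def
proof
  fix k assume S: "open S"
  show "Ck_on k S (\<lambda>x. x)"
  proof (cases k)
    case (Suc k')
    show ?thesis unfolding Suc
      by (rule Ck_on_SucI[OF S, where f' = "\<lambda>_ v. v"]) (auto intro: Ck_on_const[OF S])
  qed simp
qed

lemma smooth_on_linear: "open S \<Longrightarrow> bounded_linear h \<Longrightarrow> smooth_on S h"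
  using smooth_on_bounded_linear[OF _ _ smooth_on_id, of S h] by simp

lemma smooth_on_add:
  "open S \<Longrightarrow> smooth_on S f \<Longrightarrow> smooth_on S g \<Longrightarrow> smooth_on S (\<lambda>x. f x + g x)"
  by (simp add: smooth_on_def Ck_on_add)

lemma smooth_on_minus: "open S \<Longrightarrow> smooth_on S f \<Longrightarrow> smooth_on S (\<lambda>x. - f x)"
  by (rule smooth_on_bounded_linear) (simp_all add: bounded_linear_minus bounded_linear_ident)

lemma smooth_on_diff:
  "open S \<Longrightarrow> smooth_on S f \<Longrightarrow> smooth_on S g \<Longrightarrow> smooth_on S (\<lambda>x. f x - g x)"
  using smooth_on_add[OF _ _ smooth_on_minus, of S f g] by simp

lemma smooth_on_sum:
  "open S \<Longrightarrow> (\<And>i. i \<in> I \<Longrightarrow> smooth_on S (f i)) \<Longrightarrow> smooth_on S (\<lambda>x. \<Sum>i\<in>I. f i x)"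
  by (simp add: smooth_on_def Ck_on_sum)

lemma smooth_on_bilinear:
  "open S \<Longrightarrow> bounded_bilinear pr \<Longrightarrow> smooth_on S f \<Longrightarrow> smooth_on S g
    \<Longrightarrow> smooth_on S (\<lambda>x. pr (f x) (g x))"
  by (simp add: smooth_on_def Ck_on_bilinear)

lemma smooth_on_mult:
  fixes f g :: "_ \<Rightarrow> 'a::real_normed_algebra"
  shows "open S \<Longrightarrow> smooth_on S f \<Longrightarrow> smooth_on S g \<Longrightarrow> smooth_on S (\<lambda>x. f x * g x)"
  by (rule smooth_on_bilinear[OF _ bounded_bilinear_mult])

lemma smooth_on_scaleR:
  "open S \<Longrightarrow> smooth_on S f \<Longrightarrow> smooth_on S g \<Longrightarrow> smooth_on S (\<lambda>x. f x *\<^sub>R g x)"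
  by (rule smooth_on_bilinear[OF _ bounded_bilinear_scaleR])

lemma smooth_on_power:
  fixes f :: "_ \<Rightarrow> 'a::real_normed_algebra_1"
  shows "open S \<Longrightarrow> smooth_on S f \<Longrightarrow> smooth_on S (\<lambda>x. f x ^ n)"
  by (induction n) (simp_all add: smooth_on_const smooth_on_mult)

lemma smooth_on_compose:
  assumes "open S" "open T" "f ` S \<subseteq> T" "smooth_on S f" "smooth_on T g"
  shows "smooth_on S (\<lambda>x. g (f x))"
  unfolding smooth_on_def
proof
  show "Ck_on k S (\<lambda>x. g (f x))" for k
    by (rule Ck_on_compose[OF assms(1-3)]) (use assms(4,5) in \<open>simp_all only: smooth_on_def\<close>)
qed

lemma smooth_on_local:
  assumes "\<And>x. x \<in> S \<Longrightarrow> \<exists>W. open W \<and> x \<in> W \<and> smooth_on W f"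
  shows "smooth_on S f"
  unfolding smooth_on_def
proof (intro allI Ck_on_local)
  fix k x assume "x \<in> S"
  from assms[OF this] obtain W where "open W" "x \<in> W" "smooth_on W f" by blast
  then show "\<exists>W. open W \<and> x \<in> W \<and> Ck_on k W f"
    by (intro exI[of _ W]) (simp only: smooth_on_def simp_thms)
qed

lemma smooth_on_derivD:
  assumes "smooth_on S f"
  shows "x \<in> S \<Longrightarrow> (f has_derivative frechet_derivative f (at x)) (at x)"
    and "smooth_on S (\<lambda>x. frechet_derivative f (at x) v)"
proof -
  have "Ck_on (Suc k) S f" for k
    using assms by (simp only: smooth_on_def)
  from Ck_on_SucD[OF this]
  show "x \<in> S \<Longrightarrow> (f has_derivative frechet_derivative f (at x)) (at x)"
    and "smooth_on S (\<lambda>x. frechet_derivative f (at x) v)"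
    by (simp_all add: smooth_on_def)
qed

text \<open>
  Bootstrapping: if the derivative of \<open>f\<close> has a formula in which \<open>f\<close> itself occurs smoothly, then
  each order of differentiability of \<open>f\<close> gives the next one. This serves for exponentials, inverses,
  inverse functions and solutions of differential equations.
\<close>

lemma smooth_on_SucI:
  assumes "open S" "\<And>x. x \<in> S \<Longrightarrow> (f has_derivative f' x) (at x)"
    and "\<And>v k. Ck_on k S f \<Longrightarrow> Ck_on k S (\<lambda>x. f' x v)"
  shows "smooth_on S f"
  unfolding smooth_on_def
proof
  show "Ck_on k S f" for k
  proof (induction k)
    case 0
    have "f differentiable at x within S" if "x \<in> S" for x
      using assms(2)[OF that] by (auto simp: differentiable_def intro: has_derivative_at_withinI)
    then show ?case by (simp add: differentiable_imp_continuous_on differentiable_on_def)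
  next
    case (Suc k)
    show ?case by (rule Ck_on_SucI[OF assms(1,2) assms(3)[OF Suc]])
  qed
qed

lemma smooth_on_imp_continuous_on: "smooth_on S f \<Longrightarrow> continuous_on S f"
  using Ck_on.simps(1)[of S f] by (simp only: smooth_on_def)

lemma smooth_on_exp:
  fixes f :: "_ \<Rightarrow> complex"
  assumes "open S" "smooth_on S f"
  shows "smooth_on S (\<lambda>x. exp (f x))"
proof (rule smooth_on_SucI[OF assms(1)])
  show "((\<lambda>x. exp (f x)) has_derivative (\<lambda>v. frechet_derivative f (at x) v * exp (f x))) (at x)"
    if "x \<in> S" for x
    using has_derivative_compose[OF smooth_on_derivD(1)[OF assms(2) that]
        DERIV_exp[unfolded has_field_derivative_def]] by (simp add: mult.commute)
  show "Ck_on k S (\<lambda>x. frechet_derivative f (at x) v * exp (f x))"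
    if "Ck_on k S (\<lambda>x. exp (f x))" for v k
    using that smooth_on_derivD(2)[OF assms(2)]
    by (intro Ck_on_bilinear[OF assms(1) bounded_bilinear_mult]) (simp_all only: smooth_on_def)
qed

lemma smooth_on_inverse:
  fixes f :: "_ \<Rightarrow> 'a::real_normed_field"
  assumes "open S" "smooth_on S f" "\<And>x. x \<in> S \<Longrightarrow> f x \<noteq> 0"
  shows "smooth_on S (\<lambda>x. inverse (f x))"
proof (rule smooth_on_SucI[OF assms(1)])
  show "((\<lambda>x. inverse (f x)) has_derivative
      (\<lambda>v. - (inverse (f x) * frechet_derivative f (at x) v * inverse (f x)))) (at x)"
    if "x \<in> S" for x
    by (rule Deriv.has_derivative_inverse[OF assms(3) smooth_on_derivD(1)[OF assms(2) that]]) fact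
  show "Ck_on k S (\<lambda>x. - (inverse (f x) * frechet_derivative f (at x) v * inverse (f x)))"
    if "Ck_on k S (\<lambda>x. inverse (f x))" for v k
    using that smooth_on_derivD(2)[OF assms(2)]
    by (intro Ck_on_bilinear[OF assms(1) bounded_bilinear_mult]
       Ck_on_bounded_linear[OF assms(1) bounded_linear_minus[OF bounded_linear_ident]])
      (simp_all only: smooth_on_def)
qed

lemma smooth_on_divide:
  fixes f :: "_ \<Rightarrow> 'a::real_normed_field"
  assumes "open S" "smooth_on S f" "smooth_on S g" "\<And>x. x \<in> S \<Longrightarrow> g x \<noteq> 0"
  shows "smooth_on S (\<lambda>x. f x / g x)"
  unfolding divide_inverse by (intro smooth_on_mult smooth_on_inverse assms)

lemma smooth_on_Ln:
  fixes f :: "_ \<Rightarrow> complex"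
  assumes "open S" "smooth_on S f" "\<And>x. x \<in> S \<Longrightarrow> f x \<notin> \<real>\<^sub>\<le>\<^sub>0"
  shows "smooth_on S (\<lambda>x. Ln (f x))"
proof (rule smooth_on_SucI[OF assms(1)])
  have nz: "f x \<noteq> 0" if "x \<in> S" for x
    using assms(3)[OF that] by auto
  show "((\<lambda>x. Ln (f x)) has_derivative (\<lambda>v. frechet_derivative f (at x) v * inverse (f x))) (at x)"
    if "x \<in> S" for x
    using has_derivative_compose[OF smooth_on_derivD(1)[OF assms(2) that]
        has_field_derivative_Ln[OF assms(3)[OF that], unfolded has_field_derivative_def]]
    by (simp add: mult.commute)
  show "Ck_on k S (\<lambda>x. frechet_derivative f (at x) v * inverse (f x))" for v k
    using smooth_on_derivD(2)[OF assms(2)] smooth_on_inverse[OF assms(1,2) nz]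
    by (intro Ck_on_bilinear[OF assms(1) bounded_bilinear_mult]) (simp_all only: smooth_on_def)
qed

lemmas smooth_intros = smooth_on_const smooth_on_id smooth_on_add smooth_on_minus smooth_on_diff
  smooth_on_sum smooth_on_mult smooth_on_scaleR smooth_on_power smooth_on_exp smooth_on_inverse smooth_on_divide

section \<open>Partial derivatives and closed one-forms\<close>

lemma has_vector_derivative_along_line:
  assumes "(g has_derivative g') (at (p + s *\<^sub>R v))"
  shows "((\<lambda>s. g (p + s *\<^sub>R v)) has_vector_derivative g' v) (at s within X)"
proof -
  have "((\<lambda>s. p + s *\<^sub>R v) has_derivative (\<lambda>h. h *\<^sub>R v)) (at s within X)"
    by (auto intro!: derivative_eq_intros)
  from has_derivative_compose[OF this assms]
  have "((\<lambda>s. g (p + s *\<^sub>R v)) has_derivative (\<lambda>h. g' (h *\<^sub>R v))) (at s within X)" .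
  moreover have "linear g'" using assms has_derivative_linear by blast
  ultimately show ?thesis
    by (simp add: has_vector_derivative_def linear_cmul)
qed

text \<open>
  Along a parallelogram, \<open>u (x + s v + t w) - u (x + s v)\<close> is the integral of \<open>\<partial>\<^sub>w u\<close> in the direction
  \<open>w\<close>. Differentiating under the integral sign in \<open>s\<close>, and then the resulting identity in \<open>t\<close>,
  exchanges the two derivatives.
\<close>

lemma frechet_derivative_symmetric:
  fixes u :: "'e::euclidean_space \<Rightarrow> 'f::banach"
  assumes S: "open S" and u: "smooth_on S u" and x: "x \<in> S"
  shows "frechet_derivative (\<lambda>y. frechet_derivative u (at y) w) (at x) v
       = frechet_derivative (\<lambda>y. frechet_derivative u (at y) v) (at x) w"
proof -
  define V where "V y = frechet_derivative u (at y) v" for y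
  define W where "W y = frechet_derivative u (at y) w" for y
  define Wv where "Wv y = frechet_derivative W (at y) v" for y
  have smV: "smooth_on S V" and smW: "smooth_on S W"
    unfolding V_def W_def by (rule smooth_on_derivD(2)[OF u])+
  have smWv: "smooth_on S Wv"
    unfolding Wv_def by (rule smooth_on_derivD(2)[OF smW])
  obtain e where e: "e > 0" "ball x e \<subseteq> S" using S x openE by blast
  define d where "d = e / (2 * (norm v + norm w + 1))"
  have nn: "norm v + norm w + 1 > 0" by (smt (verit) norm_ge_zero)
  have d: "d > 0" unfolding d_def using e nn by (intro divide_pos_pos) auto
  have inS: "x + s *\<^sub>R v + t *\<^sub>R w \<in> S" if "\<bar>s\<bar> \<le> d" "\<bar>t\<bar> \<le> d" for s t
  proof -
    have "norm (s *\<^sub>R v + t *\<^sub>R w) \<le> d * norm v + d * norm w"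
      by (rule norm_triangle_le) (use that in \<open>auto intro!: add_mono mult_right_mono\<close>)
    also have "\<dots> < d * (norm v + norm w + 1)" using d by (simp add: algebra_simps)
    also have "\<dots> = e / 2" unfolding d_def using nn by (simp add: field_simps)
    also have "\<dots> \<le> e" using e by simp
    finally have "norm (s *\<^sub>R v + t *\<^sub>R w) < e" .
    then have "dist (x + (s *\<^sub>R v + t *\<^sub>R w)) x < e"
      by (simp add: dist_norm)
    then have "x + s *\<^sub>R v + t *\<^sub>R w \<in> ball x e"
      by (simp add: dist_commute add.assoc)
    then show ?thesis using e by blast
  qed
  have key: "V (x + t *\<^sub>R w) - V x = integral {0..t} (\<lambda>r. Wv (x + r *\<^sub>R w))"
    if t: "0 \<le> t" "t \<le> d" for t
  proof -
    let ?H = "\<lambda>s. integral (cbox 0 t) (\<lambda>r. W (x + s *\<^sub>R v + r *\<^sub>R w))"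
    have H1: "(?H has_vector_derivative integral (cbox 0 t) (\<lambda>r. Wv (x + 0 *\<^sub>R v + r *\<^sub>R w))) (at 0 within {-d..d})"
    proof (rule leibniz_rule_vector_derivative)
      show "((\<lambda>s. W (x + s *\<^sub>R v + r *\<^sub>R w)) has_vector_derivative Wv (x + s *\<^sub>R v + r *\<^sub>R w)) (at s within {-d..d})"
        if "s \<in> {-d..d}" "r \<in> cbox 0 t" for s r
      proof -
        have "x + r *\<^sub>R w + s *\<^sub>R v \<in> S"
          using inS[of s r] that t by (auto simp: abs_le_iff algebra_simps)
        from has_vector_derivative_along_line[OF smooth_on_derivD(1)[OF smW this]]
        show ?thesis by (simp add: Wv_def algebra_simps)
      qed
      show "(\<lambda>r. W (x + s *\<^sub>R v + r *\<^sub>R w)) integrable_on cbox 0 t" if "s \<in> {-d..d}" for s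
        by (intro integrable_continuous continuous_on_compose2[OF smooth_on_imp_continuous_on[OF smW]]
            continuous_intros) (use inS[of s] that t in \<open>auto simp: abs_le_iff\<close>)
      show "continuous_on ({-d..d} \<times> cbox 0 t) (\<lambda>(s, r). Wv (x + s *\<^sub>R v + r *\<^sub>R w))"
        unfolding split_beta
        by (intro continuous_on_compose2[OF smooth_on_imp_continuous_on[OF smWv]]
            continuous_intros) (use inS t in \<open>auto simp: abs_le_iff\<close>)
    qed (use d in auto)
    have H2: "?H s = u (x + s *\<^sub>R v + t *\<^sub>R w) - u (x + s *\<^sub>R v)" if "s \<in> {-d..d}" for s
    proof -
      have "((\<lambda>r. W (x + s *\<^sub>R v + r *\<^sub>R w)) has_integral
          u (x + s *\<^sub>R v + t *\<^sub>R w) - u (x + s *\<^sub>R v + 0 *\<^sub>R w)) {0..t}"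
      proof (rule fundamental_theorem_of_calculus[OF t(1)])
        fix r assume "r \<in> {0..t}"
        then have "x + s *\<^sub>R v + r *\<^sub>R w \<in> S"
          using inS[of s r] that t by (auto simp: abs_le_iff)
        from has_vector_derivative_along_line[OF smooth_on_derivD(1)[OF u this]]
        show "((\<lambda>r. u (x + s *\<^sub>R v + r *\<^sub>R w)) has_vector_derivative W (x + s *\<^sub>R v + r *\<^sub>R w)) (at r within {0..t})"
          by (simp add: W_def)
      qed
      then show ?thesis by (simp add: integral_unique)
    qed
    have "((\<lambda>s. u (x + s *\<^sub>R v + t *\<^sub>R w) - u (x + s *\<^sub>R v)) has_vector_derivative
        integral (cbox 0 t) (\<lambda>r. Wv (x + 0 *\<^sub>R v + r *\<^sub>R w))) (at 0 within {-d..d})"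
      by (rule has_vector_derivative_transform[OF _ _ H1]) (use d H2 in simp_all)
    moreover have "((\<lambda>s. u (x + s *\<^sub>R v + t *\<^sub>R w) - u (x + s *\<^sub>R v)) has_vector_derivative
        V (x + t *\<^sub>R w) - V x) (at 0 within {-d..d})"
    proof (rule has_vector_derivative_diff)
      have "x + t *\<^sub>R w + 0 *\<^sub>R v \<in> S" using inS[of 0 t] t by simp
      from has_vector_derivative_along_line[OF smooth_on_derivD(1)[OF u this]]
      show "((\<lambda>s. u (x + s *\<^sub>R v + t *\<^sub>R w)) has_vector_derivative V (x + t *\<^sub>R w)) (at 0 within {-d..d})"
        by (simp add: V_def algebra_simps)
      have "x + 0 *\<^sub>R v \<in> S" using x by simp
      from has_vector_derivative_along_line[OF smooth_on_derivD(1)[OF u this]]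
      show "((\<lambda>s. u (x + s *\<^sub>R v)) has_vector_derivative V x) (at 0 within {-d..d})"
        by (simp add: V_def)
    qed
    ultimately have "integral (cbox 0 t) (\<lambda>r. Wv (x + 0 *\<^sub>R v + r *\<^sub>R w)) = V (x + t *\<^sub>R w) - V x"
      using d by (intro vector_derivative_unique_within_closed_interval[of "-d" d 0]) auto
    then show ?thesis by simp
  qed
  have "((\<lambda>t. integral {0..t} (\<lambda>r. Wv (x + r *\<^sub>R w))) has_vector_derivative Wv (x + 0 *\<^sub>R w)) (at 0 within {0..d})"
    using d inS[of 0]
    by (intro integral_has_vector_derivative continuous_on_compose2[OF smooth_on_imp_continuous_on[OF smWv]] continuous_intros)
      (auto simp: abs_le_iff)
  then have "((\<lambda>t. V (x + t *\<^sub>R w) - V x) has_vector_derivative Wv x) (at 0 within {0..d})"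
    by (subst (asm) (1) scaleR_zero_left, subst (asm) add_0_right)
      (rule has_vector_derivative_transform[rotated 2], use d key in simp_all)
  moreover have "((\<lambda>t. V (x + t *\<^sub>R w) - V x) has_vector_derivative frechet_derivative V (at x) w - 0) (at 0 within {0..d})"
  proof (intro has_vector_derivative_diff has_vector_derivative_const)
    have "x + 0 *\<^sub>R w \<in> S" using x by simp
    from has_vector_derivative_along_line[OF smooth_on_derivD(1)[OF smV this]]
    show "((\<lambda>t. V (x + t *\<^sub>R w)) has_vector_derivative frechet_derivative V (at x) w) (at 0 within {0..d})"
      by simp
  qed
  ultimately have "Wv x = frechet_derivative V (at x) w - 0"
    using d by (intro vector_derivative_unique_within_closed_interval[of 0 d 0]) auto
  then show ?thesis by (simp add: Wv_def V_def[abs_def] W_def[abs_def])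
qed

lemma linear_axis_expansion:
  fixes h :: "real^'n \<Rightarrow> 'b::real_vector"
  assumes "linear h"
  shows "h v = (\<Sum>i\<in>UNIV. (v $ i) *\<^sub>R h (axis i 1))"
proof -
  have "h v = h (\<Sum>i\<in>UNIV. (v $ i) *\<^sub>R axis i 1)"
    by (simp add: basis_expansion flip: scalar_mult_eq_scaleR)
  then show ?thesis using assms by (simp add: linear_sum linear_cmul)
qed

lemma has_derivative_partial_deriv:
  assumes "smooth_on S u" "x \<in> S"
  shows "(u has_derivative (\<lambda>v. \<Sum>i\<in>UNIV. (v $ i) *\<^sub>R partial_deriv i u x)) (at x)"
proof -
  have u: "(u has_derivative frechet_derivative u (at x)) (at x)"
    by (rule smooth_on_derivD(1)[OF assms])
  have "(\<lambda>v. \<Sum>i\<in>UNIV. (v $ i) *\<^sub>R partial_deriv i u x) = frechet_derivative u (at x)"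
    unfolding partial_deriv_def
    by (rule ext, rule linear_axis_expansion[OF has_derivative_linear[OF u], symmetric])
  with u show ?thesis by (simp only:)
qed

lemma partial_deriv_eqI: "(u has_derivative u') (at x) \<Longrightarrow> partial_deriv i u x = u' (axis i 1)"
  unfolding partial_deriv_def using frechet_derivative_at by metis

lemma smooth_on_partial_deriv: "smooth_on S u \<Longrightarrow> smooth_on S (partial_deriv i u)"
  using smooth_on_derivD(2)[of S u "axis i 1"] by (simp add: partial_deriv_def[abs_def])

lemma partial_deriv_commute:
  "open S \<Longrightarrow> smooth_on S u \<Longrightarrow> x \<in> S \<Longrightarrow>
    partial_deriv i (partial_deriv j u) x = partial_deriv j (partial_deriv i u) x"
  using frechet_derivative_symmetric[of S u x "axis j 1" "axis i 1"]
  by (simp add: partial_deriv_def[abs_def])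

lemma partial_deriv_cong:
  assumes "open S" "x \<in> S" "\<And>y. y \<in> S \<Longrightarrow> u y = w y"
  shows "partial_deriv i u x = partial_deriv i w x"
  unfolding partial_deriv_def using frechet_derivative_cong_open(1)[OF assms] by simp

lemma partial_deriv_const: "partial_deriv i (\<lambda>_. c) x = 0"
  by (rule partial_deriv_eqI[where u' = "\<lambda>_. 0", simplified]) simp

lemma partial_deriv_add:
  assumes "smooth_on S u" "smooth_on S w" "x \<in> S"
  shows "partial_deriv i (\<lambda>y. u y + w y) x = partial_deriv i u x + partial_deriv i w x"
  using partial_deriv_eqI[OF has_derivative_add[OF smooth_on_derivD(1)[OF assms(1,3)]
        smooth_on_derivD(1)[OF assms(2,3)]]] by (simp add: partial_deriv_def)

lemma partial_deriv_mult:
  assumes "smooth_on S u" "smooth_on S w" "x \<in> S"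
  shows "partial_deriv i (\<lambda>y. u y * w y) x = partial_deriv i u x * w x + u x * partial_deriv i w x"
  using partial_deriv_eqI[OF has_derivative_mult[OF smooth_on_derivD(1)[OF assms(1,3)]
        smooth_on_derivD(1)[OF assms(2,3)]]] by (simp add: partial_deriv_def)

lemma partial_deriv_exp:
  assumes "smooth_on S u" "x \<in> S"
  shows "partial_deriv i (\<lambda>y. exp (u y)) x = exp (u x) * partial_deriv i u x"
  using partial_deriv_eqI[OF has_derivative_compose[OF smooth_on_derivD(1)[OF assms]
        DERIV_exp[unfolded has_field_derivative_def]]] by (simp add: partial_deriv_def)

lemma partial_deriv_Ln:
  assumes "smooth_on S u" "x \<in> S" "u x \<notin> \<real>\<^sub>\<le>\<^sub>0"
  shows "partial_deriv i (\<lambda>y. Ln (u y)) x = partial_deriv i u x / u x"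
  using partial_deriv_eqI[OF has_derivative_compose[OF smooth_on_derivD(1)[OF assms(1,2)]
        has_field_derivative_Ln[OF assms(3), unfolded has_field_derivative_def]]]
  by (simp add: partial_deriv_def field_simps)

lemma partial_deriv_coordinate:
  "partial_deriv i (\<lambda>y. complex_of_real (y $ j - c)) x = (if i = j then 1 else 0)"
proof -
  have "((\<lambda>y. complex_of_real (y $ j - c)) has_derivative (\<lambda>v. of_real (v $ j))) (at x)"
    by (auto intro!: derivative_eq_intros bounded_linear.has_derivative[OF bounded_linear_of_real]
       bounded_linear.has_derivative[OF bounded_linear_vec_nth])
  from partial_deriv_eqI[OF this] show ?thesis by (auto simp: axis_def)
qed

lemma smooth_on_coordinate:
  "open S \<Longrightarrow> smooth_on S (\<lambda>y. complex_of_real (y $ j - c))"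
  by (intro smooth_on_bounded_linear[OF _ bounded_linear_of_real] smooth_intros
    smooth_on_linear bounded_linear_vec_nth)

lemma smooth_on_partialsI:
  assumes "open S" "\<And>x. x \<in> S \<Longrightarrow> (u has_derivative (\<lambda>v. \<Sum>i\<in>UNIV. (v $ i) *\<^sub>R p i x)) (at x)"
    and "\<And>i k. Ck_on k S u \<Longrightarrow> Ck_on k S (p i)"
  shows "smooth_on S u"
  by (rule smooth_on_SucI[OF assms(1,2)])
    (auto intro!: Ck_on_sum Ck_on_bounded_linear[OF _ bounded_linear_scaleR_right] assms(1,3))

lemma smooth_on_vec:
  fixes g :: "'n::finite \<Rightarrow> 'e::euclidean_space \<Rightarrow> real"
  assumes "open S" "\<And>i. smooth_on S (g i)"
  shows "smooth_on S (\<lambda>x. \<chi> i. g i x)"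
proof -
  have "(\<chi> i. g i x) = (\<Sum>i\<in>UNIV. g i x *\<^sub>R axis i 1)" for x
    using basis_expansion[of "\<chi> i. g i x"] by (simp flip: scalar_mult_eq_scaleR)
  then show ?thesis
    by (simp add: smooth_on_sum smooth_on_scaleR smooth_on_const assms)
qed

text \<open>
  The Poincare lemma for one-forms on a ball. The primitive is the integral along the rays from the
  centre; by closedness, its derivative is the integral of the derivative of \<open>t p\<^sub>i (c + t (x - c))\<close> in \<open>t\<close>.
\<close>

lemma closed_form_has_primitive:
  fixes p :: "'n::finite \<Rightarrow> real^'n \<Rightarrow> complex"
  assumes p: "\<And>i. smooth_on (ball c R) (p i)"
    and closed: "\<And>i j x. x \<in> ball c R \<Longrightarrow> partial_deriv i (p j) x = partial_deriv j (p i) x"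
  obtains G where "\<And>x. x \<in> ball c R \<Longrightarrow> (G has_derivative (\<lambda>v. \<Sum>i\<in>UNIV. (v $ i) *\<^sub>R p i x)) (at x)"
    and "G c = 0"
proof -
  define y where "y x t = c + t *\<^sub>R (x - c)" for x :: "real^'n" and t :: real
  have yin: "y x t \<in> ball c R" if "x \<in> ball c R" "t \<in> {0..1}" for x t
  proof -
    have "norm (t *\<^sub>R (x - c)) \<le> 1 * norm (x - c)"
      using that by (simp add: mult_right_mono mult_left_le_one_le)
    then show ?thesis using that by (simp add: y_def dist_norm norm_minus_commute)
  qed
  let ?D = "\<lambda>j x. frechet_derivative (p j) (at x)"
  define f where "f x t = (\<Sum>j\<in>UNIV. (x $ j - c $ j) *\<^sub>R p j (y x t))" for x t
  define f' where "f' x t v = (\<Sum>j\<in>UNIV. (v $ j) *\<^sub>R p j (y x t) + (x $ j - c $ j) *\<^sub>R (?D j (y x t) (t *\<^sub>R v)))" for x t v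
  have Dlin: "linear (?D j x)" if "x \<in> ball c R" for j x
    using smooth_on_derivD(1)[OF p that] has_derivative_linear by blast
  have fder: "((\<lambda>x. f x t) has_derivative f' x t) (at x within ball c R)" if "x \<in> ball c R" "t \<in> {0..1}" for x t
  proof -
    have "((\<lambda>x. y x t) has_derivative (\<lambda>v. t *\<^sub>R v)) (at x within ball c R)"
      unfolding y_def by (auto intro!: derivative_eq_intros)
    from has_derivative_compose[OF this smooth_on_derivD(1)[OF p yin[OF that]]]
    have "((\<lambda>x. p j (y x t)) has_derivative (\<lambda>v. ?D j (y x t) (t *\<^sub>R v))) (at x within ball c R)" for j .
    moreover have "((\<lambda>x. x $ j - c $ j) has_derivative (\<lambda>v. v $ j)) (at x within ball c R)" for j
      by (auto intro!: derivative_eq_intros bounded_linear.has_derivative[OF bounded_linear_vec_nth])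
    ultimately have "((\<lambda>x. (x $ j - c $ j) *\<^sub>R p j (y x t)) has_derivative
       (\<lambda>v. (x $ j - c $ j) *\<^sub>R (?D j (y x t) (t *\<^sub>R v)) + (v $ j) *\<^sub>R p j (y x t))) (at x within ball c R)" for j
      by (rule has_derivative_scaleR[rotated])
    from has_derivative_sum[of UNIV, OF this] show ?thesis
      unfolding f_def f'_def by (simp add: add.commute)
  qed
  have contp: "continuous_on (ball c R \<times> {0..1}) (\<lambda>z. p j (y (fst z) (snd z)))" for j
    by (rule continuous_on_compose2[OF smooth_on_imp_continuous_on[OF p]])
      (use yin in \<open>auto simp: y_def intro!: continuous_intros\<close>)
  have contD: "continuous_on (ball c R \<times> {0..1}) (\<lambda>z. ?D j (y (fst z) (snd z)) v)" for j v
    by (rule continuous_on_compose2[OF smooth_on_imp_continuous_on[OF smooth_on_derivD(2)[OF p, of _ v]]])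
      (use yin in \<open>auto simp: y_def intro!: continuous_intros\<close>)
  have f'lin: "bounded_linear (f' x t)" if "x \<in> ball c R" "t \<in> {0..1}" for x t
    by (rule has_derivative_bounded_linear[OF fder[OF that]])
  have f'eq: "f' x t v = (\<Sum>j\<in>UNIV. (v $ j) *\<^sub>R p j (y x t) + (x $ j - c $ j) *\<^sub>R (t *\<^sub>R ?D j (y x t) v))"
    if "x \<in> ball c R" "t \<in> {0..1}" for x t v
    unfolding f'_def using linear_cmul[OF Dlin[OF yin[OF that]]] by simp
  have contf': "continuous_on (ball c R \<times> {0..1}) (\<lambda>z. f' (fst z) (snd z) v)" for v
  proof -
    have "continuous_on (ball c R \<times> {0..1}) (\<lambda>z. (\<Sum>j\<in>UNIV. (v $ j) *\<^sub>R p j (y (fst z) (snd z))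
        + (fst z $ j - c $ j) *\<^sub>R (snd z *\<^sub>R ?D j (y (fst z) (snd z)) v)))"
      by (intro continuous_intros contp contD)
    then show ?thesis by (rule continuous_on_eq) (use f'eq in auto)
  qed
  have contPair: "continuous_on {0..1} (\<lambda>t::real. (x, t))" for x :: "real^'n"
    by (intro continuous_on_Pair continuous_on_const continuous_on_id)
  define F where "F x t = Blinfun (f' x t)" for x t
  have F: "blinfun_apply (F x t) = f' x t" if "x \<in> ball c R" "t \<in> {0..1}" for x t
    unfolding F_def by (rule bounded_linear_Blinfun_apply[OF f'lin[OF that]])
  have contF: "continuous_on (ball c R \<times> {0..1}) (\<lambda>z. F (fst z) (snd z))"
  proof (rule continuous_on_blinfun_componentwise)
    fix i :: "real^'n"
    show "continuous_on (ball c R \<times> {0..1}) (\<lambda>z. blinfun_apply (F (fst z) (snd z)) i)"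
      by (rule continuous_on_eq[OF contf'[of i]]) (use F in auto)
  qed
  define G where "G x = integral (cbox 0 1) (f x)" for x
  have "(G has_derivative (\<lambda>v. \<Sum>i\<in>UNIV. (v $ i) *\<^sub>R p i x)) (at x)" if x: "x \<in> ball c R" for x
  proof -
    have 1: "(G has_derivative blinfun_apply (integral (cbox 0 1) (F x))) (at x within ball c R)"
      unfolding G_def
    proof (rule leibniz_rule)
      show "f x integrable_on cbox 0 1" if "x \<in> ball c R" for x
      proof (rule integrable_continuous)
        have "continuous_on (cbox 0 1) (\<lambda>t. p j (y x t))" for j
          using continuous_on_compose2[OF contp[of j] contPair[of x]] that
          by (simp add: image_subset_iff)
        then show "continuous_on (cbox 0 1) (f x)"
          unfolding f_def by (intro continuous_intros)
      qed
      show "continuous_on (ball c R \<times> cbox 0 1) (\<lambda>(x, t). F x t)"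
        using contF by (simp add: split_beta)
    qed (use x F fder in auto)
    have contFx: "continuous_on {0..1} (F x)"
      using continuous_on_compose2[OF contF contPair[of x]] x by (simp add: image_subset_iff)
    have "blinfun_apply (integral (cbox 0 1) (F x)) v = (\<Sum>i\<in>UNIV. (v $ i) *\<^sub>R p i x)" for v
    proof -
      have "((\<lambda>t. f' x t v) has_integral
          (\<Sum>i\<in>UNIV. (v $ i) *\<^sub>R (1 *\<^sub>R p i (y x 1))) - (\<Sum>i\<in>UNIV. (v $ i) *\<^sub>R (0 *\<^sub>R p i (y x 0)))) {0..1}"
      proof (rule fundamental_theorem_of_calculus)
        fix t :: real assume t: "t \<in> {0..1}"
        have d1: "((\<lambda>t. p i (y x t)) has_vector_derivative ?D i (y x t) (x - c)) (at t within {0..1})" for i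
          using has_vector_derivative_along_line[of "p i" "?D i (y x t)" c t "x - c"]
            smooth_on_derivD(1)[OF p yin[OF x t]] by (simp add: y_def)
        have "((\<lambda>t. \<Sum>i\<in>UNIV. (v $ i) *\<^sub>R (t *\<^sub>R p i (y x t))) has_vector_derivative
          (\<Sum>i\<in>UNIV. (v $ i) *\<^sub>R (t *\<^sub>R ?D i (y x t) (x - c) + 1 *\<^sub>R p i (y x t)))) (at t within {0..1})"
          by (intro has_vector_derivative_sum bounded_linear.has_vector_derivative[OF bounded_linear_scaleR_right]
              has_vector_derivative_scaleR d1 DERIV_ident)
        moreover have "(\<Sum>i\<in>UNIV. (v $ i) *\<^sub>R (t *\<^sub>R ?D i (y x t) (x - c) + 1 *\<^sub>R p i (y x t))) = f' x t v"
        proof -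
          have e: "?D i (y x t) w = (\<Sum>j\<in>UNIV. (w $ j) *\<^sub>R partial_deriv j (p i) (y x t))" for i w
            unfolding partial_deriv_def by (rule linear_axis_expansion[OF Dlin[OF yin[OF x t]]])
          have "(\<Sum>i\<in>UNIV. (v $ i) *\<^sub>R ?D i (y x t) (x - c))
              = (\<Sum>i\<in>UNIV. \<Sum>j\<in>UNIV. (v $ i * (x $ j - c $ j)) *\<^sub>R partial_deriv j (p i) (y x t))"
            by (simp add: e scaleR_sum_right)
          also have "\<dots> = (\<Sum>i\<in>UNIV. \<Sum>j\<in>UNIV. (v $ i * (x $ j - c $ j)) *\<^sub>R partial_deriv i (p j) (y x t))"
            using closed[OF yin[OF x t]] by simp
          also have "\<dots> = (\<Sum>j\<in>UNIV. \<Sum>i\<in>UNIV. (v $ i * (x $ j - c $ j)) *\<^sub>R partial_deriv i (p j) (y x t))"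
            by (rule sum.swap)
          also have "\<dots> = (\<Sum>j\<in>UNIV. (x $ j - c $ j) *\<^sub>R ?D j (y x t) v)"
            by (simp add: e scaleR_sum_right mult.commute)
          finally have "(\<Sum>i\<in>UNIV. (v $ i) *\<^sub>R ?D i (y x t) (x - c)) = (\<Sum>j\<in>UNIV. (x $ j - c $ j) *\<^sub>R ?D j (y x t) v)" .
          then have "t *\<^sub>R (\<Sum>i\<in>UNIV. (v $ i) *\<^sub>R ?D i (y x t) (x - c)) = t *\<^sub>R (\<Sum>j\<in>UNIV. (x $ j - c $ j) *\<^sub>R ?D j (y x t) v)"
            by simp
          then show ?thesis
            unfolding f'eq[OF x t] by (simp add: scaleR_sum_right scaleR_right_distrib sum.distrib mult.commute)
        qed
        ultimately show "((\<lambda>t. \<Sum>i\<in>UNIV. (v $ i) *\<^sub>R (t *\<^sub>R p i (y x t))) has_vector_derivative f' x t v) (at t within {0..1})"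
          by simp
      qed simp
      then have "integral {0..1} (\<lambda>t. f' x t v) = (\<Sum>i\<in>UNIV. (v $ i) *\<^sub>R p i x)"
        by (simp add: integral_unique y_def)
      moreover have "blinfun_apply (integral (cbox 0 1) (F x)) v = integral {0..1} (\<lambda>t. blinfun_apply (F x t) v)"
        using contFx by (subst blinfun_apply_integral) (auto intro: integrable_continuous_interval)
      moreover have "\<dots> = integral {0..1} (\<lambda>t. f' x t v)"
        by (rule integral_cong) (use F x in auto)
      ultimately show ?thesis by simp
    qed
    then have "blinfun_apply (integral (cbox 0 1) (F x)) = (\<lambda>v. \<Sum>i\<in>UNIV. (v $ i) *\<^sub>R p i x)" by (rule ext)
    then show ?thesis using 1 x by (simp add: at_within_open[OF _ open_ball])
  qed
  moreover have "G c = 0" unfolding G_def f_def by simp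
  ultimately show ?thesis using that by blast
qed

section \<open>Complex vector fields\<close>

definition vf :: "('n::finite \<Rightarrow> real^'n \<Rightarrow> complex) \<Rightarrow> (real^'n \<Rightarrow> complex) \<Rightarrow> real^'n \<Rightarrow> complex" where
  "vf X u x = (\<Sum>i\<in>UNIV. X i x * partial_deriv i u x)"

definition bracket ::
  "('n::finite \<Rightarrow> real^'n \<Rightarrow> complex) \<Rightarrow> ('n \<Rightarrow> real^'n \<Rightarrow> complex) \<Rightarrow> 'n \<Rightarrow> real^'n \<Rightarrow> complex" where
  "bracket X Y k x = vf X (Y k) x - vf Y (X k) x"

lemma vf_cong:
  "open S \<Longrightarrow> x \<in> S \<Longrightarrow> (\<And>y. y \<in> S \<Longrightarrow> u y = w y) \<Longrightarrow> vf X u x = vf X w x"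
  unfolding vf_def by (metis (no_types, lifting) partial_deriv_cong)

lemma smooth_on_vf:
  "open S \<Longrightarrow> (\<And>i. smooth_on S (X i)) \<Longrightarrow> smooth_on S u \<Longrightarrow> smooth_on S (vf X u)"
  unfolding vf_def[abs_def] by (intro smooth_intros smooth_on_partial_deriv)

lemma vf_const: "vf X (\<lambda>_. c) x = 0"
  by (simp add: vf_def partial_deriv_const)

lemma vf_add:
  assumes "smooth_on S u" "smooth_on S w" "x \<in> S"
  shows "vf X (\<lambda>y. u y + w y) x = vf X u x + vf X w x"
  by (simp add: vf_def partial_deriv_add[OF assms] distrib_left sum.distrib)

lemma vf_mult:
  assumes "smooth_on S u" "smooth_on S w" "x \<in> S"
  shows "vf X (\<lambda>y. u y * w y) x = vf X u x * w x + u x * vf X w x"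
  by (simp add: vf_def partial_deriv_mult[OF assms] distrib_left sum.distrib sum_distrib_left
      sum_distrib_right mult_ac)

lemma vf_cmult:
  assumes "open S" "smooth_on S u" "x \<in> S"
  shows "vf X (\<lambda>y. c * u y) x = c * vf X u x"
  using vf_mult[OF smooth_on_const[OF assms(1)] assms(2,3), of X c] by (simp add: vf_const)

lemma vf_sum:
  assumes "open S" "\<And>i. i \<in> I \<Longrightarrow> smooth_on S (u i)" "x \<in> S"
  shows "vf X (\<lambda>y. \<Sum>i\<in>I. u i y) x = (\<Sum>i\<in>I. vf X (u i) x)"
  using assms(2)
proof (induction I rule: infinite_finite_induct)
  case (insert i I)
  then show ?case
    using vf_add[of S "u i" "\<lambda>y. \<Sum>i\<in>I. u i y" x X] assms(1,3) by (auto intro: smooth_on_sum)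
qed (auto simp: vf_const)

lemma vf_exp:
  assumes "smooth_on S u" "x \<in> S"
  shows "vf X (\<lambda>y. exp (u y)) x = exp (u x) * vf X u x"
  by (simp add: vf_def partial_deriv_exp[OF assms] sum_distrib_left mult_ac)

lemma vf_Ln:
  assumes "smooth_on S u" "x \<in> S" "u x \<notin> \<real>\<^sub>\<le>\<^sub>0"
  shows "vf X (\<lambda>y. Ln (u y)) x = vf X u x / u x"
  by (simp add: vf_def partial_deriv_Ln[OF assms] sum_divide_distrib)

lemma vf_power:
  assumes "open S" "smooth_on S u" "x \<in> S"
  shows "vf X (\<lambda>y. u y ^ n) x = of_nat n * u x ^ (n - 1) * vf X u x"
proof (induction n)
  case (Suc n)
  show ?case
    using vf_mult[OF assms(2) smooth_on_power[OF assms(1,2), of n] assms(3), of X] Suc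
    by (cases n) (simp_all add: algebra_simps)
qed (simp add: vf_const)

text \<open>
  The second order terms cancel because partial derivatives commute.
\<close>

lemma vf_commutator:
  fixes X Y :: "'n::finite \<Rightarrow> real^'n \<Rightarrow> complex"
  assumes S: "open S" and X: "\<And>i. smooth_on S (X i)" and Y: "\<And>i. smooth_on S (Y i)"
    and u: "smooth_on S u" and x: "x \<in> S"
  shows "vf X (vf Y u) x - vf Y (vf X u) x = vf (bracket X Y) u x"
proof -
  have *: "vf X (vf Y u) x = (\<Sum>k\<in>UNIV. vf X (Y k) x * partial_deriv k u x)
      + (\<Sum>i\<in>UNIV. \<Sum>k\<in>UNIV. X i x * Y k x * partial_deriv i (partial_deriv k u) x)"
    if X: "\<And>i. smooth_on S (X i)" and Y: "\<And>i. smooth_on S (Y i)" for X Y :: "'n \<Rightarrow> real^'n \<Rightarrow> complex"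
  proof -
    have "vf X (vf Y u) x = (\<Sum>k\<in>UNIV. vf X (\<lambda>y. Y k y * partial_deriv k u y) x)"
      unfolding vf_def[of Y, abs_def]
      by (rule vf_sum[OF S _ x]) (intro smooth_on_mult S Y smooth_on_partial_deriv u)
    also have "\<dots> = (\<Sum>k\<in>UNIV. vf X (Y k) x * partial_deriv k u x + Y k x * vf X (partial_deriv k u) x)"
      by (intro sum.cong refl vf_mult[OF Y smooth_on_partial_deriv[OF u] x])
    also have "\<dots> = (\<Sum>k\<in>UNIV. vf X (Y k) x * partial_deriv k u x)
      + (\<Sum>k\<in>UNIV. \<Sum>i\<in>UNIV. X i x * Y k x * partial_deriv i (partial_deriv k u) x)"
      by (simp add: sum.distrib vf_def[of X "partial_deriv _ u"] sum_distrib_left mult_ac)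
    also have "(\<Sum>k\<in>UNIV. \<Sum>i\<in>UNIV. X i x * Y k x * partial_deriv i (partial_deriv k u) x)
      = (\<Sum>i\<in>UNIV. \<Sum>k\<in>UNIV. X i x * Y k x * partial_deriv i (partial_deriv k u) x)"
      by (rule sum.swap)
    finally show ?thesis .
  qed
  have "(\<Sum>i\<in>UNIV. \<Sum>k\<in>UNIV. Y i x * X k x * partial_deriv i (partial_deriv k u) x)
      = (\<Sum>k\<in>UNIV. \<Sum>i\<in>UNIV. Y i x * X k x * partial_deriv i (partial_deriv k u) x)"
    by (rule sum.swap)
  also have "\<dots> = (\<Sum>k\<in>UNIV. \<Sum>i\<in>UNIV. X k x * Y i x * partial_deriv k (partial_deriv i u) x)"
    by (intro sum.cong refl) (simp add: partial_deriv_commute[OF S u x] mult_ac)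
  finally show ?thesis
    unfolding *[OF X Y] *[OF Y X] vf_def[of "bracket X Y"] bracket_def
    by (simp add: left_diff_distrib sum_subtractf)
qed

lemma smooth_on_bracket:
  "open S \<Longrightarrow> (\<And>i. smooth_on S (X i)) \<Longrightarrow> (\<And>i. smooth_on S (Y i)) \<Longrightarrow> smooth_on S (bracket X Y k)"
  unfolding bracket_def[abs_def] by (intro smooth_on_diff smooth_on_vf)

section \<open>Words in vector fields\<close>

abbreviation word where "word Xs u \<equiv> foldr vf Xs u"

lemma word_cong:
  assumes "open S" "\<And>y. y \<in> S \<Longrightarrow> u y = w y" "x \<in> S"
  shows "word Xs u x = word Xs w x"
  using assms(3)
proof (induction Xs arbitrary: x)
  case (Cons X Xs)
  then show ?case by (auto intro: vf_cong[OF assms(1)])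
qed (use assms(2) in auto)

lemma smooth_on_prod_list:
  "open S \<Longrightarrow> (\<And>X. X \<in> set Xs \<Longrightarrow> smooth_on S (f X)) \<Longrightarrow> smooth_on S (\<lambda>x. \<Prod>X\<leftarrow>Xs. (f X x :: complex))"
  by (induction Xs) (auto intro: smooth_on_const smooth_on_mult)

text \<open>
  Each vector field applied to a power of \<open>g\<close> lowers the exponent by one and contributes a factor; all
  other terms keep a higher power of \<open>g\<close>. At a zero of \<open>g\<close> this isolates the principal symbol.
\<close>

lemma word_power:
  fixes g :: "real^'n \<Rightarrow> complex"
  assumes S: "open S" and g: "smooth_on S g"
    and "\<And>X i. X \<in> set Xs \<Longrightarrow> smooth_on S (X i)" and "length Xs + m = n"
  shows "\<exists>h. smooth_on S h \<and> (\<forall>x\<in>S. word Xs (\<lambda>y. g y ^ n) x =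
     fact n / fact m * (\<Prod>X\<leftarrow>Xs. vf X g x) * g x ^ m + g x ^ Suc m * h x)"
  using assms(3,4)
proof (induction Xs arbitrary: m)
  case Nil
  then show ?case using smooth_on_const[OF S] by (intro exI[of _ "\<lambda>_. 0"]) simp
next
  case (Cons X Xs)
  let ?P = "\<lambda>x. \<Prod>X\<leftarrow>Xs. vf X g x"
  let ?c = "fact n / fact (Suc m) :: complex"
  obtain h where h: "smooth_on S h" and eq: "\<And>x. x \<in> S \<Longrightarrow> word Xs (\<lambda>y. g y ^ n) x =
     ?c * ?P x * g x ^ Suc m + g x ^ Suc (Suc m) * h x"
    using Cons.IH[of "Suc m"] Cons.prems by auto
  have P: "smooth_on S ?P"
    by (rule smooth_on_prod_list[OF S]) (use Cons.prems in \<open>auto intro: smooth_on_vf[OF S _ g]\<close>)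
  have cP: "smooth_on S (\<lambda>x. ?c * ?P x)" by (intro smooth_intros S P)
  have X: "smooth_on S (X i)" for i using Cons.prems by simp
  note pw = smooth_on_power[OF S g]
  let ?h = "\<lambda>x. ?c * vf X ?P x + of_nat (Suc (Suc m)) * vf X g x * h x + g x * vf X h x"
  have "word (X # Xs) (\<lambda>y. g y ^ n) x =
     fact n / fact m * (\<Prod>X\<leftarrow>X # Xs. vf X g x) * g x ^ m + g x ^ Suc m * ?h x" if x: "x \<in> S" for x
  proof -
    have "word (X # Xs) (\<lambda>y. g y ^ n) x = vf X (\<lambda>x. ?c * ?P x * g x ^ Suc m + g x ^ Suc (Suc m) * h x) x"
      by (simp only: foldr.simps comp_apply) (rule vf_cong[OF S x eq])
    also have "\<dots> = (?c * vf X ?P x) * g x ^ Suc m + ?c * ?P x * (of_nat (Suc m) * g x ^ m * vf X g x)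
        + (of_nat (Suc (Suc m)) * g x ^ Suc m * vf X g x * h x + g x ^ Suc (Suc m) * vf X h x)"
      by (subst vf_add[OF smooth_on_mult[OF S cP pw] smooth_on_mult[OF S pw h] x],
          subst vf_mult[OF cP pw x], subst vf_mult[OF pw h x], subst vf_cmult[OF S P x],
          subst vf_power[OF S g x], subst vf_power[OF S g x]) simp
    also have "\<dots> = fact n / fact m * (\<Prod>X\<leftarrow>X # Xs. vf X g x) * g x ^ m + g x ^ Suc m * ?h x"
    proof -
      have "?c * of_nat (Suc m) = fact n / fact m" by (simp add: fact_Suc del: of_nat_Suc)
      moreover have "?c * ?P x * (of_nat (Suc m) * g x ^ m * vf X g x) = ?c * of_nat (Suc m) * (vf X g x * ?P x) * g x ^ m"
        by (simp only: mult_ac)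
      ultimately have "?c * ?P x * (of_nat (Suc m) * g x ^ m * vf X g x) = fact n / fact m * (\<Prod>X\<leftarrow>X # Xs. vf X g x) * g x ^ m"
        by (simp only: list.map prod_list.Cons)
      then show ?thesis by (simp add: algebra_simps)
    qed
    finally show ?thesis .
  qed
  moreover have "smooth_on S ?h"
    by (intro smooth_intros S smooth_on_vf X P g h)
  ultimately show ?case by blast
qed

lemma word_power_lt:
  assumes "open S" "smooth_on S g" "\<forall>X\<in>set Xs. \<forall>i. smooth_on S (X i)" "length Xs < n" "x \<in> S" "g x = 0"
  shows "word Xs (\<lambda>y. g y ^ n) x = 0"
  using word_power[OF assms(1,2), of Xs "n - length Xs" n] assms(3-6) by auto

lemma word_power_eq:
  assumes "open S" "smooth_on S g" "\<forall>X\<in>set Xs. \<forall>i. smooth_on S (X i)" "length Xs = n" "x \<in> S" "g x = 0"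
  shows "word Xs (\<lambda>y. g y ^ n) x = fact n * (\<Prod>X\<leftarrow>Xs. vf X g x)"
  using word_power[OF assms(1,2), of Xs 0 n] assms(3-6) by auto

section \<open>Frames of two vector fields\<close>

definition tri :: "nat \<Rightarrow> (nat \<times> nat) set" where "tri n = {(i, j). i + j \<le> n}"

lemma finite_tri [simp]: "finite (tri n)"
  by (rule finite_subset[of _ "{..n} \<times> {..n}"]) (auto simp: tri_def)

locale frame =
  fixes S :: "(real^2) set" and L M :: "2 \<Rightarrow> real^2 \<Rightarrow> complex"
  assumes open_S: "open S" and smooth_L: "\<And>k. smooth_on S (L k)" and smooth_M: "\<And>k. smooth_on S (M k)"
    and indep: "\<And>x. x \<in> S \<Longrightarrow> L 1 x * M 2 x - L 2 x * M 1 x \<noteq> 0"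
begin

definition "frame_det x = L 1 x * M 2 x - L 2 x * M 1 x"
definition "coL Y x = (Y 1 x * M 2 x - Y 2 x * M 1 x) / frame_det x"
definition "coM Y x = (L 1 x * Y 2 x - L 2 x * Y 1 x) / frame_det x"
definition "unit_vf k i x = (if i = k then 1 else (0::complex))" for k i :: 2 and x :: "real^2"

lemma det_nz: "x \<in> S \<Longrightarrow> frame_det x \<noteq> 0" using indep by (simp add: frame_det_def)

lemma smooth_det: "smooth_on S frame_det"
  unfolding frame_det_def[abs_def] by (intro smooth_intros open_S smooth_L smooth_M)

lemma smooth_coL: "(\<And>i. smooth_on S (Y i)) \<Longrightarrow> smooth_on S (coL Y)"
  unfolding coL_def[abs_def]
  by (intro smooth_intros open_S smooth_L smooth_M smooth_det det_nz)

lemma smooth_coM: "(\<And>i. smooth_on S (Y i)) \<Longrightarrow> smooth_on S (coM Y)"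
  unfolding coM_def[abs_def]
  by (intro smooth_intros open_S smooth_L smooth_M smooth_det det_nz)

text \<open>
  Cramer's rule for the components of \<open>Y\<close> in the frame.
\<close>

lemma vf_expand:
  assumes "x \<in> S"
  shows "vf Y u x = coL Y x * vf L u x + coM Y x * vf M u x"
proof -
  have "(Y 1 x * M 2 x - Y 2 x * M 1 x) * (L 1 x * a + L 2 x * b) + (L 1 x * Y 2 x - L 2 x * Y 1 x) * (M 1 x * a + M 2 x * b)
    = frame_det x * (Y 1 x * a + Y 2 x * b)" for a b
    unfolding frame_det_def by algebra
  then have "coL Y x * (L 1 x * a + L 2 x * b) + coM Y x * (M 1 x * a + M 2 x * b) = Y 1 x * a + Y 2 x * b" for a b
    unfolding coL_def coM_def using det_nz[OF assms]
    by (simp add: times_divide_eq_left add_divide_distrib[symmetric] del: distrib_left)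
  then show ?thesis by (simp add: vf_def sum_2)
qed

lemma vf_e: "vf (unit_vf k) u x = partial_deriv k u x"
  by (simp add: vf_def unit_vf_def if_distrib[where f = "\<lambda>z. z * _"] cong: if_cong)

lemma smooth_e: "smooth_on S (unit_vf k i)"
  unfolding unit_vf_def[abs_def] by (rule smooth_on_const[OF open_S])

definition W :: "nat \<Rightarrow> nat \<Rightarrow> (real^2 \<Rightarrow> complex) \<Rightarrow> real^2 \<Rightarrow> complex" where
  "W i j u = (vf M ^^ i) ((vf L ^^ j) u)"

definition "alpha = coL (bracket L M)"
definition "beta = coM (bracket L M)"

lemma smooth_alpha: "smooth_on S alpha" and smooth_beta: "smooth_on S beta"
  unfolding alpha_def beta_def
  by (intro smooth_coL smooth_coM smooth_on_bracket open_S smooth_L smooth_M)+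

lemma smooth_vfL: "smooth_on S u \<Longrightarrow> smooth_on S (vf L u)"
  and smooth_vfM: "smooth_on S u \<Longrightarrow> smooth_on S (vf M u)"
  by (intro smooth_on_vf open_S smooth_L smooth_M; assumption)+

lemma smooth_Lpow: "smooth_on S u \<Longrightarrow> smooth_on S ((vf L ^^ j) u)"
  and smooth_Mpow: "smooth_on S u \<Longrightarrow> smooth_on S ((vf M ^^ j) u)"
  by (induction j) (auto intro: smooth_vfL smooth_vfM)

lemma smooth_W: "smooth_on S u \<Longrightarrow> smooth_on S (W i j u)"
  unfolding W_def by (intro smooth_Lpow smooth_Mpow)

lemma vf_pow_word: "(vf X ^^ i) u = word (replicate i X) u"
  by (induction i) auto

lemma W_word: "W i j u = word (replicate i M @ replicate j L) u"
  by (simp only: W_def vf_pow_word foldr_append)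

lemma LM: "smooth_on S u \<Longrightarrow> x \<in> S \<Longrightarrow>
    vf L (vf M u) x = vf M (vf L u) x + (alpha x * vf L u x + beta x * vf M u x)"
  using vf_commutator[OF open_S smooth_L smooth_M, of u x] vf_expand[of x "bracket L M" u]
  by (simp add: alpha_def beta_def algebra_simps)

section \<open>Normal ordering\<close>

abbreviation nsum :: "nat \<Rightarrow> (nat \<Rightarrow> nat \<Rightarrow> real^2 \<Rightarrow> complex) \<Rightarrow> (real^2 \<Rightarrow> complex) \<Rightarrow> real^2 \<Rightarrow> complex" where
  "nsum n c u x \<equiv> (\<Sum>p\<in>tri n. c (fst p) (snd p) x * W (fst p) (snd p) u x)"

definition nf :: "nat \<Rightarrow> ((real^2 \<Rightarrow> complex) \<Rightarrow> real^2 \<Rightarrow> complex) \<Rightarrow> bool" where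
  "nf n P \<longleftrightarrow> (\<exists>c. (\<forall>i j. smooth_on S (c i j)) \<and> (\<forall>u x. smooth_on S u \<longrightarrow> x \<in> S \<longrightarrow>
     P u x = (\<Sum>(i, j)\<in>tri n. c i j x * W i j u x)))"

lemma nf_cong:
  assumes "nf n P" "\<And>u x. smooth_on S u \<Longrightarrow> x \<in> S \<Longrightarrow> Q u x = P u x"
  shows "nf n Q"
  using assms(1) unfolding nf_def by (simp add: assms(2))

lemma nf_zero: "nf n (\<lambda>_ _. 0)"
  unfolding nf_def by (rule exI[of _ "\<lambda>_ _ _. 0"]) (simp add: smooth_on_const open_S)

lemma nf_add:
  assumes "nf n P" "nf n Q"
  shows "nf n (\<lambda>u x. P u x + Q u x)"
proof -
  obtain c where c: "\<And>i j. smooth_on S (c i j)" "\<And>u x. smooth_on S u \<Longrightarrow> x \<in> S \<Longrightarrow>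
     P u x = (\<Sum>(i, j)\<in>tri n. c i j x * W i j u x)" using assms(1) unfolding nf_def by blast
  obtain d where d: "\<And>i j. smooth_on S (d i j)" "\<And>u x. smooth_on S u \<Longrightarrow> x \<in> S \<Longrightarrow>
     Q u x = (\<Sum>(i, j)\<in>tri n. d i j x * W i j u x)" using assms(2) unfolding nf_def by blast
  show ?thesis
    unfolding nf_def
    by (rule exI[of _ "\<lambda>i j x. c i j x + d i j x"])
      (auto simp: c d smooth_on_add open_S split_beta sum.distrib distrib_right)
qed

lemma nf_sum: "finite I \<Longrightarrow> (\<And>k. k \<in> I \<Longrightarrow> nf n (P k)) \<Longrightarrow> nf n (\<lambda>u x. \<Sum>k\<in>I. P k u x)"
  by (induction I rule: finite_induct) (auto intro: nf_zero nf_add)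

lemma nf_mult:
  assumes "nf n P" "smooth_on S a"
  shows "nf n (\<lambda>u x. a x * P u x)"
proof -
  obtain c where c: "\<And>i j. smooth_on S (c i j)" "\<And>u x. smooth_on S u \<Longrightarrow> x \<in> S \<Longrightarrow>
     P u x = (\<Sum>(i, j)\<in>tri n. c i j x * W i j u x)" using assms(1) unfolding nf_def by blast
  show ?thesis
    unfolding nf_def
    by (rule exI[of _ "\<lambda>i j x. a x * c i j x"])
      (auto simp: c smooth_on_mult assms(2) open_S split_beta sum_distrib_left mult.assoc)
qed

lemma nf_W:
  assumes "i + j \<le> n"
  shows "nf n (W i j)"
proof -
  have "(\<Sum>(k, l)\<in>tri n. (if k = i \<and> l = j then 1 else 0) * W k l u x)
      = (\<Sum>p\<in>tri n. if p = (i, j) then W i j u x else 0)" for u x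
    by (rule sum.cong) (auto split: if_splits)
  then have "(\<Sum>(k, l)\<in>tri n. (if k = i \<and> l = j then 1 else 0) * W k l u x) = W i j u x" for u x
    using assms by (simp add: tri_def[of n, THEN eqset_imp_iff])
  then show ?thesis
    unfolding nf_def
    by (intro exI[of _ "\<lambda>k l x. if k = i \<and> l = j then 1 else 0"])
      (auto intro: smooth_on_const open_S)
qed

lemma nf_coeffs:
  assumes "nf n P"
  obtains c where "\<And>i j. smooth_on S (c i j)" "\<And>u x. smooth_on S u \<Longrightarrow> x \<in> S \<Longrightarrow>
     P u x = nsum n c u x"
proof -
  obtain c where "\<forall>i j. smooth_on S (c i j)" "\<forall>u x. smooth_on S u \<longrightarrow> x \<in> S \<longrightarrow>
     P u x = (\<Sum>(i, j)\<in>tri n. c i j x * W i j u x)"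
    using assms unfolding nf_def by blast
  then show ?thesis using that[of c] by (simp add: split_beta)
qed

lemma nf_mono:
  assumes "nf n P" "n \<le> m"
  shows "nf m P"
proof -
  obtain c where c: "\<And>i j. smooth_on S (c i j)" "\<And>u x. smooth_on S u \<Longrightarrow> x \<in> S \<Longrightarrow>
     P u x = nsum n c u x" using nf_coeffs[OF assms(1)] by blast
  show ?thesis
    by (rule nf_cong[OF nf_sum[OF finite_tri nf_mult[OF nf_W c(1)]] c(2)])
      (use assms(2) in \<open>auto simp: tri_def\<close>)
qed

text \<open>
  Composition with \<open>X\<close> on the left preserves normal forms if it does so for the single words \<open>W i j\<close>, by
  the Leibniz rule.
\<close>

lemma nf_comp_general:
  assumes "nf n P" and VW: "\<And>i j. nf (Suc (i + j)) (\<lambda>u. vf X (W i j u))"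
    and X: "\<And>i. smooth_on S (X i)"
  shows "nf (Suc n) (\<lambda>u. vf X (P u))"
proof -
  obtain c where c: "\<And>i j. smooth_on S (c i j)" "\<And>u x. smooth_on S u \<Longrightarrow> x \<in> S \<Longrightarrow>
     P u x = nsum n c u x" using nf_coeffs[OF assms(1)] by blast
  have "vf X (P u) x = (\<Sum>p\<in>tri n. vf X (c (fst p) (snd p)) x * W (fst p) (snd p) u x
      + c (fst p) (snd p) x * vf X (W (fst p) (snd p) u) x)" if u: "smooth_on S u" and x: "x \<in> S" for u x
  proof -
    have "vf X (P u) x = vf X (\<lambda>x. \<Sum>p\<in>tri n. c (fst p) (snd p) x * W (fst p) (snd p) u x) x"
      by (rule vf_cong[OF open_S x c(2)[OF u]])
    also have "\<dots> = (\<Sum>p\<in>tri n. vf X (\<lambda>x. c (fst p) (snd p) x * W (fst p) (snd p) u x) x)"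
      by (rule vf_sum[OF open_S _ x]) (intro smooth_on_mult open_S c(1) smooth_W u)
    finally show ?thesis by (simp add: vf_mult[OF c(1) smooth_W[OF u] x])
  qed
  moreover have "nf (Suc n) (\<lambda>u x. \<Sum>p\<in>tri n. vf X (c (fst p) (snd p)) x * W (fst p) (snd p) u x
      + c (fst p) (snd p) x * vf X (W (fst p) (snd p) u) x)"
    by (intro nf_sum finite_tri nf_add nf_mult nf_W nf_mono[OF VW] smooth_on_vf open_S X c(1))
      (auto simp: tri_def)
  ultimately show ?thesis by (rule nf_cong[rotated])
qed

lemma nf_M: "nf n P \<Longrightarrow> nf (Suc n) (\<lambda>u. vf M (P u))"
proof (rule nf_comp_general)
  show "nf (Suc (i + j)) (\<lambda>u. vf M (W i j u))" for i j
    using nf_W[of "Suc i" j "Suc (i + j)"] by (simp add: W_def[abs_def])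
qed (auto intro: smooth_M)

lemma nf_Lpow:
  assumes "nf n P"
  shows "nf (n + j) (\<lambda>u. P ((vf L ^^ j) u))"
proof -
  obtain c where c: "\<And>i j. smooth_on S (c i j)" "\<And>u x. smooth_on S u \<Longrightarrow> x \<in> S \<Longrightarrow>
     P u x = nsum n c u x" using nf_coeffs[OF assms(1)] by blast
  have "W i k ((vf L ^^ j) u) = W i (k + j) u" for i k u
    by (simp add: W_def funpow_add)
  then have "P ((vf L ^^ j) u) x = (\<Sum>p\<in>tri n. c (fst p) (snd p) x * W (fst p) (snd p + j) u x)"
    if "smooth_on S u" "x \<in> S" for u x
    using c(2)[OF smooth_Lpow[OF that(1)] that(2)] by simp
  moreover have "nf (n + j) (\<lambda>u x. \<Sum>p\<in>tri n. c (fst p) (snd p) x * W (fst p) (snd p + j) u x)"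
    by (intro nf_sum finite_tri nf_mult nf_W c(1)) (auto simp: tri_def)
  ultimately show ?thesis by (rule nf_cong[rotated])
qed

text \<open>
  Moving \<open>L\<close> to the right past one \<open>M\<close> costs \<open>\<alpha> L + \<beta> M\<close>, whose contribution has lower order.
\<close>

lemma nf_L_Mpow: "nf (Suc i) (\<lambda>u. vf L ((vf M ^^ i) u))"
proof (induction i)
  case 0
  show ?case using nf_W[of 0 1 1] by (simp add: W_def[abs_def])
next
  case (Suc i)
  have "nf (Suc (Suc i)) (\<lambda>u x. vf M (vf L ((vf M ^^ i) u)) x
      + (alpha x * vf L ((vf M ^^ i) u) x + beta x * W (Suc i) 0 u x))"
    by (intro nf_add nf_mult nf_M Suc nf_mono[OF Suc] nf_W smooth_alpha smooth_beta) auto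
  then show ?case
    by (rule nf_cong) (auto simp: LM[OF smooth_Mpow] W_def)
qed

lemma nf_L: "nf n P \<Longrightarrow> nf (Suc n) (\<lambda>u. vf L (P u))"
proof (rule nf_comp_general)
  show "nf (Suc (i + j)) (\<lambda>u. vf L (W i j u))" for i j
    using nf_Lpow[OF nf_L_Mpow[of i], of j] by (simp add: W_def[abs_def])
qed (auto intro: smooth_L)

lemma nf_partial_deriv:
  assumes "nf n P"
  shows "nf (Suc n) (\<lambda>u. partial_deriv k (P u))"
proof (rule nf_cong)
  show "nf (Suc n) (\<lambda>u x. coL (unit_vf k) x * vf L (P u) x + coM (unit_vf k) x * vf M (P u) x)"
    by (intro nf_add nf_mult nf_L nf_M assms smooth_coL smooth_coM smooth_e)
qed (simp add: vf_expand[symmetric] vf_e)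

lemma nf_partial_derivs: "nf (length is) (partial_derivs is)"
proof (induction "is")
  case Nil
  show ?case using nf_W[of 0 0 0] by (simp add: W_def[abs_def] partial_derivs_def[abs_def] id_def)
next
  case (Cons k ks)
  then show ?case using nf_partial_deriv[OF Cons, of k] by (simp add: partial_derivs_def[abs_def])
qed

text \<open>
  The frame generates all partial derivatives, so every differential operator can be written with all
  \<open>M\<close> to the left of all \<open>L\<close>.
\<close>

lemma normal_ordering:
  assumes d: "\<And>is. smooth_on S (d is)"
  shows "nf p (\<lambda>u x. \<Sum>is | length is \<le> p. d is x * partial_derivs is u x)"
proof (intro nf_sum nf_mult d)
  show "finite {is :: 2 list. length is \<le> p}"
    using finite_lists_length_le[of "UNIV :: 2 set" p] by simp
  show "nf p (partial_derivs is)" if "is \<in> {is. length is \<le> p}" for "is"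
    using that nf_mono[OF nf_partial_derivs[of "is"]] by simp
qed

end

section \<open>Commutators of an operator with a frame field\<close>

context frame
begin

lemma alpha_beta: "x \<in> S \<Longrightarrow> bracket L M k x = alpha x * L k x + beta x * M k x"
proof -
  assume x: "x \<in> S"
  let ?N = "bracket L M"
  have "(?N 1 x * M 2 x - ?N 2 x * M 1 x) * L k x + (L 1 x * ?N 2 x - L 2 x * ?N 1 x) * M k x = frame_det x * ?N k x"
    using exhaust_2[of k] unfolding frame_det_def by (elim disjE) (simp_all add: algebra_simps)
  then show ?thesis
    unfolding alpha_def beta_def coL_def coM_def using det_nz[OF x]
    by (simp add: add_divide_distrib[symmetric])
qed

lemma smooth_bracket: "smooth_on S (bracket L M k)"
  by (intro smooth_on_bracket open_S smooth_L smooth_M)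

text \<open>
  The derivation rule for the commutator: \<open>[L, M\<^sup>i]\<close> is the sum over the positions at which
  one factor \<open>M\<close> is replaced by the vector field \<open>[L, M]\<close>.
\<close>

lemma Mpow_commutator:
  assumes w: "smooth_on S w" and x: "x \<in> S"
  shows "vf L ((vf M ^^ i) w) x = (vf M ^^ i) (vf L w) x
    + (\<Sum>k<i. (vf M ^^ k) (vf (bracket L M) ((vf M ^^ (i - 1 - k)) w)) x)"
  using x
proof (induction i arbitrary: x)
  case (Suc i)
  let ?v = "(vf M ^^ i) w" and ?N = "bracket L M"
  let ?f = "\<lambda>k. (vf M ^^ k) (vf ?N ((vf M ^^ (i - 1 - k)) w))"
  have sf: "smooth_on S (?f k)" for k
    by (intro smooth_Mpow smooth_on_vf open_S smooth_bracket w)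
  have "vf L (vf M ?v) x = vf M (vf L ?v) x + vf ?N ?v x"
    using vf_commutator[OF open_S smooth_L smooth_M smooth_Mpow[OF w] Suc.prems] by (simp add: algebra_simps)
  also have "vf M (vf L ?v) x = vf M (\<lambda>x. (vf M ^^ i) (vf L w) x + (\<Sum>k<i. ?f k x)) x"
    by (rule vf_cong[OF open_S Suc.prems Suc.IH])
  also have "\<dots> = vf M ((vf M ^^ i) (vf L w)) x + (\<Sum>k<i. vf M (?f k) x)"
    by (subst vf_add[OF smooth_Mpow[OF smooth_vfL[OF w]] smooth_on_sum[OF open_S sf] Suc.prems],
        subst vf_sum[OF open_S sf Suc.prems], rule refl)
  also have "\<dots> + vf ?N ?v x = (vf M ^^ Suc i) (vf L w) x
    + (\<Sum>k<Suc i. (vf M ^^ k) (vf ?N ((vf M ^^ (Suc i - 1 - k)) w)) x)"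
    unfolding sum.lessThan_Suc_shift by simp
  finally show ?case by simp
qed simp

lemma prod_list_map_replicate: "(\<Prod>X\<leftarrow>replicate n Y. f X) = (f Y ^ n :: complex)"
  by (induction n) auto

lemma W_symbol:
  assumes g: "smooth_on S g" and x: "x \<in> S" "g x = 0" and n: "i + j \<le> n"
  shows "W i j (\<lambda>y. g y ^ n) x = (if i + j = n then fact n * (vf M g x ^ i * vf L g x ^ j) else 0)"
proof -
  have sm: "\<forall>X\<in>set (replicate i M @ replicate j L). \<forall>k. smooth_on S (X k)"
    using smooth_L smooth_M by auto
  show ?thesis
    unfolding W_word
    using word_power_lt[OF open_S g sm _ x, of n] word_power_eq[OF open_S g sm _ x, of n] n
    by (auto simp: prod_list_map_replicate)
qed

text \<open>
  Every word in the commutator is again a word of length \<open>i + j\<close> in vector fields, so that its principal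
  symbol is a product.
\<close>

lemma commutator_symbol:
  assumes g: "smooth_on S g" and x: "x \<in> S" "g x = 0" and n: "i + j \<le> n"
  shows "vf L (W i j (\<lambda>y. g y ^ n)) x - W i j (vf L (\<lambda>y. g y ^ n)) x
    = (if i + j = n then fact n * (of_nat i * vf M g x ^ (i - 1) * vf (bracket L M) g x * vf L g x ^ j) else 0)"
proof -
  let ?N = "bracket L M" and ?u = "\<lambda>y. g y ^ n"
  let ?Xs = "\<lambda>k. replicate k M @ [?N] @ replicate (i - 1 - k) M @ replicate j L"
  have u: "smooth_on S ?u" by (intro smooth_on_power open_S g)
  have sm: "\<forall>X\<in>set (?Xs k). \<forall>m. smooth_on S (X m)" for k
    using smooth_L smooth_M smooth_bracket by auto
  have "W i j (vf L ?u) = (vf M ^^ i) (vf L ((vf L ^^ j) ?u))"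
    by (simp add: W_def funpow_swap1)
  then have "vf L (W i j ?u) x - W i j (vf L ?u) x
    = (\<Sum>k<i. (vf M ^^ k) (vf ?N ((vf M ^^ (i - 1 - k)) ((vf L ^^ j) ?u))) x)"
    using Mpow_commutator[OF smooth_Lpow[OF u] x(1), of i j] by (simp add: W_def)
  also have "\<dots> = (\<Sum>k<i. word (?Xs k) ?u x)"
    by (simp only: vf_pow_word foldr_append foldr.simps comp_apply id_apply)
  also have "\<dots> = (\<Sum>k<i. if i + j = n then fact n * (vf M g x ^ (i - 1) * vf ?N g x * vf L g x ^ j) else 0)"
  proof (rule sum.cong[OF refl])
    fix k assume k: "k \<in> {..<i}"
    then have len: "length (?Xs k) = i + j" by simp
    have "vf M g x ^ k * vf M g x ^ (i - 1 - k) = vf M g x ^ (i - 1)"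
      using k by (simp flip: power_add)
    then have pr: "(\<Prod>X\<leftarrow>?Xs k. vf X g x) = vf M g x ^ (i - 1) * vf ?N g x * vf L g x ^ j"
      by (simp add: prod_list_map_replicate mult_ac)
    show "word (?Xs k) ?u x = (if i + j = n then fact n * (vf M g x ^ (i - 1) * vf ?N g x * vf L g x ^ j) else 0)"
    proof (cases "i + j = n")
      case True
      then show ?thesis
        using word_power_eq[OF open_S g sm[of k] _ x, of n] len pr by (simp only: if_True simp_thms)
    next
      case False
      then show ?thesis
        using word_power_lt[OF open_S g sm[of k] _ x, of n] len n by (simp only: if_False)
    qed
  qed
  also have "\<dots> = (if i + j = n then fact n * (of_nat i * vf M g x ^ (i - 1) * vf ?N g x * vf L g x ^ j) else 0)"
    by simp
  finally show ?thesis .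
qed

text \<open>
  A linear function realizes any values of the symbols of \<open>L\<close> and \<open>M\<close> at a given point.
\<close>

lemma exists_test_function:
  assumes x: "x \<in> S"
  shows "\<exists>g. smooth_on S g \<and> g x = 0 \<and> vf L g x = s \<and> vf M g x = t"
proof -
  define z1 where "z1 = (s * M 2 x - t * L 2 x) / frame_det x"
  define z2 where "z2 = (t * L 1 x - s * M 1 x) / frame_det x"
  define X where "X k y = complex_of_real (y $ k - x $ k)" for k :: 2 and y :: "real^2"
  define g where "g y = z1 * X 1 y + z2 * X 2 y" for y
  have X: "smooth_on S (X k)" for k
    unfolding X_def by (rule smooth_on_coordinate[OF open_S])
  have dX: "vf V (X k) x = V k x" for V k
    unfolding vf_def X_def partial_deriv_coordinate using exhaust_2[of k] by (auto simp: sum_2)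
  have c: "smooth_on S (\<lambda>y. z * X k y)" for z k by (intro smooth_intros open_S X)
  have dg: "vf V g x = z1 * V 1 x + z2 * V 2 x" for V
    unfolding g_def[abs_def] vf_add[OF c c x] vf_cmult[OF open_S X x] dX ..
  have "(s * M 2 x - t * L 2 x) * L 1 x + (t * L 1 x - s * M 1 x) * L 2 x = s * frame_det x"
    "(s * M 2 x - t * L 2 x) * M 1 x + (t * L 1 x - s * M 1 x) * M 2 x = t * frame_det x"
    unfolding frame_det_def by algebra+
  then have "vf L g x = s" "vf M g x = t"
    unfolding dg z1_def z2_def using det_nz[OF x] by (simp_all add: add_divide_distrib[symmetric])
  moreover have "smooth_on S g" unfolding g_def[abs_def] by (intro smooth_on_add c open_S)
  moreover have "g x = 0" by (simp add: g_def X_def)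
  ultimately show ?thesis by blast
qed

definition commutes_up_to :: "nat \<Rightarrow> (nat \<Rightarrow> nat \<Rightarrow> real^2 \<Rightarrow> complex) \<Rightarrow> bool" where
  "commutes_up_to n c \<longleftrightarrow> (\<forall>u x. smooth_on S u \<longrightarrow> x \<in> S \<longrightarrow>
     vf L (\<lambda>y. nsum n c u y) x
     = nsum n c (vf L u) x)"

lemma L_sum:
  assumes c: "\<And>i j. smooth_on S (c i j)" and u: "smooth_on S u" and x: "x \<in> S" and "finite I"
  shows "vf L (\<lambda>y. \<Sum>p\<in>I. c (fst p) (snd p) y * W (fst p) (snd p) u y) x
     = (\<Sum>p\<in>I. vf L (c (fst p) (snd p)) x * W (fst p) (snd p) u x
         + c (fst p) (snd p) x * vf L (W (fst p) (snd p) u) x)"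
  by (subst vf_sum[OF open_S _ x]) (auto intro!: smooth_on_mult open_S c smooth_W u sum.cong vf_mult x)

lemma sum_diagonal: "(\<Sum>p\<in>tri n. if fst p + snd p = n then f (fst p) (snd p) else 0) = (\<Sum>i\<le>n. f i (n - i) :: complex)"
proof -
  have "(\<Sum>p\<in>tri n. if fst p + snd p = n then f (fst p) (snd p) else 0) = (\<Sum>p\<in>{p. fst p + snd p = n}. f (fst p) (snd p))"
    by (rule sum.mono_neutral_cong_right[OF finite_tri]) (auto simp: tri_def)
  also have "\<dots> = (\<Sum>i\<le>n. f i (n - i))"
    by (rule sum.reindex_bij_witness[of _ "\<lambda>i. (i, n - i)" fst]) auto
  finally show ?thesis .
qed

text \<open>
  Apply the commutator to \<open>g\<^sup>n\<close> at a zero \<open>x\<close> of a function \<open>g\<close> with \<open>L g = 1\<close> and \<open>M g = t\<close> at \<open>x\<close>. The result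
  is \<open>n!\<close> times a polynomial in \<open>t\<close>, which therefore vanishes identically; the identity is the vanishing of
  its \<open>i\<close>-th coefficient.
\<close>

lemma commutator_top:
  assumes c: "\<And>i j. smooth_on S (c i j)" and comm: "commutes_up_to n c"
    and i: "i \<le> n" and x: "x \<in> S"
  shows "vf L (c i (n - i)) x + of_nat i * beta x * c i (n - i) x
    + (if i < n then of_nat (Suc i) * alpha x * c (Suc i) (n - Suc i) x else 0) = 0"
proof -
  let ?C = "\<lambda>i. c i (n - i) x"
  let ?E = "\<lambda>i. vf L (c i (n - i)) x + of_nat i * beta x * ?C i
    + (if i < n then of_nat (Suc i) * alpha x * ?C (Suc i) else 0)"
  have "(\<Sum>i\<le>n. ?E i * t ^ i) = 0" for t
  proof -
    obtain g where g: "smooth_on S g" "g x = 0" "vf L g x = 1" "vf M g x = t"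
      using exists_test_function[OF x] by blast
    let ?u = "\<lambda>y. g y ^ n"
    have u: "smooth_on S ?u" by (intro smooth_on_power open_S g)
    have N: "vf (bracket L M) g x = alpha x + beta x * t"
      using vf_expand[OF x, of "bracket L M" g] g by (simp add: alpha_def beta_def)
    have "0 = (\<Sum>p\<in>tri n. vf L (c (fst p) (snd p)) x * W (fst p) (snd p) ?u x
         + c (fst p) (snd p) x * (vf L (W (fst p) (snd p) ?u) x - W (fst p) (snd p) (vf L ?u) x))"
      using comm[unfolded commutes_up_to_def, rule_format, OF u x] L_sum[where c = c, OF c u x finite_tri[of n]]
      by (simp add: sum.distrib right_diff_distrib sum_subtractf add_diff_eq)
    also have "\<dots> = (\<Sum>p\<in>tri n. if fst p + snd p = n then
        fact n * (vf L (c (fst p) (snd p)) x * t ^ fst p + c (fst p) (snd p) x * (of_nat (fst p) * t ^ (fst p - 1) * (alpha x + beta x * t))) else 0)"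
    proof (rule sum.cong[OF refl])
      fix p assume "p \<in> tri n"
      then have le: "fst p + snd p \<le> n" by (auto simp: tri_def)
      show "vf L (c (fst p) (snd p)) x * W (fst p) (snd p) ?u x
         + c (fst p) (snd p) x * (vf L (W (fst p) (snd p) ?u) x - W (fst p) (snd p) (vf L ?u) x)
        = (if fst p + snd p = n then
        fact n * (vf L (c (fst p) (snd p)) x * t ^ fst p + c (fst p) (snd p) x * (of_nat (fst p) * t ^ (fst p - 1) * (alpha x + beta x * t))) else 0)"
        unfolding W_symbol[OF g(1) x g(2) le] commutator_symbol[OF g(1) x g(2) le] g N
        by (simp add: algebra_simps)
    qed
    also have "\<dots> = (\<Sum>i\<le>n. fact n * (vf L (c i (n - i)) x * t ^ i + ?C i * (of_nat i * t ^ (i - 1) * (alpha x + beta x * t))))"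
      by (rule sum_diagonal)
    also have "\<dots> = fact n * ((\<Sum>i\<le>n. (vf L (c i (n - i)) x + of_nat i * beta x * ?C i) * t ^ i)
        + (\<Sum>i\<le>n. ?C i * of_nat i * alpha x * t ^ (i - 1)))"
    proof -
      have "vf L (c i (n - i)) x * t ^ i + ?C i * (of_nat i * t ^ (i - 1) * (alpha x + beta x * t))
        = (vf L (c i (n - i)) x + of_nat i * beta x * ?C i) * t ^ i + ?C i * of_nat i * alpha x * t ^ (i - 1)" for i
        by (cases i) (simp_all add: algebra_simps)
      then show ?thesis by (simp add: sum_distrib_left[symmetric] sum.distrib)
    qed
    also have "(\<Sum>i\<le>n. ?C i * of_nat i * alpha x * t ^ (i - 1))
      = (\<Sum>i\<le>n. (if i < n then of_nat (Suc i) * alpha x * ?C (Suc i) else 0) * t ^ i)"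
    proof (cases n)
      case (Suc m)
      have "(\<Sum>i\<le>Suc m. ?C i * of_nat i * alpha x * t ^ (i - 1)) = (\<Sum>i\<le>m. ?C (Suc i) * of_nat (Suc i) * alpha x * t ^ i)"
        by (subst sum.atMost_Suc_shift) simp
      also have "\<dots> = (\<Sum>i\<le>Suc m. (if i < Suc m then of_nat (Suc i) * alpha x * ?C (Suc i) else 0) * t ^ i)"
        by (simp add: mult_ac)
      finally show ?thesis by (simp only: Suc)
    qed simp
    finally show ?thesis by (simp add: sum.distrib distrib_right)
  qed
  then show ?thesis using polyfun_eq_0[where c = ?E and n = n] i by blast
qed

lemma sum_tri_Suc:
  "(\<Sum>p\<in>tri (Suc m). f p) = (\<Sum>p\<in>tri m. f p) + (\<Sum>i\<le>Suc m. f (i, Suc m - i) :: complex)"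
proof -
  have "(\<Sum>p\<in>tri (Suc m). f p) = (\<Sum>p\<in>tri (Suc m) - {p. fst p + snd p = Suc m}. f p) + (\<Sum>p\<in>{p. fst p + snd p = Suc m}. f p)"
    by (rule sum.subset_diff[OF _ finite_tri]) (auto simp: tri_def)
  also have "tri (Suc m) - {p. fst p + snd p = Suc m} = tri m" by (auto simp: tri_def)
  also have "(\<Sum>p\<in>{p. fst p + snd p = Suc m}. f p) = (\<Sum>i\<le>Suc m. f (i, Suc m - i))"
    by (rule sum.reindex_bij_witness[of _ "\<lambda>i. (i, Suc m - i)" fst]) (auto intro!: arg_cong[where f = f])
  finally show ?thesis .
qed

lemma commutes_up_to_lower:
  assumes c: "\<And>i j. smooth_on S (c i j)" and comm: "commutes_up_to (Suc m) c"
    and top: "\<And>u x i. smooth_on S u \<Longrightarrow> x \<in> S \<Longrightarrow> i \<le> Suc m \<Longrightarrow>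
      vf L (\<lambda>y. c i (Suc m - i) y * W i (Suc m - i) u y) x = c i (Suc m - i) x * W i (Suc m - i) (vf L u) x"
  shows "commutes_up_to m c"
  unfolding commutes_up_to_def
proof (intro allI impI)
  fix u :: "real^2 \<Rightarrow> complex" and x assume u: "smooth_on S u" and x: "x \<in> S"
  have sm: "smooth_on S (\<lambda>y. c i j y * W i j u y)" for i j
    by (intro smooth_on_mult open_S c smooth_W u)
  let ?D = "\<lambda>n u y. \<Sum>p\<in>tri n. c (fst p) (snd p) y * W (fst p) (snd p) u y"
  have "vf L (?D (Suc m) u) x = ?D (Suc m) (vf L u) x"
    using comm u x unfolding commutes_up_to_def by blast
  moreover have "vf L (?D (Suc m) u) x = vf L (?D m u) x
      + vf L (\<lambda>y. \<Sum>i\<le>Suc m. c i (Suc m - i) y * W i (Suc m - i) u y) x"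
    unfolding sum_tri_Suc fst_conv snd_conv
    by (rule vf_add[OF smooth_on_sum[OF open_S sm] smooth_on_sum[OF open_S sm] x])
  moreover have "vf L (\<lambda>y. \<Sum>i\<le>Suc m. c i (Suc m - i) y * W i (Suc m - i) u y) x
     = (\<Sum>i\<le>Suc m. c i (Suc m - i) x * W i (Suc m - i) (vf L u) x)"
    by (subst vf_sum[OF open_S sm x]) (rule sum.cong[OF refl], simp add: top[OF u x])
  ultimately show "vf L (?D m u) x = ?D m (vf L u) x"
    unfolding sum_tri_Suc fst_conv snd_conv by simp
qed

text \<open>
  Up to constants, \<open>r = exp h\<close> is a \<open>q\<close>-th root of \<open>c\<close>, and \<open>s\<close> is \<open>b r\<^sup>1\<^sup>-\<^sup>q\<close>. The two
  hypotheses give \<open>L r = - \<beta> r\<close> and \<open>L s = - \<alpha> r\<close>, which are the two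
  components of \<open>[L, r M + s L] = 0\<close>.
\<close>

lemma commuting_frame_from_top:
  assumes c: "smooth_on S c" and b: "smooth_on S b" and q: "q \<ge> (1::nat)"
    and Lc: "\<And>x. x \<in> S \<Longrightarrow> vf L c x + of_nat q * beta x * c x = 0"
    and Lb: "\<And>x. x \<in> S \<Longrightarrow> vf L b x + of_nat (q - 1) * beta x * b x + of_nat q * alpha x * c x = 0"
    and x0: "x0 \<in> S" "c x0 \<noteq> 0"
  shows "\<exists>S' M'. S' \<subseteq> S \<and> x0 \<in> S' \<and> frame S' L M' \<and> (\<forall>x\<in>S'. \<forall>k. bracket L M' k x = 0)"
proof -
  define a where "a x = c x / c x0" for x
  have a: "smooth_on S a" unfolding a_def[abs_def] divide_inverse by (intro smooth_intros c open_S)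
  have La: "vf L a x = vf L c x / c x0" if "x \<in> S" for x
    using vf_cmult[OF open_S c that, of L "inverse (c x0)"] by (simp add: a_def[abs_def] divide_inverse mult.commute)
  \<comment> \<open>The slit plane, where the logarithm of the normalized coefficient is smooth.\<close>
  define S' where "S' = S \<inter> a -` (- \<real>\<^sub>\<le>\<^sub>0)"
  have S': "open S'" unfolding S'_def
    by (rule continuous_open_preimage[OF smooth_on_imp_continuous_on[OF a] open_S])
      (simp add: open_Compl)
  have sub: "S' \<subseteq> S" and anr: "\<And>x. x \<in> S' \<Longrightarrow> a x \<notin> \<real>\<^sub>\<le>\<^sub>0" by (auto simp: S'_def)
  have x0': "x0 \<in> S'" using x0 by (simp add: S'_def a_def)
  have qn: "of_nat q \<noteq> (0::complex)" using q by simp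
  define h where "h x = Ln (a x) / of_nat q" for x
  have lna: "smooth_on S' (\<lambda>x. Ln (a x))"
    by (intro smooth_on_Ln S' smooth_on_subset[OF a sub] anr)
  have h: "smooth_on S' h"
    unfolding h_def[abs_def] divide_inverse by (intro smooth_intros S' lna)
  have anz: "a x \<noteq> 0" if "x \<in> S'" for x using anr[OF that] by auto
  have Lh: "vf L h x = - beta x" if x: "x \<in> S'" for x
  proof -
    have xS: "x \<in> S" using x sub by blast
    have "vf L h x = vf L a x / a x / of_nat q"
      using vf_cmult[OF S' lna x, of L "inverse (of_nat q)"]
        vf_Ln[OF smooth_on_subset[OF a sub] x anr[OF x], of L]
      by (simp add: h_def[abs_def] divide_inverse mult.commute)
    also have "vf L a x = - (of_nat q * beta x) * a x"
      using Lc[OF xS] unfolding La[OF xS] a_def by (simp add: add_eq_0_iff)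
    finally show ?thesis using anz[OF x] qn by simp
  qed
  define r where "r x = exp (h x)" for x
  define s where "s x = inverse (of_nat q * c x0) * (b x * exp (- of_nat (q - 1) * h x))" for x
  have bS': "smooth_on S' b" by (rule smooth_on_subset[OF b sub])
  have h1: "smooth_on S' (\<lambda>x. - of_nat (q - 1) * h x)" by (intro smooth_intros S' h)
  have eh1: "smooth_on S' (\<lambda>x. exp (- of_nat (q - 1) * h x))" by (intro smooth_on_exp S' h1)
  have beh1: "smooth_on S' (\<lambda>x. b x * exp (- of_nat (q - 1) * h x))" by (intro smooth_on_mult S' bS' eh1)
  have r: "smooth_on S' r" unfolding r_def[abs_def] by (intro smooth_on_exp S' h)
  have s: "smooth_on S' s" unfolding s_def[abs_def] by (intro smooth_on_mult[OF S' smooth_on_const] beh1 S')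
  have Lr: "vf L r x = - beta x * r x" if x: "x \<in> S'" for x
    using vf_exp[OF h x, of L] Lh[OF x] by (simp add: r_def[abs_def])
  have rq: "exp (of_nat q * h x) = a x" if x: "x \<in> S'" for x
    using anz[OF x] qn by (simp add: h_def)
  have Ls: "vf L s x = - alpha x * r x" if x: "x \<in> S'" for x
  proof -
    have xS: "x \<in> S" using x sub by blast
    let ?E = "exp (- of_nat (q - 1) * h x)"
    have "vf L s x = inverse (of_nat q * c x0) * (vf L b x * ?E + b x * (?E * (- of_nat (q - 1) * vf L h x)))"
      unfolding s_def[abs_def]
      by (subst vf_cmult[OF S' beh1 x], subst vf_mult[OF bS' eh1 x], subst vf_exp[OF h1 x], subst vf_cmult[OF S' h x]) simp
    also have "\<dots> = inverse (of_nat q * c x0) * ?E * (vf L b x + of_nat (q - 1) * beta x * b x)"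
      by (simp add: Lh[OF x] algebra_simps)
    also have "vf L b x + of_nat (q - 1) * beta x * b x = - (of_nat q * alpha x * c x)"
      using Lb[OF xS] by (simp add: add_eq_0_iff2)
    also have "inverse (of_nat q * c x0) * ?E * - (of_nat q * alpha x * c x) = - alpha x * (a x * ?E)"
      using qn x0(2) by (simp add: a_def field_simps)
    also have "a x * ?E = r x"
      unfolding rq[OF x, symmetric] r_def exp_add[symmetric] using q by (simp add: of_nat_diff algebra_simps)
    finally show ?thesis .
  qed
  define M' where "M' k x = r x * M k x + s x * L k x" for k x
  note smL = smooth_on_subset[OF smooth_L sub] and smM = smooth_on_subset[OF smooth_M sub]
  have "frame S' L M'"
  proof
    show "smooth_on S' (M' k)" for k
      unfolding M'_def[abs_def] by (intro smooth_intros S' r s smL smM)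
    fix x assume x: "x \<in> S'"
    have "L 1 x * M' 2 x - L 2 x * M' 1 x = r x * (L 1 x * M 2 x - L 2 x * M 1 x)"
      by (simp add: M'_def algebra_simps)
    then show "L 1 x * M' 2 x - L 2 x * M' 1 x \<noteq> 0"
      using indep[of x] x sub by (simp add: r_def subset_iff)
  qed (rule S' smL)+
  moreover have "bracket L M' k x = 0" if x: "x \<in> S'" for k x
  proof -
    have xS: "x \<in> S" using x sub by blast
    have "vf L (M' k) x = vf L r x * M k x + r x * vf L (M k) x + (vf L s x * L k x + s x * vf L (L k) x)"
      unfolding M'_def[abs_def]
      by (subst vf_add[OF smooth_on_mult[OF S' r smM] smooth_on_mult[OF S' s smL] x],
          subst vf_mult[OF r smM x], subst vf_mult[OF s smL x]) simp
    moreover have "vf M' (L k) x = r x * vf M (L k) x + s x * vf L (L k) x"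
      by (simp add: vf_def M'_def sum_2 algebra_simps)
    ultimately have "bracket L M' k x = vf L r x * M k x + vf L s x * L k x + r x * bracket L M k x"
      by (simp add: bracket_def algebra_simps)
    then show ?thesis by (simp add: Lr[OF x] Ls[OF x] alpha_beta[OF xS] algebra_simps)
  qed
  ultimately show ?thesis using sub x0' by blast
qed

text \<open>
  Induction on the order: as long as the top order part is a multiple of a power of \<open>L\<close>, it can be
  removed, since its coefficient is annihilated by \<open>L\<close>. Otherwise the highest power of \<open>M\<close> in the top order
  part gives the commuting frame.
\<close>

theorem polynomial_or_commuting_frame:
  assumes c: "\<And>i j. smooth_on S (c i j)" and comm: "commutes_up_to n c"
  shows "(\<forall>i j. \<forall>x\<in>S. 1 \<le> i \<longrightarrow> i + j \<le> n \<longrightarrow> c i j x = 0) \<or>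
    (\<exists>S' M'. S' \<subseteq> S \<and> S' \<noteq> {} \<and> frame S' L M' \<and> (\<forall>x\<in>S'. \<forall>k. bracket L M' k x = 0))"
  using comm
proof (induction n)
  case (Suc m)
  note top = commutator_top[OF c Suc.prems]
  show ?case
  proof (cases "\<exists>i x. 1 \<le> i \<and> i \<le> Suc m \<and> x \<in> S \<and> c i (Suc m - i) x \<noteq> 0")
    case True
    let ?P = "\<lambda>i. 1 \<le> i \<and> i \<le> Suc m \<and> (\<exists>x\<in>S. c i (Suc m - i) x \<noteq> 0)"
    define q where "q = Max {i. ?P i}"
    have fin: "finite {i. ?P i}" by (rule finite_subset[of _ "{..Suc m}"]) auto
    have ne: "{i. ?P i} \<noteq> {}" using True by blast
    have q: "1 \<le> q" "q \<le> Suc m" and "\<exists>x\<in>S. c q (Suc m - q) x \<noteq> 0"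
      using Max_in[OF fin ne] unfolding q_def by auto
    then obtain x0 where x0: "x0 \<in> S" "c q (Suc m - q) x0 \<noteq> 0" by blast
    have above: "c i (Suc m - i) x = 0" if "q < i" "i \<le> Suc m" "x \<in> S" for i x
    proof (rule ccontr)
      assume "c i (Suc m - i) x \<noteq> 0"
      then have "i \<in> {i. ?P i}" using that q by auto
      from Max_ge[OF fin this] show False using that by (simp add: q_def)
    qed
    have "\<exists>S' M'. S' \<subseteq> S \<and> x0 \<in> S' \<and> frame S' L M' \<and> (\<forall>x\<in>S'. \<forall>k. bracket L M' k x = 0)"
    proof (rule commuting_frame_from_top[OF c c q(1) _ _ x0])
      show "vf L (c q (Suc m - q)) x + of_nat q * beta x * c q (Suc m - q) x = 0" if "x \<in> S" for x
        using top[OF q(2) that] above[of "Suc q" x] that by (cases "q < Suc m") auto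
      show "vf L (c (q - 1) (Suc m - (q - 1))) x + of_nat (q - 1) * beta x * c (q - 1) (Suc m - (q - 1)) x
          + of_nat q * alpha x * c q (Suc m - q) x = 0" if "x \<in> S" for x
      proof -
        obtain q' where "q = Suc q'" using q by (cases q) auto
        then show ?thesis using top[of q' x] q that by simp
      qed
    qed
    then show ?thesis by blast
  next
    case False
    have z: "c i (Suc m - i) x = 0" if "1 \<le> i" "i \<le> Suc m" "x \<in> S" for i x
      using False that by blast
    have L0: "vf L (c 0 (Suc m)) x = 0" if "x \<in> S" for x
      using top[of 0 x] z[of 1 x] that by simp
    have "commutes_up_to m c"
    proof (rule commutes_up_to_lower[OF c Suc.prems])
      fix u :: "real^2 \<Rightarrow> complex" and x i assume u: "smooth_on S u" and x: "x \<in> S" and i: "i \<le> Suc m"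
      show "vf L (\<lambda>y. c i (Suc m - i) y * W i (Suc m - i) u y) x = c i (Suc m - i) x * W i (Suc m - i) (vf L u) x"
      proof (cases "i = 0")
        case True
        then show ?thesis
          by (simp add: vf_mult[OF c smooth_W[OF u] x] L0[OF x]) (simp add: W_def funpow_swap1)
      next
        case False
        then have "vf L (\<lambda>y. c i (Suc m - i) y * W i (Suc m - i) u y) x = vf L (\<lambda>y. 0) x"
          by (intro vf_cong[OF open_S x]) (use z i in simp)
        then show ?thesis using z[of i x] False i x by (simp add: vf_const)
      qed
    qed
    from Suc.IH[OF this] show ?thesis
    proof
      assume *: "\<forall>i j. \<forall>x\<in>S. 1 \<le> i \<longrightarrow> i + j \<le> m \<longrightarrow> c i j x = 0"
      have "c i j x = 0" if "x \<in> S" "1 \<le> i" "i + j \<le> Suc m" for i j x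
      proof (cases "i + j \<le> m")
        case False
        then have "j = Suc m - i" using that by simp
        then show ?thesis using z[of i x] that by simp
      qed (use * that in blast)
      then show ?thesis by blast
    qed blast
  qed
qed auto

end

section \<open>Commuting frames\<close>

locale commuting_frame = frame +
  assumes commute: "\<And>x k. x \<in> S \<Longrightarrow> bracket L M k x = 0"
begin

lemma alpha0: "x \<in> S \<Longrightarrow> alpha x = 0" and beta0: "x \<in> S \<Longrightarrow> beta x = 0"
  by (simp_all add: alpha_def beta_def coL_def coM_def commute)

lemma LM_commute: "smooth_on S u \<Longrightarrow> x \<in> S \<Longrightarrow> vf L (vf M u) x = vf M (vf L u) x"
  using LM by (simp add: alpha0 beta0)

lemma L_Mpow: "smooth_on S u \<Longrightarrow> x \<in> S \<Longrightarrow> vf L ((vf M ^^ i) u) x = (vf M ^^ i) (vf L u) x"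
proof (induction i arbitrary: x)
  case (Suc i)
  have "vf L (vf M ((vf M ^^ i) u)) x = vf M (vf L ((vf M ^^ i) u)) x"
    by (rule LM_commute[OF smooth_Mpow[OF Suc.prems(1)] Suc.prems(2)])
  also have "\<dots> = vf M ((vf M ^^ i) (vf L u)) x"
    by (rule vf_cong[OF open_S Suc.prems(2) Suc.IH[OF Suc.prems(1)]])
  finally show ?case by simp
qed simp

lemma L_W: "smooth_on S u \<Longrightarrow> x \<in> S \<Longrightarrow> vf L (W i j u) x = W i j (vf L u) x"
  unfolding W_def using L_Mpow[OF smooth_Lpow] by (simp add: funpow_swap1)

text \<open>
  With \<open>\<alpha> = \<beta> = 0\<close> the equations for the top order coefficients decouple. The top order part then
  commutes with \<open>L\<close> and can be removed.
\<close>

lemma coefficients_invariant: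
  assumes c: "\<And>i j. smooth_on S (c i j)" and comm: "commutes_up_to n c"
    and ij: "i + j \<le> n" and x: "x \<in> S"
  shows "vf L (c i j) x = 0"
  using comm ij
proof (induction n)
  case 0
  then show ?case using commutator_top[OF c 0(1), of 0 x] x by simp
next
  case (Suc m)
  have top: "vf L (c i (Suc m - i)) x = 0" if "i \<le> Suc m" "x \<in> S" for i x
    using commutator_top[OF c Suc.prems(1) that]
    by (simp only: alpha0[OF that(2)] beta0[OF that(2)] mult_zero_right mult_zero_left if_cancel add_0_right)
  have "commutes_up_to m c"
    by (rule commutes_up_to_lower[OF c Suc.prems(1)])
      (simp add: vf_mult[OF c smooth_W] top L_W)
  note IH = Suc.IH[OF this]
  show ?case
  proof (cases "i + j \<le> m")
    case False
    then have "j = Suc m - i" "i \<le> Suc m" using Suc.prems(2) by auto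
    then show ?thesis using top[OF _ x, of i] by simp
  qed (rule IH)
qed

end

section \<open>Linear systems in a commuting frame\<close>

context frame
begin

lemma frame_coeff_sums:
  assumes "x \<in> S"
  shows "L 1 x * coL (unit_vf 1) x + L 2 x * coL (unit_vf 2) x = 1"
    and "L 1 x * coM (unit_vf 1) x + L 2 x * coM (unit_vf 2) x = 0"
    and "M 1 x * coL (unit_vf 1) x + M 2 x * coL (unit_vf 2) x = 0"
    and "M 1 x * coM (unit_vf 1) x + M 2 x * coM (unit_vf 2) x = 1"
  using det_nz[OF assms]
  by (simp_all add: coL_def coM_def unit_vf_def diff_divide_distrib[symmetric] add_divide_distrib[symmetric]
      add: frame_det_def mult.commute)

text \<open>
  The one-form with value \<open>p\<close> on \<open>L\<close> and value \<open>q\<close> on \<open>M\<close>, in coordinates.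
\<close>

definition form :: "(real^2 \<Rightarrow> complex) \<Rightarrow> (real^2 \<Rightarrow> complex) \<Rightarrow> 2 \<Rightarrow> real^2 \<Rightarrow> complex" where
  "form p q i x = coL (unit_vf i) x * p x + coM (unit_vf i) x * q x"

lemma form_L: "x \<in> S \<Longrightarrow> L 1 x * form p q 1 x + L 2 x * form p q 2 x = p x"
proof -
  assume x: "x \<in> S"
  have "L 1 x * form p q 1 x + L 2 x * form p q 2 x
    = (L 1 x * coL (unit_vf 1) x + L 2 x * coL (unit_vf 2) x) * p x
    + (L 1 x * coM (unit_vf 1) x + L 2 x * coM (unit_vf 2) x) * q x"
    by (simp add: form_def algebra_simps)
  then show ?thesis by (simp only: frame_coeff_sums[OF x]) simp
qed

lemma form_M: "x \<in> S \<Longrightarrow> M 1 x * form p q 1 x + M 2 x * form p q 2 x = q x"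
proof -
  assume x: "x \<in> S"
  have "M 1 x * form p q 1 x + M 2 x * form p q 2 x
    = (M 1 x * coL (unit_vf 1) x + M 2 x * coL (unit_vf 2) x) * p x
    + (M 1 x * coM (unit_vf 1) x + M 2 x * coM (unit_vf 2) x) * q x"
    by (simp add: form_def algebra_simps)
  then show ?thesis by (simp only: frame_coeff_sums[OF x]) simp
qed

lemma vf_of_form:
  assumes x: "x \<in> S" and G: "\<And>i. partial_deriv i G x = form p q i x"
  shows "vf L G x = p x" "vf M G x = q x"
  using form_L[OF x] form_M[OF x] by (simp_all add: vf_def sum_2 G)

end

context commuting_frame
begin

text \<open>
  The formula \<open>d\<omega> (L, M) = L (\<omega> M) - M (\<omega> L) - \<omega> [L, M]\<close>, whose last term vanishes.
\<close>

lemma form_closed: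
  assumes T: "open T" "T \<subseteq> S" and p: "smooth_on T p" and q: "smooth_on T q"
    and closed: "\<And>x. x \<in> T \<Longrightarrow> vf L q x = vf M p x" and x: "x \<in> T"
  shows "partial_deriv i (form p q j) x = partial_deriv j (form p q i) x"
proof -
  let ?w = "form p q"
  note smL = smooth_on_subset[OF smooth_L T(2)] and smM = smooth_on_subset[OF smooth_M T(2)]
  have xS: "x \<in> S" using x T by blast
  have w: "smooth_on T (?w i)" for i
    unfolding form_def[abs_def]
    by (intro smooth_intros T(1) p q smooth_on_subset[OF smooth_coL T(2)]
        smooth_on_subset[OF smooth_coM T(2)] smooth_e)
  have pL: "vf M p x = vf M (L 1) x * ?w 1 x + L 1 x * vf M (?w 1) x + (vf M (L 2) x * ?w 2 x + L 2 x * vf M (?w 2) x)"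
  proof -
    have "vf M p x = vf M (\<lambda>x. L 1 x * ?w 1 x + L 2 x * ?w 2 x) x"
      by (rule vf_cong[OF T(1) x]) (use form_L T(2) in auto)
    then show ?thesis
      by (simp only: vf_add[OF smooth_on_mult[OF T(1) smL w] smooth_on_mult[OF T(1) smL w] x] vf_mult[OF smL w x])
  qed
  have qM: "vf L q x = vf L (M 1) x * ?w 1 x + M 1 x * vf L (?w 1) x + (vf L (M 2) x * ?w 2 x + M 2 x * vf L (?w 2) x)"
  proof -
    have "vf L q x = vf L (\<lambda>x. M 1 x * ?w 1 x + M 2 x * ?w 2 x) x"
      by (rule vf_cong[OF T(1) x]) (use form_M T(2) in auto)
    then show ?thesis
      by (simp only: vf_add[OF smooth_on_mult[OF T(1) smM w] smooth_on_mult[OF T(1) smM w] x] vf_mult[OF smM w x])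
  qed
  have br: "vf L (M k) x = vf M (L k) x" for k
    using commute[OF xS, of k] by (simp add: bracket_def)
  have "0 = M 1 x * vf L (?w 1) x + M 2 x * vf L (?w 2) x - L 1 x * vf M (?w 1) x - L 2 x * vf M (?w 2) x"
    using closed[OF x] unfolding pL qM br by (simp add: algebra_simps)
  also have "\<dots> = frame_det x * (partial_deriv 1 (?w 2) x - partial_deriv 2 (?w 1) x)"
    by (simp add: vf_def sum_2 frame_det_def algebra_simps)
  finally have "partial_deriv 1 (?w 2) x = partial_deriv 2 (?w 1) x"
    using det_nz[OF xS] by simp
  then show ?thesis using exhaust_2[of i] exhaust_2[of j] by auto
qed

text \<open>
  Each step of the iteration that solves linear systems is an instance.
\<close>

lemma frame_primitive:
  assumes T: "ball c R \<subseteq> S" and p: "smooth_on (ball c R) p" and q: "smooth_on (ball c R) q"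
    and closed: "\<And>x. x \<in> ball c R \<Longrightarrow> vf L q x = vf M p x"
  shows "\<exists>G. smooth_on (ball c R) G \<and> G c = 0 \<and> (\<forall>x\<in>ball c R. \<forall>i. partial_deriv i G x = form p q i x)"
proof -
  let ?w = "form p q"
  have w: "smooth_on (ball c R) (?w i)" for i
    unfolding form_def[abs_def]
    by (intro smooth_intros open_ball p q smooth_on_subset[OF smooth_coL T]
        smooth_on_subset[OF smooth_coM T] smooth_e)
  obtain G where G: "\<And>x. x \<in> ball c R \<Longrightarrow> (G has_derivative (\<lambda>v. \<Sum>i\<in>UNIV. (v $ i) *\<^sub>R ?w i x)) (at x)" "G c = 0"
    by (rule closed_form_has_primitive[OF w form_closed[OF open_ball T p q closed]]) auto
  have "smooth_on (ball c R) G"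
    by (rule smooth_on_partialsI[OF open_ball G(1)]) (use w in \<open>simp_all add: smooth_on_def\<close>)
  moreover have "partial_deriv i G x = ?w i x" if "x \<in> ball c R" for i x
    using partial_deriv_eqI[OF G(1)[OF that], of i] exhaust_2[of i] by (auto simp: sum_2 axis_def)
  ultimately show ?thesis using G(2) by blast
qed

end

lemma compact_family_bounded:
  fixes h :: "'i \<Rightarrow> 'a::metric_space \<Rightarrow> complex"
  assumes "compact C" "finite I" "\<And>i. i \<in> I \<Longrightarrow> continuous_on C (h i)"
  shows "\<exists>K>0. \<forall>i\<in>I. \<forall>x\<in>C. norm (h i x) \<le> K"
proof -
  have "continuous_on C (\<lambda>x. \<Sum>i\<in>I. norm (h i x))"
    by (intro continuous_on_sum continuous_on_norm assms(3))
  then have "bounded ((\<lambda>x. \<Sum>i\<in>I. norm (h i x)) ` C)"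
    by (rule compact_imp_bounded[OF compact_continuous_image[OF _ assms(1)]])
  then obtain K where K: "K > 0" "\<And>x. x \<in> C \<Longrightarrow> norm (\<Sum>i\<in>I. norm (h i x)) \<le> K"
    unfolding bounded_pos by auto
  have "norm (h i x) \<le> K" if "i \<in> I" "x \<in> C" for i x
  proof -
    have "norm (h i x) \<le> (\<Sum>i\<in>I. norm (h i x))"
      using member_le_sum[OF that(1), of "\<lambda>i. norm (h i x)"] assms(2) by simp
    also have "\<dots> \<le> norm (\<Sum>i\<in>I. norm (h i x))" by simp
    finally show ?thesis using K(2)[OF that(2)] by simp
  qed
  then show ?thesis using K(1) by blast
qed

lemma geometric_tail:
  fixes g :: "nat \<Rightarrow> complex"
  assumes "\<And>n. norm (g n) \<le> E * (1/2) ^ n"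
  shows "summable g" "norm (suminf g - (\<Sum>m<n. g m)) \<le> 2 * E * (1/2) ^ n"
proof -
  have s: "summable (\<lambda>m. E * (1/2) ^ n * (1/2) ^ m :: real)" for n
    by (intro summable_mult summable_geometric) auto
  show sg: "summable g"
    by (rule summable_comparison_test'[OF s[of 0]]) (use assms in simp)
  have "suminf g - (\<Sum>m<n. g m) = (\<Sum>m. g (m + n))"
    using suminf_minus_initial_segment[OF sg] by simp
  also have "norm \<dots> \<le> (\<Sum>m. E * (1/2) ^ n * (1/2) ^ m)"
    by (rule norm_suminf_le[OF _ s]) (use assms[of "_ + n"] in \<open>simp add: power_add mult_ac\<close>)
  also have "\<dots> = E * (1/2) ^ n * 2"
    using suminf_mult[OF summable_geometric, of "1/2::real" "E * (1/2) ^ n"] suminf_geometric[of "1/2::real"] by simp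
  finally show "norm (suminf g - (\<Sum>m<n. g m)) \<le> 2 * E * (1/2) ^ n" by (simp add: mult_ac)
qed

context commuting_frame
begin

text \<open>
  The solution is a series \<open>F = \<Sum>\<^sub>n G\<^sub>n\<close> with constant \<open>G\<^sub>0\<close> and \<open>L G\<^sub>n\<^sub>+\<^sub>1 = l G\<^sub>n\<close>, \<open>M G\<^sub>n\<^sub>+\<^sub>1 = B G\<^sub>n\<close>.
  Each step is integrable: \<open>L (B G\<^sub>n) = B (L G\<^sub>n) = l B G\<^sub>n\<^sub>-\<^sub>1 = M (l G\<^sub>n)\<close>, where the first equality is \<open>L B = 0\<close>.
  On a small ball the terms decay geometrically, and so do their derivatives, being linear in the previous
  terms.
\<close>

lemma linear_system_solution:
  fixes B :: "nat \<Rightarrow> nat \<Rightarrow> real^2 \<Rightarrow> complex" and e :: "nat \<Rightarrow> complex" and l :: complex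
  assumes x0: "x0 \<in> S" and B: "\<And>i j. smooth_on S (B i j)"
    and LB: "\<And>i j x. x \<in> S \<Longrightarrow> vf L (B i j) x = 0"
  shows "\<exists>r>0. ball x0 r \<subseteq> S \<and> (\<exists>F. \<forall>i<q. smooth_on (ball x0 r) (F i) \<and> F i x0 = e i \<and>
     (\<forall>x\<in>ball x0 r. vf L (F i) x = l * F i x \<and> vf M (F i) x = (\<Sum>j<q. B i j x * F j x)))"
proof -
  obtain R0 where R0: "R0 > 0" "cball x0 R0 \<subseteq> S" using open_contains_cball open_S x0 by blast
  have cont: "continuous_on (cball x0 R0) f" if "smooth_on S f" for f :: "real^2 \<Rightarrow> complex"
    by (rule continuous_on_subset[OF smooth_on_imp_continuous_on[OF that] R0(2)])
  have scoL: "smooth_on S (coL (unit_vf k))" and scoM: "smooth_on S (coM (unit_vf k))" for k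
    by (rule smooth_coL[OF smooth_e], rule smooth_coM[OF smooth_e])
  obtain K1 where K1: "K1 > 0" "\<forall>i\<in>UNIV. \<forall>x\<in>cball x0 R0. norm (coL (unit_vf i) x) \<le> K1"
    using compact_family_bounded[of "cball x0 R0" UNIV "\<lambda>k. coL (unit_vf k)", OF compact_cball finite cont[OF scoL]] by blast
  obtain K2 where K2: "K2 > 0" "\<forall>i\<in>UNIV. \<forall>x\<in>cball x0 R0. norm (coM (unit_vf i) x) \<le> K2"
    using compact_family_bounded[of "cball x0 R0" UNIV "\<lambda>k. coM (unit_vf k)", OF compact_cball finite cont[OF scoM]] by blast
  obtain K3 where K3: "K3 > 0" "\<forall>p\<in>{..<q} \<times> {..<q}. \<forall>x\<in>cball x0 R0. norm (B (fst p) (snd p) x) \<le> K3"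
    using compact_family_bounded[of "cball x0 R0" "{..<q} \<times> {..<q}" "\<lambda>p. B (fst p) (snd p)", OF compact_cball _ cont[OF B]]
    by blast
  define K where "K = K1 * norm l + K2 * (real q * K3)"
  have K: "K \<ge> 0" unfolding K_def using K1(1) K2(1) K3(1) by simp
  \<comment> \<open>The radius makes the map from \<open>G\<^sub>n\<close> to \<open>G\<^sub>n\<^sub>+\<^sub>1\<close> a contraction by the factor \<open>1/2\<close>.\<close>
  define R where "R = min R0 (1 / (4 * K + 1))"
  have R: "R > 0" "4 * K * R \<le> 1"
  proof -
    show "R > 0" unfolding R_def using R0(1) K by simp
    have "4 * K * R \<le> 4 * K * (1 / (4 * K + 1))" unfolding R_def using K by (intro mult_left_mono) auto
    also have "\<dots> \<le> 1" using K by (simp add: field_simps)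
    finally show "4 * K * R \<le> 1" .
  qed
  let ?U = "ball x0 R"
  have US: "?U \<subseteq> S" and UC: "?U \<subseteq> cball x0 R0" using R0(2) by (auto simp: R_def)
  have BU: "smooth_on ?U (B i j)" for i j by (rule smooth_on_subset[OF B US])
  define MB where "MB G i x = (\<Sum>j<q. B i j x * G j x)" for G :: "nat \<Rightarrow> real^2 \<Rightarrow> complex" and i x
  define w where "w G i = form (\<lambda>y. l * G i y) (MB G i)" for G :: "nat \<Rightarrow> real^2 \<Rightarrow> complex" and i
  have MBs: "smooth_on ?U (MB G i)" if "\<And>j. j < q \<Longrightarrow> smooth_on ?U (G j)" for G i
    unfolding MB_def[abs_def] by (intro smooth_intros open_ball BU) (use that in auto)
  have LMB: "vf L (MB G i) x = (\<Sum>j<q. B i j x * vf L (G j) x)"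
    if "\<And>j. j < q \<Longrightarrow> smooth_on ?U (G j)" "x \<in> ?U" for G i x
  proof -
    have "vf L (MB G i) x = (\<Sum>j<q. vf L (\<lambda>x. B i j x * G j x) x)"
      unfolding MB_def[abs_def]
      by (rule vf_sum[OF open_ball _ that(2)]) (intro smooth_on_mult open_ball BU, use that(1) in auto)
    also have "\<dots> = (\<Sum>j<q. B i j x * vf L (G j) x)"
    proof (rule sum.cong[OF refl])
      fix j assume "j \<in> {..<q}"
      then have "smooth_on ?U (G j)" using that(1) by simp
      from vf_mult[OF BU this that(2)] LB US that(2)
      show "vf L (\<lambda>x. B i j x * G j x) x = B i j x * vf L (G j) x" by auto
    qed
    finally show ?thesis .
  qed
  \<comment> \<open>\<open>P\<close> carries the integrability condition for the next step along the iteration.\<close>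
  define P where "P n G \<longleftrightarrow> (\<forall>i<q. smooth_on ?U (G i) \<and>
     (\<forall>x\<in>?U. vf L (MB G i) x = vf M (\<lambda>y. l * G i y) x)) \<and> (n = 0 \<longrightarrow> G = (\<lambda>i _. e i))"
    for n :: nat and G :: "nat \<Rightarrow> real^2 \<Rightarrow> complex"
  define Q where "Q G G' \<longleftrightarrow> (\<forall>i<q. G' i x0 = 0 \<and> (\<forall>x\<in>?U. \<forall>k. partial_deriv k (G' i) x = w G i k x))"
    for G G' :: "nat \<Rightarrow> real^2 \<Rightarrow> complex"
  have "\<exists>G. P 0 G"
  proof (rule exI[of _ "\<lambda>i _. e i"])
    have "vf L (MB (\<lambda>i _. e i) i) x = vf M (\<lambda>y. l * e i) x" if "x \<in> ?U" for i x
      using LMB[of "\<lambda>i _. e i" x i] that by (simp add: smooth_on_const vf_const)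
    then show "P 0 (\<lambda>i _. e i)" by (simp add: P_def smooth_on_const)
  qed
  moreover have "\<exists>G'. P (Suc n) G' \<and> Q G G'" if PG: "P n G" for n G
  proof -
    have G: "\<And>j. j < q \<Longrightarrow> smooth_on ?U (G j)" using PG by (simp add: P_def)
    have lG: "smooth_on ?U (\<lambda>y. l * G i y)" if "i < q" for i
      by (intro smooth_intros open_ball G that)
    have "\<forall>i. \<exists>H. i < q \<longrightarrow> smooth_on ?U H \<and> H x0 = 0 \<and> (\<forall>x\<in>?U. \<forall>k. partial_deriv k H x = w G i k x)"
    proof
      fix i
      show "\<exists>H. i < q \<longrightarrow> smooth_on ?U H \<and> H x0 = 0 \<and> (\<forall>x\<in>?U. \<forall>k. partial_deriv k H x = w G i k x)"
      proof (cases "i < q")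
        case True
        have "\<exists>H. smooth_on ?U H \<and> H x0 = 0 \<and> (\<forall>x\<in>?U. \<forall>k. partial_deriv k H x = w G i k x)"
          unfolding w_def
          by (rule frame_primitive[OF US lG[OF True] MBs[OF G]]) (use PG True in \<open>auto simp: P_def\<close>)
        then show ?thesis by blast
      qed simp
    qed
    then obtain G' where G': "\<And>i. i < q \<Longrightarrow> smooth_on ?U (G' i) \<and> G' i x0 = 0 \<and>
        (\<forall>x\<in>?U. \<forall>k. partial_deriv k (G' i) x = w G i k x)" by metis
    have sG': "smooth_on ?U (G' i)" if "i < q" for i using G'[OF that] by blast
    have pG': "partial_deriv k (G' i) x = form (\<lambda>y. l * G i y) (MB G i) k x" if "i < q" "x \<in> ?U" for i k x
      using G'[OF that(1)] that(2) by (simp add: w_def)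
    have der: "vf L (G' i) x = l * G i x" "vf M (G' i) x = MB G i x" if "i < q" "x \<in> ?U" for i x
      using vf_of_form[of x "G' i", OF _ pG'[OF that]] that US by auto
    have "vf L (MB G' i) x = vf M (\<lambda>y. l * G' i y) x" if i: "i < q" and x: "x \<in> ?U" for i x
    proof -
      have "vf L (MB G' i) x = (\<Sum>j<q. B i j x * vf L (G' j) x)"
        by (rule LMB) (use sG' x in auto)
      also have "\<dots> = (\<Sum>j<q. B i j x * (l * G j x))"
        by (rule sum.cong[OF refl]) (use der(1) x in simp)
      also have "\<dots> = l * MB G i x" by (simp add: MB_def sum_distrib_left mult_ac)
      also have "\<dots> = vf M (\<lambda>y. l * G' i y) x"
        using vf_cmult[OF open_ball sG'[OF i] x] der(2)[OF i x] by simp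
      finally show ?thesis .
    qed
    then have "P (Suc n) G' \<and> Q G G'" using G' by (simp add: P_def Q_def)
    then show ?thesis by blast
  qed
  ultimately obtain G where PG: "\<And>n. P n (G n)" and QG: "\<And>n. Q (G n) (G (Suc n))"
    using dependent_nat_choice[of P "\<lambda>_. Q"] by blast
  have sG: "smooth_on ?U (G n i)" if "i < q" for n i using PG[of n] that by (simp add: P_def)
  have G0: "G 0 i x = e i" for i x using PG[of 0] by (simp add: P_def)
  have Gx0: "G (Suc n) i x0 = 0" if "i < q" for n i using QG[of n] that by (simp add: Q_def)
  have dG: "partial_deriv k (G (Suc n) i) x = w (G n) i k x" if "i < q" "x \<in> ?U" for n i k x
    using QG[of n] that by (simp add: Q_def)
  have wbound: "norm (w H i k x) \<le> K * b" if i: "i < q" and x: "x \<in> ?U" and H: "\<And>j. j < q \<Longrightarrow> norm (H j x) \<le> b" for H i k x b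
  proof -
    have xC: "x \<in> cball x0 R0" using UC x by blast
    have b: "b \<ge> 0" using H[OF i] norm_ge_zero order_trans by blast
    have "norm (MB H i x) \<le> (\<Sum>j<q. K3 * b)"
      unfolding MB_def
      by (rule sum_norm_le, unfold norm_mult, intro mult_mono)
         (use K3 i xC H in auto)
    then have 2: "norm (coM (unit_vf k) x * MB H i x) \<le> K2 * (real q * (K3 * b))"
      unfolding norm_mult using K2 xC b K3(1) by (intro mult_mono) auto
    have 1: "norm (coL (unit_vf k) x * (l * H i x)) \<le> K1 * (norm l * b)"
      unfolding norm_mult using K1 xC H[OF i] b by (intro mult_mono) auto
    have "norm (w H i k x) \<le> norm (coL (unit_vf k) x * (l * H i x)) + norm (coM (unit_vf k) x * MB H i x)"
      unfolding w_def form_def by (rule norm_triangle_ineq)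
    also have "\<dots> \<le> K1 * (norm l * b) + K2 * (real q * (K3 * b))" using 1 2 by linarith
    finally show ?thesis by (simp add: K_def algebra_simps)
  qed
  have sumnorm: "norm (\<Sum>k\<in>UNIV. (h $ k) *\<^sub>R a k) \<le> 2 * b * norm h" if "\<And>k. norm (a k) \<le> b" for h :: "real^2" and a :: "2 \<Rightarrow> complex" and b
  proof -
    have "norm ((h $ k) *\<^sub>R a k) \<le> norm h * b" for k
      unfolding norm_scaleR using component_le_norm_cart[of h k] that[of k] by (intro mult_mono) auto
    from add_mono[OF this[of 1] this[of 2]] show ?thesis
      using norm_triangle_ineq[of "(h $ 1) *\<^sub>R a 1" "(h $ 2) *\<^sub>R a 2"] by (simp add: sum_2)
  qed
  define E where "E = (\<Sum>i<q. norm (e i))"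
  have E: "norm (e i) \<le> E" if "i < q" for i
    unfolding E_def using member_le_sum[of i "{..<q}" "\<lambda>i. norm (e i)"] that by simp
  have Gbound: "norm (G n i x) \<le> E * (1/2) ^ n" if "i < q" "x \<in> ?U" for n i x
    using that
  proof (induction n arbitrary: i x)
    case 0
    then show ?case using E by (simp add: G0)
  next
    case (Suc n)
    have "norm (G (Suc n) i x - G (Suc n) i x0) \<le> (2 * (K * (E * (1/2) ^ n))) * norm (x - x0)"
    proof (rule differentiable_bound[OF convex_ball _ _ Suc.prems(2)])
      show "x0 \<in> ?U" using R by simp
      fix y assume y: "y \<in> ?U"
      show "(G (Suc n) i has_derivative (\<lambda>v. \<Sum>k\<in>UNIV. (v $ k) *\<^sub>R partial_deriv k (G (Suc n) i) y)) (at y within ?U)"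
        by (rule has_derivative_at_withinI[OF has_derivative_partial_deriv[OF sG[OF Suc.prems(1)] y]])
      show "onorm (\<lambda>v. \<Sum>k\<in>UNIV. (v $ k) *\<^sub>R partial_deriv k (G (Suc n) i) y) \<le> 2 * (K * (E * (1/2) ^ n))"
        by (rule onorm_le, rule sumnorm, unfold dG[OF Suc.prems(1) y], rule wbound[OF Suc.prems(1) y]) (use Suc.IH y in auto)
    qed
    also have "\<dots> \<le> (2 * (K * (E * (1/2) ^ n))) * R"
      using Suc.prems(2) K E[OF Suc.prems(1)] order_trans[OF norm_ge_zero E[OF Suc.prems(1)]]
      by (intro mult_left_mono) (auto simp: dist_norm norm_minus_commute)
    also have "\<dots> = (4 * K * R) * (E * (1/2) ^ Suc n)" by simp
    also have "\<dots> \<le> 1 * (E * (1/2) ^ Suc n)"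
      using R order_trans[OF norm_ge_zero E[OF Suc.prems(1)]] by (intro mult_right_mono) auto
    finally show ?case using Gx0[OF Suc.prems(1)] by simp
  qed
  define F where "F i x = (\<Sum>n. G n i x)" for i x
  have tail: "norm (F i x - (\<Sum>m<n. G m i x)) \<le> 2 * E * (1/2) ^ n" if "i < q" "x \<in> ?U" for i x n
    unfolding F_def by (rule geometric_tail(2)[OF Gbound[OF that]])
  have summ: "(\<lambda>n. G n i x) sums F i x" if "i < q" "x \<in> ?U" for i x
    unfolding F_def using geometric_tail(1)[OF Gbound[OF that]] by (rule summable_sums)
  have wdiff: "w H i k x - w H' i k x = w (\<lambda>j x. H j x - H' j x) i k x" for H H' i k x
    by (simp add: w_def form_def MB_def algebra_simps sum_subtractf)
  have wsum: "(\<Sum>m<n. w (G m) i k x) = w (\<lambda>j x. \<Sum>m<n. G m j x) i k x" for n i k x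
    unfolding w_def form_def MB_def
    by (simp add: sum.distrib sum_distrib_left sum.swap[of _ "{..<n}" "{..<q}"])
  have derF: "(F i has_derivative (\<lambda>v. \<Sum>k\<in>UNIV. (v $ k) *\<^sub>R w F i k x)) (at x)" if i: "i < q" and x: "x \<in> ?U" for i x
  proof -
    let ?f' = "\<lambda>n x v. \<Sum>k\<in>UNIV. (v $ k) *\<^sub>R partial_deriv k (G n i) x"
    \<comment> \<open>The derivative of the next term is the form of the current one, which shifts the index by one.\<close>
    have part: "(\<Sum>m<Suc n. ?f' m y v) - (\<Sum>k\<in>UNIV. (v $ k) *\<^sub>R w F i k y)
        = (\<Sum>k\<in>UNIV. (v $ k) *\<^sub>R w (\<lambda>j x. (\<Sum>m<n. G m j x) - F j x) i k y)" if y: "y \<in> ?U" for n y v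
    proof -
      have "partial_deriv k (G 0 i) y = 0" for k
        using partial_deriv_const[of k "e i" y] G0[of i] by (simp add: fun_eq_iff[THEN iffD2, of "G 0 i" "\<lambda>_. e i"])
      then have "(\<Sum>m<Suc n. ?f' m y v) = (\<Sum>m<n. \<Sum>k\<in>UNIV. (v $ k) *\<^sub>R w (G m) i k y)"
        by (subst sum.lessThan_Suc_shift) (simp add: dG[OF i y])
      also have "\<dots> = (\<Sum>k\<in>UNIV. (v $ k) *\<^sub>R w (\<lambda>j x. \<Sum>m<n. G m j x) i k y)"
        by (subst sum.swap) (simp add: scaleR_sum_right[symmetric] wsum)
      finally show ?thesis
        by (simp add: sum_subtractf[symmetric] scaleR_diff_right[symmetric] wdiff)
    qed
    have "\<exists>g. \<forall>x\<in>?U. (\<lambda>n. G n i x) sums g x \<and> (g has_derivative (\<lambda>v. \<Sum>k\<in>UNIV. (v $ k) *\<^sub>R w F i k x)) (at x within ?U)"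
    proof (rule has_derivative_series[where f = "\<lambda>n. G n i" and f' = ?f' and S = ?U and x = x and l = "F i x"
          and g' = "\<lambda>x v. \<Sum>k\<in>UNIV. (v $ k) *\<^sub>R w F i k x", OF convex_ball _ _ x summ[OF i x]])
      show "(G n i has_derivative ?f' n y) (at y within ?U)" if "y \<in> ?U" for n y
        by (rule has_derivative_at_withinI[OF has_derivative_partial_deriv[OF sG[OF i] that]])
      fix d :: real assume d: "d > 0"
      have "(\<lambda>n. 4 * K * E * (1/2) ^ n) \<longlonglongrightarrow> 4 * K * E * 0"
        by (intro tendsto_mult tendsto_const LIMSEQ_power_zero) auto
      then have "\<forall>\<^sub>F n in sequentially. 4 * K * E * (1/2) ^ n < d"
        using d by (intro order_tendstoD(2)[where y = "4 * K * E * 0"]) auto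
      then have "\<forall>\<^sub>F n in sequentially. \<forall>y\<in>?U. \<forall>v. norm (sum (\<lambda>m. ?f' m y v) {..<Suc n} - (\<Sum>k\<in>UNIV. (v $ k) *\<^sub>R w F i k y)) \<le> d * norm v"
      proof eventually_elim
        case (elim n)
        show ?case
        proof (intro ballI allI)
          fix y v assume y: "y \<in> ?U"
          have "norm (sum (\<lambda>m. ?f' m y v) {..<Suc n} - (\<Sum>k\<in>UNIV. (v $ k) *\<^sub>R w F i k y)) \<le> 2 * (K * (2 * E * (1/2) ^ n)) * norm v"
            unfolding part[OF y]
            by (rule sumnorm, rule wbound[OF i y]) (use tail[OF _ y] in \<open>simp add: norm_minus_commute\<close>)
          also have "\<dots> \<le> d * norm v" using elim by (intro mult_right_mono) auto
          finally show "norm (sum (\<lambda>m. ?f' m y v) {..<Suc n} - (\<Sum>k\<in>UNIV. (v $ k) *\<^sub>R w F i k y)) \<le> d * norm v" .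
        qed
      qed
      then show "\<forall>\<^sub>F n in sequentially. \<forall>y\<in>?U. \<forall>v. norm (sum (\<lambda>m. ?f' m y v) {..<n} - (\<Sum>k\<in>UNIV. (v $ k) *\<^sub>R w F i k y)) \<le> d * norm v"
        by (subst (asm) eventually_sequentially_Suc)
    qed
    then obtain g where g: "\<And>y. y \<in> ?U \<Longrightarrow> (\<lambda>n. G n i y) sums g y"
      "\<And>y. y \<in> ?U \<Longrightarrow> (g has_derivative (\<lambda>v. \<Sum>k\<in>UNIV. (v $ k) *\<^sub>R w F i k y)) (at y within ?U)" by blast
    have "g y = F i y" if "y \<in> ?U" for y
      using sums_unique2[OF g(1)[OF that] summ[OF i that]] .
    then have "(F i has_derivative (\<lambda>v. \<Sum>k\<in>UNIV. (v $ k) *\<^sub>R w F i k x)) (at x within ?U)"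
      using has_derivative_transform[OF x _ g(2)[OF x]] by simp
    then show ?thesis using x by (simp add: at_within_open[OF _ open_ball])
  qed
  \<comment> \<open>All components are bootstrapped simultaneously, since each derivative involves all of them.\<close>
  have ckF: "\<forall>i<q. Ck_on k ?U (F i)" for k
  proof (induction k)
    case 0
    have "F i differentiable at x within ?U" if "i < q" "x \<in> ?U" for i x
      using derF[OF that] by (auto simp: differentiable_def intro: has_derivative_at_withinI)
    then show ?case by (simp add: differentiable_imp_continuous_on differentiable_on_def)
  next
    case (Suc k)
    have co: "Ck_on k ?U (coL (unit_vf m))" "Ck_on k ?U (coM (unit_vf m))" "Ck_on k ?U (B i j)" for m i j
      using smooth_on_subset[OF scoL US] smooth_on_subset[OF scoM US] BU
      unfolding smooth_on_def by auto
    have "Ck_on k ?U (w F i m)" if "i < q" for i m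
      unfolding w_def form_def[abs_def] MB_def[abs_def]
      by (intro Ck_on_add Ck_on_sum Ck_on_bilinear[OF _ bounded_bilinear_mult] open_ball co Ck_on_const)
        (use Suc that in auto)
    then show ?case
      by (intro allI impI Ck_on_SucI[OF open_ball derF] Ck_on_sum open_ball
          Ck_on_bounded_linear[OF _ bounded_linear_scaleR_right]) auto
  qed
  have sF: "smooth_on ?U (F i)" if "i < q" for i
    using ckF that by (simp add: smooth_on_def)
  have pF: "partial_deriv k (F i) x = form (\<lambda>y. l * F i y) (MB F i) k x" if "i < q" "x \<in> ?U" for i k x
    using partial_deriv_eqI[OF derF[OF that], of k] exhaust_2[of k] by (auto simp: sum_2 axis_def w_def)
  have "vf L (F i) x = l * F i x \<and> vf M (F i) x = (\<Sum>j<q. B i j x * F j x)" if "i < q" "x \<in> ?U" for i x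
    using vf_of_form[of x "F i", OF _ pF[OF that]] that US by (auto simp: MB_def)
  moreover have "F i x0 = e i" if "i < q" for i
  proof -
    have "(\<lambda>n. G n i x0) sums (\<Sum>n\<in>{0}. G n i x0)"
      by (rule sums_finite) (use Gx0[OF that] in \<open>auto simp: gr0_conv_Suc\<close>)
    then show ?thesis using sums_unique2[OF summ[OF that, of x0]] R by (simp add: G0)
  qed
  ultimately show ?thesis using R(1) US sF by (intro exI[of _ R]) blast
qed

end

section \<open>Bump functions\<close>

text \<open>
  The powers in the denominator make the family closed under differentiation.
\<close>

definition flat :: "nat \<Rightarrow> real \<Rightarrow> real" where
  "flat k t = (if t > 0 then exp (- (1 / t)) / t ^ k else 0)"

lemma flat_tendsto_0: "(flat k \<longlongrightarrow> 0) (at 0)"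
proof (rule filterlim_split_at)
  have "((\<lambda>s::real. s ^ k / exp s) \<longlongrightarrow> 0) at_top" for k by (rule tendsto_power_div_exp_0)
  then have "((\<lambda>t. (inverse t) ^ k / exp (inverse t)) \<longlongrightarrow> 0) (at_right (0::real))"
    by (rule filterlim_compose[OF _ filterlim_inverse_at_top_right])
  moreover have "\<forall>\<^sub>F t in at_right 0. (inverse t) ^ k / exp (inverse t) = flat k t"
    by (rule eventually_at_rightI[of 0 1]) (auto simp: flat_def exp_minus field_simps power_divide)
  ultimately show "(flat k \<longlongrightarrow> 0) (at_right 0)"
    by (rule Lim_transform_eventually)
  have "\<forall>\<^sub>F t in at_left (0::real). 0 = flat k t"
    by (rule eventually_at_leftI[of "-1"]) (auto simp: flat_def)
  then show "(flat k \<longlongrightarrow> 0) (at_left 0)"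
    by (rule Lim_transform_eventually[OF tendsto_const])
qed

lemma flat_has_derivative:
  "(flat k has_real_derivative flat (Suc (Suc k)) t - of_nat k * flat (Suc k) t) (at t)"
proof (cases t "0::real" rule: linorder_cases)
  case less
  have "((\<lambda>_. 0) has_real_derivative 0) (at t)" by simp
  then have "(flat k has_real_derivative 0) (at t)"
    by (rule has_field_derivative_transform_within_open[of _ _ _ "{..<0}"]) (use less in \<open>auto simp: flat_def\<close>)
  then show ?thesis using less by (simp add: flat_def)
next
  case equal
  have "((\<lambda>h. (flat k (0 + h) - flat k 0) / h) \<longlongrightarrow> 0) (at 0)"
  proof (rule Lim_transform_eventually[OF flat_tendsto_0[of "Suc k"]])
    show "\<forall>\<^sub>F h in at 0. flat (Suc k) h = (flat k (0 + h) - flat k 0) / h"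
      by (auto simp: flat_def eventually_at_filter field_simps)
  qed
  then show ?thesis using equal by (simp add: DERIV_def flat_def)
next
  case greater
  have "((\<lambda>t. exp (- (1 / t)) / t ^ k) has_real_derivative
      (exp (- (1 / t)) * (1 / t ^ 2) * t ^ k - exp (- (1 / t)) * (of_nat k * t ^ (k - 1))) / (t ^ k * t ^ k)) (at t)"
    using greater by (auto intro!: derivative_eq_intros simp: power2_eq_square)
  also have "(exp (- (1 / t)) * (1 / t ^ 2) * t ^ k - exp (- (1 / t)) * (of_nat k * t ^ (k - 1))) / (t ^ k * t ^ k)
    = flat (Suc (Suc k)) t - of_nat k * flat (Suc k) t"
    using greater by (cases k) (simp_all add: flat_def field_simps power2_eq_square)
  finally have d: "((\<lambda>t. exp (- (1 / t)) / t ^ k) has_real_derivative flat (Suc (Suc k)) t - of_nat k * flat (Suc k) t) (at t)" .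
  show ?thesis
    by (rule has_field_derivative_transform_within_open[OF d, of "{0<..}"]) (use greater in \<open>auto simp: flat_def\<close>)
qed

lemma smooth_on_flat: "smooth_on UNIV (flat k)"
proof -
  have "Ck_on n UNIV (flat k)" for n
  proof (induction n arbitrary: k)
    case 0
    show ?case
      by (simp, rule continuous_at_imp_continuous_on) (use flat_has_derivative DERIV_isCont in blast)
  next
    case (Suc n)
    have "Ck_on n UNIV (\<lambda>t. (flat (Suc (Suc k)) t + (- of_nat k) * flat (Suc k) t) * v)" for v
      by (intro Ck_on_bilinear[OF open_UNIV bounded_bilinear_mult] Ck_on_add Suc Ck_on_const open_UNIV)
    then show ?case
      by (intro Ck_on_SucI[OF open_UNIV flat_has_derivative[unfolded has_field_derivative_def]]) simp
  qed
  then show ?thesis by (simp add: smooth_on_def)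
qed

text \<open>
  In terms of \<open>s = 2 |x - x\<^sub>0|\<^sup>2 / r\<^sup>2\<close>, the quotient equals \<open>1\<close> for \<open>s \<le> 1\<close> and \<open>0\<close> for \<open>s \<ge> 2\<close>. The denominator
  is positive because \<open>2 - s\<close> and \<open>s - 1\<close> are not both non-positive.
\<close>

lemma exists_bump:
  fixes x0 :: "'e::euclidean_space"
  assumes "r > 0"
  shows "\<exists>b::'e \<Rightarrow> real. smooth_on UNIV b \<and> (\<forall>x\<in>ball x0 (r / 2). b x = 1) \<and> (\<forall>x. x \<notin> ball x0 r \<longrightarrow> b x = 0)"
proof -
  define s where "s x = 2 / r ^ 2 * ((x - x0) \<bullet> (x - x0))" for x
  define b where "b x = flat 0 (2 - s x) / (flat 0 (2 - s x) + flat 0 (s x - 1))" for x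
  have s: "smooth_on UNIV s"
    unfolding s_def[abs_def]
    by (intro smooth_intros open_UNIV smooth_on_bilinear[OF _ bounded_bilinear_inner] smooth_intros)
  have den: "flat 0 (2 - t) + flat 0 (t - 1) \<noteq> 0" for t
    by (cases "t < 2") (auto simp: flat_def add_pos_pos order.strict_implies_not_eq[OF exp_gt_zero, symmetric]
        intro!: order.strict_implies_not_eq[symmetric] add_pos_nonneg add_nonneg_pos)
  have c: "smooth_on UNIV (\<lambda>x. flat 0 (u x))" if "smooth_on UNIV u" for u :: "'e \<Rightarrow> real"
    by (rule smooth_on_compose[OF open_UNIV open_UNIV _ that smooth_on_flat]) auto
  have "smooth_on UNIV b"
    unfolding b_def[abs_def]
    by (intro smooth_intros open_UNIV c smooth_intros s) (rule den)
  moreover have "b x = 1" if "x \<in> ball x0 (r / 2)" for x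
  proof -
    have "norm (x - x0) \<le> r / 2" using that by (simp add: dist_norm norm_minus_commute)
    then have "norm (x - x0) ^ 2 \<le> (r / 2) ^ 2" by (intro power_mono) auto
    also have "(r / 2) ^ 2 = r ^ 2 / 4" by (simp add: power_divide)
    finally have "2 * norm (x - x0) ^ 2 \<le> r ^ 2"
      using zero_le_power2[of "norm (x - x0)"] by linarith
    then have "s x \<le> 1" using assms by (simp add: s_def dot_square_norm field_simps power_divide)
    then show ?thesis by (simp add: b_def flat_def)
  qed
  moreover have "b x = 0" if "x \<notin> ball x0 r" for x
  proof -
    have "norm (x - x0) \<ge> r" using that by (simp add: dist_norm norm_minus_commute)
    then have "norm (x - x0) ^ 2 \<ge> r ^ 2" using assms by (intro power_mono) auto
    then have "s x \<ge> 2" using assms by (simp add: s_def dot_square_norm field_simps)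
    then show ?thesis by (simp add: b_def flat_def)
  qed
  ultimately show ?thesis by blast
qed

lemma local_extension:
  fixes f :: "'e::euclidean_space \<Rightarrow> 'f::real_normed_vector"
  assumes "open T" "x0 \<in> T" "smooth_on T f"
  shows "\<exists>g V. smooth_on UNIV g \<and> open V \<and> x0 \<in> V \<and> V \<subseteq> T \<and> (\<forall>y\<in>V. g y = f y)"
proof -
  obtain r where r: "r > 0" "cball x0 r \<subseteq> T" using open_contains_cball assms by blast
  obtain b :: "'e \<Rightarrow> real" where b: "smooth_on UNIV b" "\<And>x. x \<in> ball x0 (r / 2) \<Longrightarrow> b x = 1" "\<And>x. x \<notin> ball x0 r \<Longrightarrow> b x = 0"
    using exists_bump[OF r(1), of x0] by blast
  define g where "g x = (if x \<in> T then b x *\<^sub>R f x else 0)" for x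
  have "smooth_on UNIV g"
  proof (rule smooth_on_local)
    fix x :: 'e
    show "\<exists>W. open W \<and> x \<in> W \<and> smooth_on W g"
    proof (cases "x \<in> T")
      case True
      have "smooth_on T (\<lambda>x. b x *\<^sub>R f x)"
        by (intro smooth_on_scaleR assms smooth_on_subset[OF b(1)]) simp
      then have "smooth_on T g" using smooth_on_cong[OF assms(1), of g "\<lambda>x. b x *\<^sub>R f x"] by (simp add: g_def)
      then show ?thesis using True assms(1) by blast
    next
      case False
      have "open (- cball x0 r)" by (simp add: open_Compl)
      moreover have "g y = 0" if "y \<in> - cball x0 r" for y using that b(3)[of y] by (simp add: g_def)
      ultimately have "smooth_on (- cball x0 r) g"
        using smooth_on_cong[of "- cball x0 r" g "\<lambda>_. 0"] smooth_on_const by simp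
      moreover have "x \<in> - cball x0 r" using False r by blast
      ultimately show ?thesis using \<open>open (- cball x0 r)\<close> by blast
    qed
  qed
  moreover have "ball x0 (r / 2) \<subseteq> T" using r by (auto simp: subset_iff)
  moreover have "\<forall>y\<in>ball x0 (r / 2). g y = f y" using b(2) \<open>ball x0 (r / 2) \<subseteq> T\<close> by (auto simp: g_def)
  ultimately show ?thesis using r(1) by (intro exI[of _ g] exI[of _ "ball x0 (r / 2)"]) auto
qed

lemma partial_derivs_cong:
  assumes "open V" "\<And>y. y \<in> V \<Longrightarrow> u y = w y" "x \<in> V"
  shows "partial_derivs is u x = partial_derivs is w x"
  using assms(3)
proof (induction "is" arbitrary: x)
  case (Cons i "is")
  then show ?case
    unfolding partial_derivs_def foldr.simps comp_apply
    by (intro partial_deriv_cong[OF assms(1) Cons.prems]) (simp add: partial_derivs_def)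
qed (use assms(2) in \<open>simp add: partial_derivs_def\<close>)

section \<open>Local solutions\<close>

lemma exists_nonzero_nonroot:
  fixes b :: "nat \<Rightarrow> complex"
  assumes "k \<le> n" "b k \<noteq> 0"
  shows "\<exists>z. z \<noteq> 0 \<and> (\<Sum>j\<le>n. b j * z ^ j) \<noteq> 0"
proof -
  have "finite {z. (\<Sum>j\<le>n. b j * z ^ j) = 0}"
    by (rule polyfun_rootbound_finite) (use assms in auto)
  then have "finite (insert 0 {z. (\<Sum>j\<le>n. b j * z ^ j) = 0})" by simp
  from ex_new_if_finite[OF infinite_UNIV_char_0 this] show ?thesis by auto
qed

context frame
begin

lemma frame_subset: "open T \<Longrightarrow> T \<subseteq> S \<Longrightarrow> frame T L M"
  using indep smooth_on_subset[OF smooth_L] smooth_on_subset[OF smooth_M]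
  by (simp add: frame_def subset_iff)

lemma sum_tri_pure:
  assumes "\<And>i j. 1 \<le> i \<Longrightarrow> i + j \<le> n \<Longrightarrow> c i j x = 0"
  shows "nsum n c u x = (\<Sum>j\<le>n. c 0 j x * (vf L ^^ j) u x)"
proof -
  have "nsum n c u x = (\<Sum>p\<in>{0} \<times> {..n}. c (fst p) (snd p) x * W (fst p) (snd p) u x)"
  proof (rule sum.mono_neutral_right[OF finite_tri])
    show "\<forall>p\<in>tri n - {0} \<times> {..n}. c (fst p) (snd p) x * W (fst p) (snd p) u x = 0"
    proof
      fix p assume "p \<in> tri n - {0} \<times> {..n}"
      then have "1 \<le> fst p" "fst p + snd p \<le> n" by (auto simp: tri_def)
      from assms[OF this] show "c (fst p) (snd p) x * W (fst p) (snd p) u x = 0" by simp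
    qed
  qed (auto simp: tri_def)
  also have "\<dots> = (\<Sum>j\<le>n. c 0 j x * (vf L ^^ j) u x)"
    by (rule sum.reindex_bij_witness[of _ "\<lambda>j. (0, j)" snd]) (auto simp: W_def)
  finally show ?thesis .
qed

lemma commutes_up_to_of_operator:
  assumes D: "\<And>u x. smooth_on S u \<Longrightarrow> x \<in> S \<Longrightarrow> D u x = nsum n c u x"
    and comm: "\<And>u x. smooth_on S u \<Longrightarrow> x \<in> S \<Longrightarrow> D (vf L u) x = vf L (D u) x"
  shows "commutes_up_to n c"
  unfolding commutes_up_to_def
proof (intro allI impI)
  fix u :: "real^2 \<Rightarrow> complex" and x assume u: "smooth_on S u" and x: "x \<in> S"
  have "vf L (\<lambda>y. nsum n c u y) x = vf L (D u) x"
    by (rule vf_cong[OF open_S x]) (simp add: D[OF u])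
  also have "\<dots> = nsum n c (vf L u) x"
    using comm[OF u x] D[OF smooth_vfL[OF u] x] by simp
  finally show "vf L (\<lambda>y. nsum n c u y) x
    = nsum n c (vf L u) x" .
qed

end

context commuting_frame
begin

lemma commuting_frame_subset: "open T \<Longrightarrow> T \<subseteq> S \<Longrightarrow> commuting_frame T L M"
  using frame_subset commute by (auto simp: commuting_frame_def commuting_frame_axioms_def)

text \<open>
  Let \<open>q\<close> be the highest power of \<open>M\<close> in the operator. On functions with \<open>L f = l f\<close> the operator acts
  as \<open>\<Sum>\<^sub>i C\<^sub>i M\<^sup>i\<close>, of degree \<open>q\<close> in \<open>M\<close>, and \<open>l \<noteq> 0\<close> is chosen such that \<open>C\<^sub>q\<close> does not vanish at \<open>x0\<close>. The matrix
  \<open>B\<close> is the companion matrix of this operator.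
\<close>

theorem local_solution:
  assumes c: "\<And>i j. smooth_on S (c i j)" and comm: "commutes_up_to n c"
    and nz: "\<exists>i j. \<exists>x\<in>S. 1 \<le> i \<and> i + j \<le> n \<and> c i j x \<noteq> 0"
  shows "\<exists>x0 r f. r > 0 \<and> ball x0 r \<subseteq> S \<and> smooth_on (ball x0 r) f \<and>
    (\<forall>x\<in>ball x0 r. nsum n c f x = 0) \<and>
    f x0 \<noteq> 0 \<and> (\<exists>k. partial_deriv k f x0 \<noteq> 0)"
proof -
  let ?P = "\<lambda>i. 1 \<le> i \<and> (\<exists>j. \<exists>x\<in>S. i + j \<le> n \<and> c i j x \<noteq> 0)"
  define q where "q = Max {i. ?P i}"
  have fin: "finite {i. ?P i}" by (rule finite_subset[of _ "{..n}"]) auto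
  have ne: "{i. ?P i} \<noteq> {}" using nz by blast
  have q1: "1 \<le> q" and "\<exists>j. \<exists>x\<in>S. q + j \<le> n \<and> c q j x \<noteq> 0"
    using Max_in[OF fin ne] unfolding q_def by auto
  then obtain j0 x0 where x0: "x0 \<in> S" "q + j0 \<le> n" "c q j0 x0 \<noteq> 0" by blast
  have above: "c i j x = 0" if "q < i" "i + j \<le> n" "x \<in> S" for i j x
  proof (rule ccontr)
    assume "c i j x \<noteq> 0"
    then have "i \<in> {i. ?P i}" using that q1 by auto
    from Max_ge[OF fin this] show False using that by (simp add: q_def)
  qed
  obtain l where l: "l \<noteq> 0" "(\<Sum>j\<le>n. (if q + j \<le> n then c q j x0 else 0) * l ^ j) \<noteq> 0"
    using exists_nonzero_nonroot[of j0 n "\<lambda>j. if q + j \<le> n then c q j x0 else 0"] x0 by auto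
  define C where "C i x = (\<Sum>j\<le>n. (if i + j \<le> n then c i j x else 0) * l ^ j)" for i x
  have cs: "smooth_on S (\<lambda>x. if i + j \<le> n then c i j x else 0)" for i j
    by (cases "i + j \<le> n") (simp_all add: c smooth_on_const open_S)
  have C: "smooth_on S (C i)" for i
    unfolding C_def[abs_def] by (intro smooth_intros open_S cs)
  have LC: "vf L (C i) x = 0" if x: "x \<in> S" for i x
  proof -
    have "vf L (\<lambda>x. if i + j \<le> n then c i j x else 0) x = 0" for j
      using coefficients_invariant[OF c comm _ x] by (cases "i + j \<le> n") (simp_all add: vf_const)
    then have "vf L (\<lambda>x. (if i + j \<le> n then c i j x else 0) * l ^ j) x = 0" for j
      by (simp add: vf_mult[OF cs smooth_on_const[OF open_S] x] vf_const)
    then show ?thesis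
      unfolding C_def[abs_def]
      by (subst vf_sum[OF open_S _ x]) (auto intro!: smooth_on_mult smooth_on_const open_S cs)
  qed
  define T where "T = S \<inter> C q -` (- {0})"
  have T: "open T" unfolding T_def
    by (rule continuous_open_preimage[OF smooth_on_imp_continuous_on[OF C] open_S]) auto
  have TS: "T \<subseteq> S" and Cq: "\<And>x. x \<in> T \<Longrightarrow> C q x \<noteq> 0" and x0T: "x0 \<in> T"
    using x0 l by (auto simp: T_def C_def)
  interpret t: commuting_frame T L M by (rule commuting_frame_subset[OF T TS])
  define B where "B i j x = (if Suc i < q then (if j = Suc i then 1 else 0) else - (C j x / C q x))" for i j x
  have CT: "smooth_on T (C i)" for i by (rule smooth_on_subset[OF C TS])
  have Cdiv: "smooth_on T (\<lambda>x. C j x / C q x)" for j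
    by (intro smooth_on_divide T CT Cq)
  have B: "smooth_on T (B i j)" for i j
    unfolding B_def[abs_def]
    by (cases "Suc i < q"; cases "j = Suc i") (simp_all add: smooth_on_const T smooth_on_minus Cdiv)
  have LB: "vf L (B i j) x = 0" if x: "x \<in> T" for i j x
  proof (cases "Suc i < q")
    case True
    then have "B i j = (\<lambda>x. if j = Suc i then 1 else 0)" by (auto simp: B_def)
    then show ?thesis by (simp add: vf_const)
  next
    case False
    have xS: "x \<in> S" using x TS by blast
    let ?E = "\<lambda>x. C j x / C q x"
    have "0 = vf L (C j) x" by (simp add: LC[OF xS])
    also have "\<dots> = vf L (\<lambda>x. ?E x * C q x) x"
      by (rule vf_cong[OF T x]) (use Cq in simp)
    also have "\<dots> = vf L ?E x * C q x"
      by (simp only: vf_mult[OF Cdiv CT x] LC[OF xS] mult_zero_right add_0_right)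
    finally have "vf L ?E x = 0" using Cq[OF x] by simp
    then have "vf L (\<lambda>x. - 1 * ?E x) x = 0"
      by (simp only: vf_cmult[OF T Cdiv x] mult_zero_right)
    then show ?thesis using False by (simp add: B_def[abs_def])
  qed
  have sys: "\<exists>r>0. ball x0 r \<subseteq> T \<and> (\<exists>F. \<forall>i<q. smooth_on (ball x0 r) (F i) \<and>
      F i x0 = (if i = 0 then 1 else 0) \<and>
      (\<forall>x\<in>ball x0 r. vf L (F i) x = l * F i x \<and> vf M (F i) x = (\<Sum>j<q. B i j x * F j x)))"
    by (rule t.linear_system_solution[OF x0T B LB])
  obtain r F where r: "r > 0" "ball x0 r \<subseteq> T" and FF: "\<forall>i<q. smooth_on (ball x0 r) (F i) \<and>
      F i x0 = (if i = 0 then 1 else 0) \<and>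
      (\<forall>x\<in>ball x0 r. vf L (F i) x = l * F i x \<and> vf M (F i) x = (\<Sum>j<q. B i j x * F j x))"
    using sys by (elim exE conjE)
  then have F: "\<And>i. i < q \<Longrightarrow> smooth_on (ball x0 r) (F i)"
    and F0: "\<And>i. i < q \<Longrightarrow> F i x0 = (if i = 0 then 1 else 0)"
    and LF: "\<And>i x. i < q \<Longrightarrow> x \<in> ball x0 r \<Longrightarrow> vf L (F i) x = l * F i x"
    and MF: "\<And>i x. i < q \<Longrightarrow> x \<in> ball x0 r \<Longrightarrow> vf M (F i) x = (\<Sum>j<q. B i j x * F j x)"
    by simp_all
  let ?U = "ball x0 r" and ?f = "F 0"
  have US: "?U \<subseteq> S" using r TS by blast
  interpret u: commuting_frame ?U L M by (rule commuting_frame_subset[OF open_ball US])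
  have f: "smooth_on ?U ?f" using F q1 by simp
  have MF': "vf M (F i) x = F (Suc i) x" if "Suc i < q" "x \<in> ?U" for i x
  proof -
    have "(\<Sum>j<q. B i j x * F j x) = (\<Sum>j<q. if j = Suc i then F j x else 0)"
      by (rule sum.cong) (use that in \<open>auto simp: B_def\<close>)
    then show ?thesis using MF[of i x] that by simp
  qed
  have Mpow: "(vf M ^^ i) ?f x = F i x" if "i < q" "x \<in> ?U" for i x
    using that
  proof (induction i arbitrary: x)
    case (Suc i)
    have "vf M ((vf M ^^ i) ?f) x = vf M (F i) x"
      by (rule vf_cong[OF open_ball Suc.prems(2)]) (use Suc in simp)
    then show ?case using MF'[of i x] Suc.prems by simp
  qed simp
  have Lpow: "(vf L ^^ j) ?f x = l ^ j * ?f x" if "x \<in> ?U" for j x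
    using that
  proof (induction j arbitrary: x)
    case (Suc j)
    have "vf L ((vf L ^^ j) ?f) x = vf L (\<lambda>x. l ^ j * ?f x) x"
      by (rule vf_cong[OF open_ball Suc.prems]) (use Suc in simp)
    then show ?case using vf_cmult[OF open_ball f Suc.prems] LF[of 0 x] q1 Suc.prems by simp
  qed simp
  have MpowL: "(vf M ^^ i) (\<lambda>x. a * ?f x) x = a * (vf M ^^ i) ?f x" if "x \<in> ?U" for a i x
    using that
  proof (induction i arbitrary: x)
    case (Suc i)
    have "vf M ((vf M ^^ i) (\<lambda>x. a * ?f x)) x = vf M (\<lambda>x. a * (vf M ^^ i) ?f x) x"
      by (rule vf_cong[OF open_ball Suc.prems]) (use Suc in simp)
    then show ?case using vf_cmult[OF open_ball u.smooth_Mpow[OF f] Suc.prems] by simp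
  qed simp
  have Wf: "W i j ?f x = l ^ j * (vf M ^^ i) ?f x" if "x \<in> ?U" for i j x
  proof -
    have "W i j ?f x = (vf M ^^ i) (\<lambda>x. l ^ j * ?f x) x"
      unfolding W_def vf_pow_word by (rule word_cong[OF open_ball _ that]) (simp add: Lpow flip: vf_pow_word)
    then show ?thesis by (simp add: MpowL[OF that])
  qed
  have "nsum n c ?f x = 0" if x: "x \<in> ?U" for x
  proof -
    have xS: "x \<in> S" and xT: "x \<in> T" using x US r by auto
    let ?h = "\<lambda>i j. (if i + j \<le> n then c i j x else 0) * l ^ j * (vf M ^^ i) ?f x"
    have "nsum n c ?f x = (\<Sum>p\<in>{..n} \<times> {..n}. ?h (fst p) (snd p))"
      by (rule sum.mono_neutral_cong_left) (auto simp: tri_def Wf[OF x])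
    also have "\<dots> = (\<Sum>i\<le>n. \<Sum>j\<le>n. ?h i j)"
      by (simp add: sum.cartesian_product split_beta)
    also have "\<dots> = (\<Sum>i\<le>n. C i x * (vf M ^^ i) ?f x)"
      by (simp add: C_def sum_distrib_right)
    also have "\<dots> = (\<Sum>i<Suc q. C i x * (vf M ^^ i) ?f x)"
    proof (rule sum.mono_neutral_right)
      show "\<forall>i\<in>{..n} - {..<Suc q}. C i x * (vf M ^^ i) ?f x = 0"
      proof
        fix i assume "i \<in> {..n} - {..<Suc q}"
        then have "C i x = 0"
          unfolding C_def by (intro sum.neutral ballI) (use above xS in simp)
        then show "C i x * (vf M ^^ i) ?f x = 0" by simp
      qed
    qed (use x0 in auto)
    also have "\<dots> = (\<Sum>i<q. C i x * F i x) + C q x * (vf M ^^ q) ?f x"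
      using Mpow[OF _ x] by simp
    also have "(vf M ^^ q) ?f x = - (\<Sum>j<q. C j x / C q x * F j x)"
    proof -
      obtain q' where q': "q = Suc q'" using q1 by (cases q) auto
      have "(vf M ^^ q) ?f x = vf M (F q') x"
        unfolding q' funpow.simps comp_apply by (rule vf_cong[OF open_ball x]) (use Mpow q' in simp)
      also have "\<dots> = (\<Sum>j<q. B q' j x * F j x)" by (rule MF[OF _ x]) (simp add: q')
      finally show ?thesis by (simp add: B_def q' sum_negf)
    qed
    also have "C q x * - (\<Sum>j<q. C j x / C q x * F j x) = - (\<Sum>j<q. C j x * F j x)"
      using Cq[OF xT] by (simp add: sum_distrib_left)
    finally show ?thesis by simp
  qed
  moreover have "?f x0 = 1" using F0 q1 by simp
  moreover have "\<exists>k. partial_deriv k ?f x0 \<noteq> 0"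
  proof (rule ccontr)
    assume "\<not> ?thesis"
    then have "vf L ?f x0 = 0" by (simp add: vf_def)
    moreover have "vf L ?f x0 = l" using LF[of 0 x0] q1 r \<open>?f x0 = 1\<close> by simp
    ultimately show False using l by simp
  qed
  ultimately show ?thesis using r US f
    by (intro exI[of _ x0] exI[of _ r] exI[of _ ?f]) auto
qed

end

text \<open>
  As \<open>M\<close> any coordinate field serves that is independent of \<open>X\<close> near \<open>x1\<close>. The operator is put into normal
  form twice, first in this frame and then in the commuting frame.
\<close>

theorem exists_local_solution:
  fixes X :: "2 \<Rightarrow> real^2 \<Rightarrow> complex" and d :: "2 list \<Rightarrow> real^2 \<Rightarrow> complex" and n :: nat
  defines "D \<equiv> \<lambda>u x. \<Sum>is | length is \<le> n. d is x * partial_derivs is u x"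
  assumes S: "open S" and X: "\<And>k. smooth_on S (X k)" and d: "\<And>is. smooth_on S (d is)"
    and comm: "\<And>T u x. open T \<Longrightarrow> T \<subseteq> S \<Longrightarrow> smooth_on T u \<Longrightarrow> x \<in> T \<Longrightarrow> D (vf X u) x = vf X (D u) x"
    and x1: "x1 \<in> S" "X k x1 \<noteq> 0"
    and ngen: "\<And>T c. open T \<Longrightarrow> T \<noteq> {} \<Longrightarrow> T \<subseteq> S \<Longrightarrow> (\<And>i. smooth_on T (c i)) \<Longrightarrow>
       (\<And>u x. smooth_on T u \<Longrightarrow> x \<in> T \<Longrightarrow> D u x = (\<Sum>i\<le>n. c i x * (vf X ^^ i) u x)) \<Longrightarrow> False"
  shows "\<exists>x0 r f. r > 0 \<and> ball x0 r \<subseteq> S \<and> smooth_on (ball x0 r) f \<and> (\<forall>x\<in>ball x0 r. D f x = 0) \<and>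
    f x0 \<noteq> 0 \<and> (\<exists>k. partial_deriv k f x0 \<noteq> 0)"
proof -
  have expand: "\<exists>c. (\<forall>i j. smooth_on T (c i j)) \<and> frame.commutes_up_to T X M n c \<and>
      (\<forall>u x. smooth_on T u \<longrightarrow> x \<in> T \<longrightarrow> D u x = (\<Sum>p\<in>tri n. c (fst p) (snd p) x * frame.W X M (fst p) (snd p) u x)) \<and>
      (T \<noteq> {} \<longrightarrow> (\<exists>i j. \<exists>x\<in>T. 1 \<le> i \<and> i + j \<le> n \<and> c i j x \<noteq> 0))"
    if fr: "frame T X M" and TS: "T \<subseteq> S" for T M
  proof -
    interpret frame T X M by fact
    have "nf n D" unfolding D_def by (rule normal_ordering) (rule smooth_on_subset[OF d TS])
    then obtain c where c: "\<And>i j. smooth_on T (c i j)" "\<And>u x. smooth_on T u \<Longrightarrow> x \<in> T \<Longrightarrow>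
       D u x = nsum n c u x" using nf_coeffs by blast
    have "commutes_up_to n c"
      by (rule commutes_up_to_of_operator[OF c(2) comm[OF open_S TS]])
    moreover have "\<exists>i j. \<exists>x\<in>T. 1 \<le> i \<and> i + j \<le> n \<and> c i j x \<noteq> 0" if "T \<noteq> {}"
    proof (rule ccontr)
      assume no: "\<not> ?thesis"
      show False
      proof (rule ngen[OF open_S that TS c(1)])
        show "D u x = (\<Sum>j\<le>n. c 0 j x * (vf X ^^ j) u x)" if "smooth_on T u" "x \<in> T" for u x
          unfolding c(2)[OF that] by (rule sum_tri_pure) (use no that in blast)
      qed
    qed
    ultimately show ?thesis using c by blast
  qed
  define k' :: 2 where "k' = (if k = 1 then 2 else 1)"
  define M :: "2 \<Rightarrow> real^2 \<Rightarrow> complex" where "M i x = (if i = k' then 1 else 0)" for i x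
  define T where "T = S \<inter> X k -` (- {0})"
  have T: "open T" unfolding T_def
    by (rule continuous_open_preimage[OF smooth_on_imp_continuous_on[OF X] S]) auto
  have TS: "T \<subseteq> S" "T \<noteq> {}" using x1 by (auto simp: T_def)
  have fr: "frame T X M"
  proof
    show "smooth_on T (M i)" for i unfolding M_def[abs_def] by (rule smooth_on_const[OF T])
    show "X 1 x * M 2 x - X 2 x * M 1 x \<noteq> 0" if "x \<in> T" for x
      using that exhaust_2[of k] by (auto simp: T_def M_def k'_def)
  qed (rule T smooth_on_subset[OF X TS(1)])+
  obtain c where c: "\<And>i j. smooth_on T (c i j)" "frame.commutes_up_to T X M n c"
    "\<exists>i j. \<exists>x\<in>T. 1 \<le> i \<and> i + j \<le> n \<and> c i j x \<noteq> 0"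
    using expand[OF fr TS(1)] TS(2) by blast
  obtain T' M' where T': "T' \<subseteq> T" "T' \<noteq> {}" "frame T' X M'" "\<And>x k. x \<in> T' \<Longrightarrow> bracket X M' k x = 0"
    using frame.polynomial_or_commuting_frame[OF fr c(1,2)] c(3) by blast
  then interpret commuting_frame T' X M'
    by (simp add: commuting_frame_def commuting_frame_axioms_def)
  have T'S: "T' \<subseteq> S" using T' TS by blast
  obtain c' where cc: "(\<forall>i j. smooth_on T' (c' i j)) \<and> commutes_up_to n c' \<and>
      (\<forall>u x. smooth_on T' u \<longrightarrow> x \<in> T' \<longrightarrow> D u x = nsum n c' u x) \<and>
      (T' \<noteq> {} \<longrightarrow> (\<exists>i j. \<exists>x\<in>T'. 1 \<le> i \<and> i + j \<le> n \<and> c' i j x \<noteq> 0))"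
    using expand[OF T'(3) T'S] by (rule exE)
  then have c': "\<And>i j. smooth_on T' (c' i j)" "commutes_up_to n c'"
    and D: "\<And>u x. smooth_on T' u \<Longrightarrow> x \<in> T' \<Longrightarrow> D u x = nsum n c' u x"
    and nz: "\<exists>i j. \<exists>x\<in>T'. 1 \<le> i \<and> i + j \<le> n \<and> c' i j x \<noteq> 0"
    using T'(2) by simp_all
  obtain x0 r f where r: "r > 0" "ball x0 r \<subseteq> T'" and f: "smooth_on (ball x0 r) f" "f x0 \<noteq> 0" "\<exists>k. partial_deriv k f x0 \<noteq> 0"
    and sol: "\<And>x. x \<in> ball x0 r \<Longrightarrow> nsum n c' f x = 0"
    using local_solution[OF c' nz] by blast
  have "D f x = 0" if x: "x \<in> ball x0 r" for x
  proof -
    \<comment> \<open>The normal form holds for functions smooth on all of \<open>T'\<close>, so \<open>f\<close> is replaced by such a function with the same germ.\<close>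
    obtain g V where g: "smooth_on UNIV g" and V: "open V" "x \<in> V" "V \<subseteq> ball x0 r" "\<And>y. y \<in> V \<Longrightarrow> g y = f y"
      using local_extension[OF open_ball x f(1)] by blast
    have "D f x = D g x"
      unfolding D_def by (rule sum.cong[OF refl]) (use partial_derivs_cong[OF V(1,4,2)] in simp)
    also have "\<dots> = nsum n c' g x"
      by (rule D) (use x r smooth_on_subset[OF g] in auto)
    also have "\<dots> = nsum n c' f x"
      by (rule sum.cong[OF refl]) (simp only: W_word word_cong[OF V(1,4,2)])
    finally show ?thesis using sol[OF x] by simp
  qed
  moreover have "ball x0 r \<subseteq> S" using r(2) T'S by (rule order_trans)
  ultimately show ?thesis using r(1) f by (intro exI[of _ x0] exI[of _ r] exI[of _ f] conjI ballI)
qed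

section \<open>Smooth inverse functions in the plane\<close>

definition jac :: "(real^2 \<Rightarrow> real^2) \<Rightarrow> 2 \<Rightarrow> 2 \<Rightarrow> real^2 \<Rightarrow> real" where
  "jac f i j x = frechet_derivative f (at x) (axis j 1) $ i"

definition jac_det :: "(real^2 \<Rightarrow> real^2) \<Rightarrow> real^2 \<Rightarrow> real" where
  "jac_det f x = jac f 1 1 x * jac f 2 2 x - jac f 1 2 x * jac f 2 1 x"

lemma smooth_on_jac: "open S \<Longrightarrow> smooth_on S f \<Longrightarrow> smooth_on S (jac f i j)"
  unfolding jac_def[abs_def]
  by (rule smooth_on_bounded_linear[OF _ bounded_linear_vec_nth smooth_on_derivD(2)])

lemma smooth_on_jac_det: "open S \<Longrightarrow> smooth_on S f \<Longrightarrow> smooth_on S (jac_det f)"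
  unfolding jac_det_def[abs_def] by (intro smooth_intros smooth_on_jac)

lemma frechet_derivative_component:
  assumes "smooth_on S f" "x \<in> S" "((\<lambda>y. f y $ i) has_derivative d) (at x)"
  shows "frechet_derivative f (at x) v $ i = d v"
proof -
  have "((\<lambda>y. f y $ i) has_derivative (\<lambda>v. frechet_derivative f (at x) v $ i)) (at x)"
    by (rule bounded_linear.has_derivative[OF bounded_linear_vec_nth smooth_on_derivD(1)[OF assms(1,2)]])
  from has_derivative_unique[OF this assms(3)] show ?thesis by metis
qed

definition cramer :: "(real^2 \<Rightarrow> real^2) \<Rightarrow> real^2 \<Rightarrow> real^2 \<Rightarrow> real^2" where
  "cramer f v x = (\<chi> i. if i = 1 then (jac f 2 2 x * v $ 1 - jac f 1 2 x * v $ 2) / jac_det f x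
      else (jac f 1 1 x * v $ 2 - jac f 2 1 x * v $ 1) / jac_det f x)"

lemma cramer:
  assumes "smooth_on S f" "x \<in> S" "jac_det f x \<noteq> 0"
  shows "frechet_derivative f (at x) (cramer f v x) = v"
proof -
  have "linear (frechet_derivative f (at x))"
    using smooth_on_derivD(1)[OF assms(1,2)] has_derivative_linear by blast
  from linear_axis_expansion[OF this, of "cramer f v x"]
  have *: "frechet_derivative f (at x) (cramer f v x) $ i = cramer f v x $ 1 * jac f i 1 x + cramer f v x $ 2 * jac f i 2 x" for i
    by (simp add: sum_2 jac_def)
  have "(jac f 2 2 x * v $ 1 - jac f 1 2 x * v $ 2) * jac f 1 1 x + (jac f 1 1 x * v $ 2 - jac f 2 1 x * v $ 1) * jac f 1 2 x = v $ 1 * jac_det f x"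
    "(jac f 2 2 x * v $ 1 - jac f 1 2 x * v $ 2) * jac f 2 1 x + (jac f 1 1 x * v $ 2 - jac f 2 1 x * v $ 1) * jac f 2 2 x = v $ 2 * jac_det f x"
    unfolding jac_det_def by algebra+
  then have "frechet_derivative f (at x) (cramer f v x) $ 1 = v $ 1" "frechet_derivative f (at x) (cramer f v x) $ 2 = v $ 2"
    unfolding * using assms(3) by (simp_all add: cramer_def add_divide_distrib[symmetric])
  then show ?thesis by (simp add: vec_eq_iff forall_2)
qed

text \<open>
  The inverse function exists by the inverse function theorem. Its derivative is given by Cramer's
  rule in terms of the inverse function itself, so it is smooth by bootstrapping. A ball as image
  contains the segment between any two of its points, along which derivatives can be integrated.
\<close>

lemma smooth_inverse_function:
  assumes S: "open S" and f: "smooth_on S f" and x0: "x0 \<in> S" "jac_det f x0 \<noteq> 0"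
  shows "\<exists>N e g. open N \<and> x0 \<in> N \<and> N \<subseteq> S \<and> e > 0 \<and> f ` N = ball (f x0) e \<and> homeomorphism N (f ` N) f g \<and>
     smooth_on (f ` N) g \<and> (\<forall>y\<in>f ` N. jac_det f (g y) \<noteq> 0 \<and> (g has_derivative (\<lambda>v. cramer f v (g y))) (at y))"
proof -
  define T where "T = S \<inter> jac_det f -` (- {0})"
  have T: "open T" unfolding T_def
    by (rule continuous_open_preimage[OF smooth_on_imp_continuous_on[OF smooth_on_jac_det[OF S f]] S]) auto
  have TS: "T \<subseteq> S" and nz: "\<And>x. x \<in> T \<Longrightarrow> jac_det f x \<noteq> 0" and x0T: "x0 \<in> T" using x0 by (auto simp: T_def)
  have fT: "smooth_on T f" by (rule smooth_on_subset[OF f TS])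
  let ?D = "\<lambda>x. frechet_derivative f (at x)"
  have bl: "bounded_linear (?D x)" if "x \<in> T" for x
    using smooth_on_derivD(1)[OF fT that] has_derivative_bounded_linear by blast
  define F where "F x = Blinfun (?D x)" for x
  have F: "blinfun_apply (F x) = ?D x" if "x \<in> T" for x
    unfolding F_def by (rule bounded_linear_Blinfun_apply[OF bl[OF that]])
  have contF: "continuous_on T F"
  proof (rule continuous_on_blinfun_componentwise)
    fix i :: "real^2"
    show "continuous_on T (\<lambda>x. blinfun_apply (F x) i)"
      by (rule continuous_on_eq[OF smooth_on_imp_continuous_on[OF smooth_on_derivD(2)[OF fT, of i]]]) (simp add: F)
  qed
  have lin: "linear (?D x)" if "x \<in> T" for x using bl[OF that] by (rule bounded_linear.linear)
  have surj: "surj (?D x)" if "x \<in> T" for x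
    by (rule surjI[where f = "\<lambda>v. cramer f v x"]) (rule cramer[OF fT that nz[OF that]])
  have inj: "inj (?D x)" if "x \<in> T" for x
    by (rule linear_surjective_imp_injective[OF lin[OF that] surj[OF that]]) simp
  obtain h where h: "linear h" "h \<circ> ?D x0 = id"
    using linear_injective_left_inverse[OF lin[OF x0T] inj[OF x0T]] by blast
  have "Blinfun h o\<^sub>L F x0 = id_blinfun"
    by (rule blinfun_eqI)
      (use h in \<open>simp add: F[OF x0T] bounded_linear_Blinfun_apply linear_conv_bounded_linear[symmetric] fun_eq_iff\<close>)
  then obtain U V g g' where U: "open U" "U \<subseteq> T" "x0 \<in> U" "open V" "f x0 \<in> V" "homeomorphism U V f g"
    and g': "\<And>y. y \<in> V \<Longrightarrow> (g has_derivative (g' y)) (at y)"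
      "\<And>y. y \<in> V \<Longrightarrow> g' y = inv (blinfun_apply (F (g y)))"
    using inverse_function_theorem[OF T, of f F x0 "Blinfun h"] F smooth_on_derivD(1)[OF fT] contF x0T
    by (metis (no_types, lifting))
  obtain e where e: "e > 0" "ball (f x0) e \<subseteq> V" using U(4,5) openE by blast
  let ?B = "ball (f x0) e"
  define N where "N = U \<inter> f -` ?B"
  have N: "open N" unfolding N_def
    by (rule continuous_open_preimage[OF _ U(1) open_ball])
      (rule continuous_on_subset[OF smooth_on_imp_continuous_on[OF fT] U(2)])
  have gV: "g y \<in> U" "f (g y) = y" if "y \<in> V" for y
    using U(6) that by (auto simp: homeomorphism_def)
  have gU: "g (f x) = x" if "x \<in> U" for x
    using U(6) that by (auto simp: homeomorphism_def)
  have fN: "f ` N = ?B"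
  proof
    show "?B \<subseteq> f ` N"
    proof
      fix y assume "y \<in> ?B"
      then show "y \<in> f ` N" using gV[of y] e by (intro image_eqI[of _ _ "g y"]) (auto simp: N_def)
    qed
  qed (auto simp: N_def)
  have gB: "g y \<in> N" if "y \<in> ?B" for y using gV[of y] that e by (auto simp: N_def)
  have NT: "N \<subseteq> T" using U(2) by (auto simp: N_def)
  have hom: "homeomorphism N (f ` N) f g"
    by (rule homeomorphism_of_subsets[OF U(6)]) (use fN e in \<open>auto simp: N_def\<close>)
  have der: "(g has_derivative (\<lambda>v. cramer f v (g y))) (at y)" if y: "y \<in> ?B" for y
  proof -
    have gT: "g y \<in> T" using gB[OF y] NT by blast
    have "g' y v = cramer f v (g y)" for v
    proof -
      have "g' y = inv (?D (g y))" using g'(2)[of y] y e F[OF gT] by auto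
      then show ?thesis
        using inv_f_eq[OF inj[OF gT] cramer[OF fT gT nz[OF gT]]] by simp
    qed
    then have "g' y = (\<lambda>v. cramer f v (g y))" by (rule ext)
    then show ?thesis using g'(1)[of y] y e by auto
  qed
  have sc: "smooth_on N (cramer f v)" for v
  proof -
    note nn = nz[OF subsetD[OF NT]]
    have fN: "smooth_on N f" by (rule smooth_on_subset[OF fT NT])
    have 1: "smooth_on N (\<lambda>x. (jac f 2 2 x * v $ 1 - jac f 1 2 x * v $ 2) / jac_det f x)"
      and 2: "smooth_on N (\<lambda>x. (jac f 1 1 x * v $ 2 - jac f 2 1 x * v $ 1) / jac_det f x)"
      by (intro smooth_intros smooth_on_jac smooth_on_jac_det N fN nn; assumption)+
    show ?thesis
      unfolding cramer_def[abs_def]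
    proof (rule smooth_on_vec[OF N])
      show "smooth_on N (\<lambda>x. if i = 1 then (jac f 2 2 x * v $ 1 - jac f 1 2 x * v $ 2) / jac_det f x
        else (jac f 1 1 x * v $ 2 - jac f 2 1 x * v $ 1) / jac_det f x)" for i :: 2
        using 1 2 by (cases "i = 1") simp_all
    qed
  qed
  have "smooth_on ?B g"
  proof (rule smooth_on_SucI[OF open_ball der])
    show "Ck_on k ?B (\<lambda>y. cramer f v (g y))" if "Ck_on k ?B g" for v k
      by (rule Ck_on_compose[OF open_ball N _ that]) (use gB sc in \<open>auto simp: smooth_on_def\<close>)
  qed
  moreover have "\<forall>y\<in>?B. jac_det f (g y) \<noteq> 0 \<and> (g has_derivative (\<lambda>v. cramer f v (g y))) (at y)"
    using der gB NT nz by blast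
  moreover have "x0 \<in> N" "N \<subseteq> S" using U(3) e(1) NT TS by (auto simp: N_def)
  ultimately show ?thesis
    using N fN hom e(1) by (intro exI[of _ N] exI[of _ e] exI[of _ g]) simp
qed

section \<open>Charts in which a given function is separated\<close>

lemma not_constant_on:
  assumes "open N" "x \<in> N" "partial_deriv k f x \<noteq> 0"
  shows "\<not> f constant_on N"
proof
  assume "f constant_on N"
  then obtain c where "\<And>y. y \<in> N \<Longrightarrow> f y = c" by (auto simp: constant_on_def)
  from partial_deriv_cong[OF assms(1,2) this, where i = k] show False using assms(3) by (simp add: partial_deriv_const)
qed

definition pair_map :: "(real^2 \<Rightarrow> real) \<Rightarrow> (real^2 \<Rightarrow> real) \<Rightarrow> real^2 \<Rightarrow> real^2" where
  "pair_map a b x = (\<chi> i. if i = 1 then a x else b x)"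

lemma pair_map_nth [simp]: "pair_map a b x $ 1 = a x" "pair_map a b x $ 2 = b x"
  by (simp_all add: pair_map_def)

lemma smooth_on_pair_map:
  assumes "open S" "smooth_on S a" "smooth_on S b"
  shows "smooth_on S (pair_map a b)"
  unfolding pair_map_def[abs_def]
proof (rule smooth_on_vec[OF assms(1)])
  show "smooth_on S (\<lambda>x. if i = 1 then a x else b x)" for i :: 2
    using assms by (cases "i = 1") simp_all
qed

lemma pair_map_derivative:
  assumes "open S" "smooth_on S a" "smooth_on S b" "x \<in> S"
    and "(a has_derivative a') (at x)" "(b has_derivative b') (at x)"
  shows "frechet_derivative (pair_map a b) (at x) v $ 1 = a' v"
    and "frechet_derivative (pair_map a b) (at x) v $ 2 = b' v"
  using frechet_derivative_component[OF smooth_on_pair_map[OF assms(1-3)] assms(4), of 1 a' v]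
    frechet_derivative_component[OF smooth_on_pair_map[OF assms(1-3)] assms(4), of 2 b' v] assms(5,6) by simp_all

text \<open>
  Let \<open>u\<close> be a local logarithm of \<open>f\<close> up to a constant factor, and \<open>J\<close> the Jacobian of its real and
  imaginary part. If \<open>J\<close> does not vanish identically, these two are coordinates. Otherwise one of them, say \<open>a\<close>,
  has non-zero differential at \<open>x0\<close>, and \<open>a\<close> together with a coordinate function forms
  a chart. Because \<open>J = 0\<close>, the function \<open>u\<close> is constant along the curves on which \<open>a\<close> is constant.
\<close>

lemma separated_chart:
  fixes f :: "real^2 \<Rightarrow> complex" and k :: 2
  assumes T: "open T" and f: "smooth_on T f" and x0: "x0 \<in> T" "f x0 \<noteq> 0" "partial_deriv k f x0 \<noteq> 0"
  shows "\<exists>N (\<Psi> :: real^2 \<Rightarrow> real^2) (\<Phi> :: real^2 \<Rightarrow> real^2) g h. open N \<and> N \<noteq> {} \<and> N \<subseteq> T \<and> open (\<Psi> ` N) \<and> homeomorphism N (\<Psi> ` N) \<Psi> \<Phi> \<and>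
    smooth_on N \<Psi> \<and> smooth_on (\<Psi> ` N) \<Phi> \<and> smooth_on N g \<and> smooth_on N h \<and> (\<forall>x\<in>N. f x = g x * h x) \<and>
    (\<forall>x\<in>N. \<forall>y\<in>N. \<Psi> x $ 2 = \<Psi> y $ 2 \<longrightarrow> g x = g y) \<and> (\<forall>x\<in>N. \<forall>y\<in>N. \<Psi> x $ 1 = \<Psi> y $ 1 \<longrightarrow> h x = h y) \<and>
    \<not> f constant_on N"
proof -
  define v where "v x = inverse (f x0) * f x" for x
  have v: "smooth_on T v" unfolding v_def[abs_def] by (intro smooth_intros T f)
  define S where "S = T \<inter> v -` (- \<real>\<^sub>\<le>\<^sub>0)"
  have S: "open S" unfolding S_def
    by (rule continuous_open_preimage[OF smooth_on_imp_continuous_on[OF v] T]) (simp add: open_Compl)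
  have ST: "S \<subseteq> T" and vS: "\<And>x. x \<in> S \<Longrightarrow> v x \<notin> \<real>\<^sub>\<le>\<^sub>0" and x0S: "x0 \<in> S" using x0 by (auto simp: S_def v_def)
  have sv: "smooth_on S v" by (rule smooth_on_subset[OF v ST])
  define u where "u x = Ln (v x)" for x
  have u: "smooth_on S u" unfolding u_def[abs_def] by (intro smooth_on_Ln S sv vS)
  have fu: "f x = f x0 * exp (u x)" if "x \<in> S" for x
  proof -
    have "v x \<noteq> 0" using vS[OF that] by auto
    then have "exp (u x) = v x" by (simp add: u_def)
    then show ?thesis using x0(2) by (simp add: v_def)
  qed
  have pf: "partial_deriv j f x = f x * partial_deriv j u x" if x: "x \<in> S" for j x
  proof -
    have "partial_deriv j f x = partial_deriv j (\<lambda>x. f x0 * exp (u x)) x"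
      by (rule partial_deriv_cong[OF S x fu])
    also have "\<dots> = f x0 * (exp (u x) * partial_deriv j u x)"
      using partial_deriv_mult[OF smooth_on_const[OF S] smooth_on_exp[OF S u] x] partial_deriv_exp[OF u x]
      by (simp add: partial_deriv_const)
    finally show ?thesis using fu[OF x] by simp
  qed
  have fnz: "f x \<noteq> 0" if "x \<in> S" for x using fu[OF that] x0 by simp
  let ?p = "\<lambda>j x. partial_deriv j u x"
  have du: "(u has_derivative (\<lambda>w. (w $ 1) *\<^sub>R ?p 1 x + (w $ 2) *\<^sub>R ?p 2 x)) (at x)" if "x \<in> S" for x
    using has_derivative_partial_deriv[OF u that] by (simp add: sum_2)
  define J where "J x = Re (?p 1 x) * Im (?p 2 x) - Re (?p 2 x) * Im (?p 1 x)" for x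
  have reu: "smooth_on S (\<lambda>x. Re (u x))" and imu: "smooth_on S (\<lambda>x. Im (u x))"
    by (rule smooth_on_bounded_linear[OF S _ u], simp add: bounded_linear_Re bounded_linear_Im)+
  have dre: "((\<lambda>x. Re (u x)) has_derivative (\<lambda>w. w $ 1 * Re (?p 1 x) + w $ 2 * Re (?p 2 x))) (at x)"
    and dim: "((\<lambda>x. Im (u x)) has_derivative (\<lambda>w. w $ 1 * Im (?p 1 x) + w $ 2 * Im (?p 2 x))) (at x)"
    if "x \<in> S" for x
    using bounded_linear.has_derivative[OF bounded_linear_Re du[OF that]]
      bounded_linear.has_derivative[OF bounded_linear_Im du[OF that]] by simp_all
  show ?thesis
  proof (cases "\<exists>x1\<in>S. J x1 \<noteq> 0")
    case True
    then obtain x1 where x1: "x1 \<in> S" "J x1 \<noteq> 0" by blast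
    let ?\<Psi> = "pair_map (\<lambda>x. Re (u x)) (\<lambda>x. Im (u x))"
    have \<Psi>: "smooth_on S ?\<Psi>" by (rule smooth_on_pair_map[OF S reu imu])
    have "jac_det ?\<Psi> x1 = J x1"
      unfolding jac_det_def jac_def J_def pair_map_derivative[OF S reu imu x1(1) dre[OF x1(1)] dim[OF x1(1)]]
      by (simp add: axis_def)
    then obtain N e \<Phi> where N: "open N" "x1 \<in> N" "N \<subseteq> S" "?\<Psi> ` N = ball (?\<Psi> x1) e"
      "homeomorphism N (?\<Psi> ` N) ?\<Psi> \<Phi>" "smooth_on (?\<Psi> ` N) \<Phi>"
      using smooth_inverse_function[OF S \<Psi> x1(1)] x1(2) by metis
    define g where "g x = exp (\<i> * of_real (Im (u x)))" for x
    define h where "h x = f x0 * exp (of_real (Re (u x)))" for x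
    have "smooth_on N g" "smooth_on N h"
      unfolding g_def[abs_def] h_def[abs_def]
      by (intro smooth_intros N(1) smooth_on_bounded_linear[OF _ bounded_linear_of_real]
          smooth_on_subset[OF reu N(3)] smooth_on_subset[OF imu N(3)])+
    moreover have "f x = g x * h x" if "x \<in> N" for x
    proof -
      have "exp (u x) = exp (of_real (Re (u x))) * exp (\<i> * of_real (Im (u x)))"
        by (subst complex_eq[of "u x"]) (simp add: exp_add)
      then show ?thesis using fu[of x] that N(3) by (auto simp: g_def h_def)
    qed
    moreover have "\<not> f constant_on N"
    proof -
      have "?p 1 x1 \<noteq> 0 \<or> ?p 2 x1 \<noteq> 0" using x1(2) by (auto simp: J_def)
      then obtain j where "?p j x1 \<noteq> 0" by blast
      then show ?thesis using not_constant_on[OF N(1,2), of j f] pf[OF x1(1), of j] fnz[OF x1(1)] by simp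
    qed
    moreover have "open (?\<Psi> ` N)" using N(4) by simp
    moreover have "smooth_on N ?\<Psi>" by (rule smooth_on_subset[OF \<Psi> N(3)])
    ultimately show ?thesis using N ST
      by (intro exI[of _ N] exI[of _ ?\<Psi>] exI[of _ \<Phi>] exI[of _ g] exI[of _ h]) (auto simp: g_def h_def)
  next
    case False
    have pk: "?p k x0 \<noteq> 0" using pf[OF x0S, of k] x0(3) by auto
    \<comment> \<open>With the coordinate other than \<open>k\<close> as second component, the Jacobian is the partial derivative of \<open>a\<close> up to sign.\<close>
    define k' :: 2 where "k' = (if k = 1 then 2 else 1)"
    obtain \<rho> where \<rho>: "\<rho> = Re \<or> \<rho> = Im" "\<rho> (?p k x0) \<noteq> 0" using pk complex_eq_iff[of "?p k x0" 0] by auto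
    let ?a = "\<lambda>x. \<rho> (u x)" and ?b = "\<lambda>x :: real^2. x $ k'"
    have a: "smooth_on S ?a" using \<rho>(1) reu imu by auto
    have b: "smooth_on S ?b" by (rule smooth_on_linear[OF S bounded_linear_vec_nth])
    have da: "(?a has_derivative (\<lambda>w. w $ 1 * \<rho> (?p 1 x) + w $ 2 * \<rho> (?p 2 x))) (at x)" if "x \<in> S" for x
      using \<rho>(1) dre[OF that] dim[OF that] by auto
    have db: "(?b has_derivative (\<lambda>w. w $ k')) (at x)" for x
      by (rule bounded_linear_imp_has_derivative[OF bounded_linear_vec_nth])
    let ?\<Psi> = "pair_map ?a ?b"
    have \<Psi>: "smooth_on S ?\<Psi>" by (rule smooth_on_pair_map[OF S a b])
    note d\<Psi> = pair_map_derivative[OF S a b _ da db]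
    have jd: "jac_det ?\<Psi> x = (if k = 1 then 1 else -1) * \<rho> (?p k x)" if "x \<in> S" for x
      unfolding jac_det_def jac_def d\<Psi>[OF that that] using exhaust_2[of k] by (auto simp: axis_def k'_def)
    have "jac_det ?\<Psi> x0 \<noteq> 0" using jd[OF x0S] \<rho>(2) by simp
    then obtain N e \<Phi> where N: "open N" "x0 \<in> N" "N \<subseteq> S" "?\<Psi> ` N = ball (?\<Psi> x0) e"
      "homeomorphism N (?\<Psi> ` N) ?\<Psi> \<Phi>" "smooth_on (?\<Psi> ` N) \<Phi>"
      "\<forall>y\<in>?\<Psi> ` N. jac_det ?\<Psi> (\<Phi> y) \<noteq> 0 \<and> (\<Phi> has_derivative (\<lambda>v. cramer ?\<Psi> v (\<Phi> y))) (at y)"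
      using smooth_inverse_function[OF S \<Psi> x0S] by metis
    have \<Phi>N: "\<Phi> y \<in> N" if "y \<in> ?\<Psi> ` N" for y using N(5) that by (auto simp: homeomorphism_def)
    have \<Phi>\<Psi>: "\<Phi> (?\<Psi> x) = x" if "x \<in> N" for x using N(5) that by (auto simp: homeomorphism_def)
    have dir: "((\<lambda>y. u (\<Phi> y)) has_derivative (\<lambda>w. (cramer ?\<Psi> w (\<Phi> y) $ 1) *\<^sub>R ?p 1 (\<Phi> y) + (cramer ?\<Psi> w (\<Phi> y) $ 2) *\<^sub>R ?p 2 (\<Phi> y))) (at y)"
      and zero: "w $ 1 = 0 \<Longrightarrow> (cramer ?\<Psi> w (\<Phi> y) $ 1) *\<^sub>R ?p 1 (\<Phi> y) + (cramer ?\<Psi> w (\<Phi> y) $ 2) *\<^sub>R ?p 2 (\<Phi> y) = 0"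
      if y: "y \<in> ?\<Psi> ` N" for y w
    proof -
      let ?x = "\<Phi> y" and ?c = "cramer ?\<Psi> w (\<Phi> y)"
      have x: "?x \<in> S" using \<Phi>N[OF y] N(3) by blast
      have nz: "jac_det ?\<Psi> ?x \<noteq> 0" and d\<Phi>: "(\<Phi> has_derivative (\<lambda>v. cramer ?\<Psi> v ?x)) (at y)" using N(7) y by auto
      show "((\<lambda>y. u (\<Phi> y)) has_derivative (\<lambda>w. (cramer ?\<Psi> w (\<Phi> y) $ 1) *\<^sub>R ?p 1 (\<Phi> y) + (cramer ?\<Psi> w (\<Phi> y) $ 2) *\<^sub>R ?p 2 (\<Phi> y))) (at y)"
        by (rule has_derivative_compose[OF d\<Phi> du[OF x]])
      assume w: "w $ 1 = 0"
      have e: "?c $ 1 * \<rho> (?p 1 ?x) + ?c $ 2 * \<rho> (?p 2 ?x) = 0"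
        using d\<Psi>(1)[OF x x, of ?c] cramer[OF \<Psi> x nz, of w] w by simp
      have J0: "Re (?p 1 ?x) * Im (?p 2 ?x) = Re (?p 2 ?x) * Im (?p 1 ?x)" using False x by (auto simp: J_def)
      have \<rho>k: "\<rho> (?p k ?x) \<noteq> 0" using nz jd[OF x] by auto
      have lin: "r1 * c1 + r2 * c2 = (0::real)" if "s1 * c1 + s2 * c2 = 0" "s1 * r2 = s2 * r1" "s1 \<noteq> 0 \<or> s2 \<noteq> 0" for r1 r2 s1 s2 c1 c2
      proof -
        have "s1 * (r1 * c1 + r2 * c2) = 0" "s2 * (r1 * c1 + r2 * c2) = 0"
          using that(1,2) by algebra+
        then show ?thesis using that(3) by auto
      qed
      have \<rho>12: "\<rho> (?p 1 ?x) \<noteq> 0 \<or> \<rho> (?p 2 ?x) \<noteq> 0" using \<rho>k exhaust_2[of k] by auto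
      have "?c $ 1 * Re (?p 1 ?x) + ?c $ 2 * Re (?p 2 ?x) = 0 \<and> ?c $ 1 * Im (?p 1 ?x) + ?c $ 2 * Im (?p 2 ?x) = 0"
        using \<rho>(1)
      proof
        assume \<rho>: "\<rho> = Re"
        show ?thesis
          using lin[of "Re (?p 1 ?x)" "?c $ 1" "Re (?p 2 ?x)" "?c $ 2" "Im (?p 2 ?x)" "Im (?p 1 ?x)"] e \<rho>12 J0
          unfolding \<rho> by (simp add: mult.commute)
      next
        assume \<rho>: "\<rho> = Im"
        show ?thesis
          using lin[of "Im (?p 1 ?x)" "?c $ 1" "Im (?p 2 ?x)" "?c $ 2" "Re (?p 2 ?x)" "Re (?p 1 ?x)"] e \<rho>12 J0
          unfolding \<rho> by (simp add: mult.commute)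
      qed
      then show "(?c $ 1) *\<^sub>R ?p 1 ?x + (?c $ 2) *\<^sub>R ?p 2 ?x = 0" by (simp add: complex_eq_iff)
    qed
    have const: "u (\<Phi> y) = u (\<Phi> z)" if y: "y \<in> ?\<Psi> ` N" and z: "z \<in> ?\<Psi> ` N" and yz: "y $ 1 = z $ 1" for y z
    proof -
      have seg: "y + t *\<^sub>R (z - y) \<in> ?\<Psi> ` N" if "t \<in> {0..1}" for t
      proof -
        have "(1 - t) *\<^sub>R y + t *\<^sub>R z \<in> ball (?\<Psi> x0) e"
          using convexD[OF convex_ball, of y "?\<Psi> x0" e z "1 - t" t] y z that N(4) by auto
        then show ?thesis unfolding N(4) by (simp add: algebra_simps)
      qed
      have dz: "((\<lambda>t. u (\<Phi> (y + t *\<^sub>R (z - y)))) has_vector_derivative 0) (at t within {0..1})" if t: "t \<in> {0..1}" for t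
        using has_vector_derivative_along_line[OF dir[OF seg[OF t]], of "{0..1}"] zero[OF seg[OF t], of "z - y"] yz by simp
      obtain c where "\<And>t. t \<in> {0..1} \<Longrightarrow> u (\<Phi> (y + t *\<^sub>R (z - y))) = c"
        by (rule has_vector_derivative_zero_constant[OF _ dz]) auto
      from this[of 0] this[of 1] show ?thesis by simp
    qed
    have fc: "f x = f y" if "x \<in> N" "y \<in> N" "?\<Psi> x $ 1 = ?\<Psi> y $ 1" for x y
    proof -
      have "u x = u y" using const[OF imageI[OF that(1)] imageI[OF that(2)] that(3)] that by (simp add: \<Phi>\<Psi>)
      then show ?thesis using fu[OF subsetD[OF N(3) that(1)]] fu[OF subsetD[OF N(3) that(2)]] by simp
    qed
    have "\<forall>x\<in>N. \<forall>y\<in>N. ?\<Psi> x $ 1 = ?\<Psi> y $ 1 \<longrightarrow> f x = f y" using fc by blast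
    have "N \<noteq> {}" "N \<subseteq> T" using N(2,3) ST by auto
    have "smooth_on N (\<lambda>_. 1 :: complex)" by (rule smooth_on_const[OF N(1)])
    have "\<not> f constant_on N" by (rule not_constant_on[OF N(1,2) x0(3)])
    have "open (?\<Psi> ` N)" using N(4) by simp
    have "smooth_on N ?\<Psi>" by (rule smooth_on_subset[OF \<Psi> N(3)])
    have "smooth_on N f" by (rule smooth_on_subset[OF f]) (use N(3) ST in blast)
    have "\<forall>x\<in>N. f x = 1 * f x"
      "\<forall>x\<in>N. \<forall>y\<in>N. ?\<Psi> x $ 2 = ?\<Psi> y $ 2 \<longrightarrow> 1 = (1 :: complex)" by simp_all
    show ?thesis
      by (rule exI[of _ N], rule exI[of _ ?\<Psi>], rule exI[of _ \<Phi>], rule exI[of _ "\<lambda>_. 1"], rule exI[of _ f],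
          intro conjI) (fact N(1) N(5) N(6) | fact)+
  qed
qed

section \<open>Charts of a manifold\<close>

context
  fixes A :: "('a::{t2_space,second_countable_topology}, 'n::finite) chart set"
  assumes atlas: "smooth_atlas A"
begin

lemma atlas_subset_charts: "A \<subseteq> charts_of A"
  using atlas by (auto simp: smooth_atlas_def charts_of_def)

lemma chart_is_chart: "c \<in> charts_of A \<Longrightarrow> is_chart c"
  by (simp add: charts_of_def)

lemma exists_chart: "\<exists>V \<psi>. (V, \<psi>) \<in> A \<and> (V, \<psi>) \<in> charts_of A \<and> m \<in> V"
proof -
  have "m \<in> (\<Union>c\<in>A. fst c)" using atlas by (simp add: smooth_atlas_def)
  then show ?thesis using atlas_subset_charts by fastforce
qed

end

lemma chart_homeomorphism:
  assumes "is_chart (U, \<phi>)"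
  shows "open U" "open (\<phi> ` U)" "homeomorphism U (\<phi> ` U) \<phi> (inv_into U \<phi>)" "inj_on \<phi> U"
proof -
  obtain \<phi>' where U: "open U" "open (\<phi> ` U)" and h: "homeomorphism U (\<phi> ` U) \<phi> \<phi>'"
    using assms by (auto simp: is_chart_def)
  show inj: "inj_on \<phi> U" using h by (metis homeomorphism_apply1 inj_onI)
  show "open U" "open (\<phi> ` U)" by (fact U)+
  have "\<phi>' y = inv_into U \<phi> y" if "y \<in> \<phi> ` U" for y
    using that h inj by (auto simp: homeomorphism_def)
  then show "homeomorphism U (\<phi> ` U) \<phi> (inv_into U \<phi>)"
    using homeomorphism_cong[OF h, of U "\<phi> ` U" \<phi> "inv_into U \<phi>"] by simp
qed

lemma chart_inverse:
  assumes "is_chart (U, \<phi>)"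
  shows "m \<in> U \<Longrightarrow> inv_into U \<phi> (\<phi> m) = m"
    and "z \<in> \<phi> ` U \<Longrightarrow> inv_into U \<phi> z \<in> U"
    and "z \<in> \<phi> ` U \<Longrightarrow> \<phi> (inv_into U \<phi> z) = z"
  using chart_homeomorphism(4)[OF assms] by (simp_all add: inv_into_into f_inv_into_f)

lemma chart_open_image:
  assumes "is_chart (U, \<phi>)" "open N" "N \<subseteq> U"
  shows "open (\<phi> ` N)"
  using homeomorphism_imp_open_map[OF chart_homeomorphism(3)[OF assms(1)], of N]
    chart_homeomorphism(1,2)[OF assms(1)] assms(2,3) by (simp add: openin_open_eq)

lemma chart_open_preimage:
  assumes "is_chart (U, \<phi>)" "open T" "T \<subseteq> \<phi> ` U"
  shows "open (inv_into U \<phi> ` T)"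
  using homeomorphism_imp_open_map[OF homeomorphism_symD[OF chart_homeomorphism(3)[OF assms(1)]], of T]
    chart_homeomorphism(1,2)[OF assms(1)] assms(2,3) by (simp add: openin_open_eq)

lemma chart_image_preimage:
  assumes "is_chart (U, \<phi>)" "T \<subseteq> \<phi> ` U"
  shows "\<phi> ` (inv_into U \<phi> ` T) = T" "inv_into U \<phi> ` T \<subseteq> U"
  using chart_inverse[OF assms(1)] assms(2) by (force simp: image_image)+

context
  fixes A :: "('a::{t2_space,second_countable_topology}, 'n::finite) chart set"
  assumes atlas: "smooth_atlas A"
begin

lemma transition_smooth:
  assumes c: "(U, \<phi>) \<in> charts_of A" and d: "(V, \<psi>) \<in> charts_of A"
  shows "smooth_on (\<phi> ` (U \<inter> V)) (\<psi> \<circ> inv_into U \<phi>)"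
proof (rule smooth_on_local)
  note cc = chart_is_chart[OF atlas c] and dd = chart_is_chart[OF atlas d]
  fix z assume "z \<in> \<phi> ` (U \<inter> V)"
  then obtain m where m: "m \<in> U" "m \<in> V" "z = \<phi> m" by blast
  obtain W \<theta> where W: "(W, \<theta>) \<in> A" "m \<in> W" using exists_chart[OF atlas] by blast
  have Wc: "is_chart (W, \<theta>)" using atlas W by (auto simp: smooth_atlas_def)
  let ?N = "U \<inter> V \<inter> W"
  have oN: "open ?N" using chart_homeomorphism(1) cc dd Wc by blast
  have o: "open (\<phi> ` ?N)" "open (\<theta> ` ?N)" using chart_open_image[OF cc oN] chart_open_image[OF Wc oN] by auto
  have "compatible (U, \<phi>) (W, \<theta>)" "compatible (V, \<psi>) (W, \<theta>)" using c d W by (auto simp: charts_of_def)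
  then have s: "smooth_on (\<phi> ` (U \<inter> W)) (\<theta> \<circ> inv_into U \<phi>)" "smooth_on (\<theta> ` (V \<inter> W)) (\<psi> \<circ> inv_into W \<theta>)"
    by (auto simp: compatible_def)
  have "smooth_on (\<phi> ` ?N) (\<lambda>z. (\<psi> \<circ> inv_into W \<theta>) ((\<theta> \<circ> inv_into U \<phi>) z))"
    by (rule smooth_on_compose[OF o _ smooth_on_subset[OF s(1)] smooth_on_subset[OF s(2)]])
      (use chart_inverse[OF cc] in auto)
  then have "smooth_on (\<phi> ` ?N) (\<psi> \<circ> inv_into U \<phi>)"
    by (rule smooth_on_cong[OF o(1), THEN iffD1, rotated]) (use chart_inverse[OF cc] chart_inverse[OF Wc] in auto)
  then show "\<exists>W. open W \<and> z \<in> W \<and> smooth_on W (\<psi> \<circ> inv_into U \<phi>)"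
    using o(1) m W(2) by (intro exI[of _ "\<phi> ` ?N"]) auto
qed

text \<open>
  By composition with the transition map; hence smoothness may be checked in any one chart around each
  point.
\<close>

lemma smooth_transfer:
  assumes c: "(V, \<psi>) \<in> charts_of A" and d: "(W, \<theta>) \<in> charts_of A" and N: "open N" "N \<subseteq> V \<inter> W"
    and f: "smooth_on (\<psi> ` N) (f \<circ> inv_into V \<psi>)"
  shows "smooth_on (\<theta> ` N) (f \<circ> inv_into W \<theta>)"
proof -
  note cc = chart_is_chart[OF atlas c] and dd = chart_is_chart[OF atlas d]
  have NV: "m \<in> V" "m \<in> W" if "m \<in> N" for m using N(2) that by auto
  have o: "open (\<theta> ` N)" "open (\<psi> ` N)" using chart_open_image[OF cc N(1)] chart_open_image[OF dd N(1)] N(2) by auto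
  have t: "smooth_on (\<theta> ` N) (\<psi> \<circ> inv_into W \<theta>)"
    by (rule smooth_on_subset[OF transition_smooth[OF d c]]) (use N in auto)
  have "smooth_on (\<theta> ` N) (\<lambda>z. (f \<circ> inv_into V \<psi>) ((\<psi> \<circ> inv_into W \<theta>) z))"
    by (rule smooth_on_compose[OF o _ t f]) (use chart_inverse[OF dd] N(2) in auto)
  then show ?thesis
    by (rule smooth_on_cong[OF o(1), THEN iffD1, rotated])
      (use NV in \<open>auto simp: chart_inverse(1)[OF cc] chart_inverse(1)[OF dd]\<close>)
qed

lemma C_inf_chart:
  assumes f: "f \<in> C_inf A U" and U: "open U" and c: "(V, \<psi>) \<in> charts_of A"
  shows "smooth_on (\<psi> ` (U \<inter> V)) (f \<circ> inv_into V \<psi>)"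
proof (rule smooth_on_local)
  note cc = chart_is_chart[OF atlas c]
  fix z assume "z \<in> \<psi> ` (U \<inter> V)"
  then obtain m where m: "m \<in> U" "m \<in> V" "z = \<psi> m" by blast
  obtain W \<theta> where W: "(W, \<theta>) \<in> A" "m \<in> W" and Wc: "(W, \<theta>) \<in> charts_of A"
      using exists_chart[OF atlas] by blast
  let ?N = "U \<inter> V \<inter> W"
  have oN: "open ?N" using U chart_homeomorphism(1) cc chart_is_chart[OF atlas Wc] by blast
  have "smooth_on (\<theta> ` (U \<inter> W)) (f \<circ> inv_into W \<theta>)" using f W by (auto simp: C_inf_def)
  then have "smooth_on (\<theta> ` ?N) (f \<circ> inv_into W \<theta>)" by (rule smooth_on_subset) auto
  then have "smooth_on (\<psi> ` ?N) (f \<circ> inv_into V \<psi>)"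
    by (rule smooth_transfer[OF Wc c oN, rotated]) auto
  moreover have "open (\<psi> ` ?N)" by (rule chart_open_image[OF cc oN]) auto
  ultimately show "\<exists>W. open W \<and> z \<in> W \<and> smooth_on W (f \<circ> inv_into V \<psi>)"
    using m W by (intro exI[of _ "\<psi> ` ?N"]) auto
qed

lemma C_inf_local:
  assumes U: "open U" and loc: "\<And>m. m \<in> U \<Longrightarrow> \<exists>V \<psi> N. (V, \<psi>) \<in> charts_of A \<and> open N \<and> m \<in> N \<and> N \<subseteq> V \<and>
     smooth_on (\<psi> ` N) (f \<circ> inv_into V \<psi>)"
  shows "f \<in> C_inf A U"
  unfolding C_inf_def
proof (clarify)
  fix W \<theta> assume "(W, \<theta>) \<in> A"
  then have W: "(W, \<theta>) \<in> charts_of A" using atlas_subset_charts[OF atlas] by blast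
  note ww = chart_is_chart[OF atlas W]
  show "smooth_on (\<theta> ` (U \<inter> W)) (f \<circ> inv_into W \<theta>)"
  proof (rule smooth_on_local)
    fix z assume "z \<in> \<theta> ` (U \<inter> W)"
    then obtain m where m: "m \<in> U" "m \<in> W" "z = \<theta> m" by blast
    obtain V \<psi> N where V: "(V, \<psi>) \<in> charts_of A" "open N" "m \<in> N" "N \<subseteq> V" "smooth_on (\<psi> ` N) (f \<circ> inv_into V \<psi>)"
      using loc[OF m(1)] by blast
    have oN: "open (N \<inter> W)" using V(2) chart_homeomorphism(1)[OF ww] by blast
    have "smooth_on (\<theta> ` (N \<inter> W)) (f \<circ> inv_into W \<theta>)"
      by (rule smooth_transfer[OF V(1) W oN _ smooth_on_subset[OF V(5)]]) (use V in auto)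
    moreover have "open (\<theta> ` (N \<inter> W))" by (rule chart_open_image[OF ww oN]) auto
    ultimately show "\<exists>T. open T \<and> z \<in> T \<and> smooth_on T (f \<circ> inv_into W \<theta>)"
      using m V by (intro exI[of _ "\<theta> ` (N \<inter> W)"]) auto
  qed
qed

lemma C_inf_const: "(\<lambda>_. c) \<in> C_inf A UNIV"
proof (rule C_inf_local)
  fix m :: 'a
  obtain W \<theta> where W: "(W, \<theta>) \<in> A" "m \<in> W" and Wc: "(W, \<theta>) \<in> charts_of A"
      using exists_chart[OF atlas] by blast
  note h = chart_homeomorphism[OF chart_is_chart[OF atlas Wc]]
  have "smooth_on (\<theta> ` W) ((\<lambda>_. c) \<circ> inv_into W \<theta>)" using h by (simp add: comp_def smooth_on_const)
  then show "\<exists>V \<psi> N. (V, \<psi>) \<in> charts_of A \<and> open N \<and> m \<in> N \<and> N \<subseteq> V \<and> smooth_on (\<psi> ` N) ((\<lambda>_. c) \<circ> inv_into V \<psi>)"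
    using Wc W h by blast
qed simp

lemma C_inf_pullback:
  assumes c: "(U, \<phi>) \<in> charts_of A" and N: "open N" "N \<subseteq> \<phi> ` U" and u: "smooth_on N u"
    and f: "\<And>z. z \<in> N \<Longrightarrow> f (inv_into U \<phi> z) = u z"
  shows "f \<in> C_inf A (inv_into U \<phi> ` N)"
proof (rule C_inf_local)
  note cc = chart_is_chart[OF atlas c]
  show o: "open (inv_into U \<phi> ` N)" by (rule chart_open_preimage[OF cc N])
  have "smooth_on N (f \<circ> inv_into U \<phi>)" using smooth_on_cong[OF N(1), of "f \<circ> inv_into U \<phi>" u] f u by simp
  then show "\<exists>V \<psi> N'. (V, \<psi>) \<in> charts_of A \<and> open N' \<and> m \<in> N' \<and> N' \<subseteq> V \<and> smooth_on (\<psi> ` N') (f \<circ> inv_into V \<psi>)"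
    if "m \<in> inv_into U \<phi> ` N" for m
    using c o that chart_image_preimage[OF cc N(2)] by (intro exI[of _ U] exI[of _ \<phi>] exI[of _ "inv_into U \<phi> ` N"]) simp
qed

text \<open>
  Multiply by a bump function and extend by zero. The extension vanishes outside the preimage of a
  closed ball, and this preimage is compact, hence closed in the Hausdorff space.
\<close>

lemma global_extension:
  assumes c: "(U, \<phi>) \<in> charts_of A" and T: "open T" "T \<subseteq> \<phi> ` U" and u: "smooth_on T u" and y: "y \<in> T"
  shows "\<exists>g V. g \<in> C_inf A UNIV \<and> open V \<and> y \<in> V \<and> V \<subseteq> T \<and> (\<forall>z\<in>V. g (inv_into U \<phi> z) = u z)"
proof -
  note cc = chart_is_chart[OF atlas c]
  note h = chart_homeomorphism[OF cc] and inv = chart_inverse[OF cc]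
  obtain r where r: "r > 0" "cball y r \<subseteq> T" using open_contains_cball T(1) y by blast
  obtain b :: "real^'n \<Rightarrow> real" where b: "smooth_on UNIV b" "\<And>x. x \<in> ball y (r / 2) \<Longrightarrow> b x = 1" "\<And>x. x \<notin> ball y r \<Longrightarrow> b x = 0"
    using exists_bump[OF r(1), of y] by blast
  define g where "g m = (if m \<in> U \<and> \<phi> m \<in> T then b (\<phi> m) *\<^sub>R u (\<phi> m) else 0)" for m
  let ?K = "inv_into U \<phi> ` cball y r"
  have "compact ?K"
    by (rule compact_continuous_image[OF continuous_on_subset[OF homeomorphism_cont2[OF h(3)]]])
      (use r(2) T(2) in auto)
  then have K: "open (- ?K)" by (simp add: compact_imp_closed open_Compl)
  have gK: "g m = 0" if "m \<in> - ?K" for m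
  proof (cases "m \<in> U \<and> \<phi> m \<in> T")
    case True
    then have "\<phi> m \<notin> cball y r" using that inv(1)[of m] by (metis ComplD image_eqI)
    then show ?thesis using b(3)[of "\<phi> m"] by (simp add: g_def)
  qed (auto simp: g_def)
  have "g \<in> C_inf A UNIV"
  proof (rule C_inf_local)
    fix m :: 'a
    show "\<exists>V \<psi> N. (V, \<psi>) \<in> charts_of A \<and> open N \<and> m \<in> N \<and> N \<subseteq> V \<and> smooth_on (\<psi> ` N) (g \<circ> inv_into V \<psi>)"
    proof (cases "m \<in> inv_into U \<phi> ` T")
      case True
      have "smooth_on T (\<lambda>z. b z *\<^sub>R u z)" by (intro smooth_on_scaleR T(1) u smooth_on_subset[OF b(1)]) simp
      then have "smooth_on T (g \<circ> inv_into U \<phi>)"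
        by (rule smooth_on_cong[OF T(1), THEN iffD1, rotated]) (use inv T(2) in \<open>auto simp: g_def subset_iff\<close>)
      then show ?thesis
        using c True chart_open_preimage[OF cc T] chart_image_preimage[OF cc T(2)]
        by (intro exI[of _ U] exI[of _ \<phi>] exI[of _ "inv_into U \<phi> ` T"]) simp
    next
      case False
      obtain W \<theta> where W: "(W, \<theta>) \<in> A" "m \<in> W" and Wc: "(W, \<theta>) \<in> charts_of A"
      using exists_chart[OF atlas] by blast
      note ww = chart_is_chart[OF atlas Wc]
      have N: "open (W \<inter> - ?K)" using K chart_homeomorphism(1)[OF ww] by blast
      have o: "open (\<theta> ` (W \<inter> - ?K))" by (rule chart_open_image[OF ww N]) auto
      have "smooth_on (\<theta> ` (W \<inter> - ?K)) (g \<circ> inv_into W \<theta>)"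
        by (rule smooth_on_cong[OF o, THEN iffD1, OF _ smooth_on_const[OF o, of 0]])
          (use gK chart_inverse[OF ww] in auto)
      moreover have "m \<in> W \<inter> - ?K" using False W r(2) by blast
      ultimately show ?thesis using Wc N by blast
    qed
  qed simp
  moreover have "g (inv_into U \<phi> z) = u z" if "z \<in> ball y (r / 2)" for z
  proof -
    have "z \<in> T" using that r by (auto simp: subset_iff)
    then show ?thesis using inv T(2) b(2)[OF that] by (auto simp: g_def subset_iff)
  qed
  moreover have "ball y (r / 2) \<subseteq> T" using r by (auto simp: subset_iff)
  ultimately show ?thesis using r(1) by (intro exI[of _ g] exI[of _ "ball y (r / 2)"]) auto
qed

section \<open>Differential operators in a chart\<close>

text \<open>
  The second clause, locality, makes it possible to apply \<open>Q\<close> to functions that are smooth only near a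
  point.
\<close>

definition locally_given ::
  "(('a \<Rightarrow> complex) \<Rightarrow> 'a \<Rightarrow> complex) \<Rightarrow> 'a set \<Rightarrow> ('a \<Rightarrow> real^'n) \<Rightarrow> ((real^'n \<Rightarrow> complex) \<Rightarrow> real^'n \<Rightarrow> complex) \<Rightarrow> bool" where
  "locally_given P U \<phi> Q \<longleftrightarrow> (\<forall>f\<in>C_inf A UNIV. \<forall>m\<in>U. P f m = Q (f \<circ> inv_into U \<phi>) (\<phi> m)) \<and>
     (\<forall>V u w x. open V \<longrightarrow> (\<forall>y\<in>V. u y = w y) \<longrightarrow> x \<in> V \<longrightarrow> Q u x = Q w x)"

text \<open>
  The choice of a global function with the germ of \<open>f\<close> is possible by \<open>global_extension\<close>, and does not
  matter because \<open>Q\<close> is local.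
\<close>

lemma restrict_op_in_chart:
  assumes c: "(U, \<phi>) \<in> charts_of A" and Q: "locally_given P U \<phi> Q"
    and N: "open N" "N \<subseteq> U" and f: "f \<in> C_inf A N" and m: "m \<in> N"
  shows "restrict_op A P N f m = Q (f \<circ> inv_into U \<phi>) (\<phi> m)"
proof -
  note cc = chart_is_chart[OF atlas c]
  have "\<phi> ` (N \<inter> U) = \<phi> ` N" using N(2) by auto
  then have u: "smooth_on (\<phi> ` N) (f \<circ> inv_into U \<phi>)" using C_inf_chart[OF f N(1) c] by simp
  have o: "open (\<phi> ` N)" by (rule chart_open_image[OF cc N])
  obtain g V where g: "g \<in> C_inf A UNIV" "open V" "\<phi> m \<in> V" "V \<subseteq> \<phi> ` N"
    "\<And>z. z \<in> V \<Longrightarrow> g (inv_into U \<phi> z) = (f \<circ> inv_into U \<phi>) z"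
    using global_extension[OF c o image_mono[OF N(2)] u imageI[OF m]] by blast
  let ?G = "\<lambda>g. g \<in> C_inf A UNIV \<and> (\<exists>W. open W \<and> m \<in> W \<and> W \<subseteq> N \<and> (\<forall>x\<in>W. g x = f x))"
  have VU: "V \<subseteq> \<phi> ` U" using g(4) N(2) by blast
  have "?G g"
  proof (intro conjI exI[of _ "inv_into U \<phi> ` V"])
    show "open (inv_into U \<phi> ` V)" by (rule chart_open_preimage[OF cc g(2) VU])
    show "m \<in> inv_into U \<phi> ` V" using g(3) m N(2) chart_inverse(1)[OF cc, of m] by (metis image_eqI subsetD)
    show "inv_into U \<phi> ` V \<subseteq> N" using g(4) N(2) chart_inverse(1)[OF cc] by (auto simp: subset_iff)
  qed (use g in auto)
  then have G: "?G (SOME g. ?G g)" by (rule someI[where P = ?G])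
  define g' where "g' = (SOME g. ?G g)"
  obtain W where g': "g' \<in> C_inf A UNIV" and W: "open W" "m \<in> W" "W \<subseteq> N" "\<And>x. x \<in> W \<Longrightarrow> g' x = f x"
    using G unfolding g'_def[symmetric] by blast
  have oW: "open (\<phi> ` W)" by (rule chart_open_image[OF cc W(1)]) (use W N in auto)
  have "restrict_op A P N f m = P g' m" using m by (simp add: restrict_op_def g'_def)
  also have "\<dots> = Q (g' \<circ> inv_into U \<phi>) (\<phi> m)" using Q g' m N(2) by (auto simp: locally_given_def)
  also have "\<dots> = Q (f \<circ> inv_into U \<phi>) (\<phi> m)"
  proof -
    have "\<forall>y\<in>\<phi> ` W. (g' \<circ> inv_into U \<phi>) y = (f \<circ> inv_into U \<phi>) y"
      using W N(2) chart_inverse(1)[OF cc] by auto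
    then show ?thesis using Q oW W(2) unfolding locally_given_def by blast
  qed
  finally show ?thesis .
qed

lemma partial_derivs_sum_local:
  "open V \<Longrightarrow> (\<forall>y\<in>V. u y = w y) \<Longrightarrow> x \<in> V \<Longrightarrow>
    (\<Sum>is | length is \<le> p. a is x * partial_derivs is u x) = (\<Sum>is | length is \<le> p. a is x * partial_derivs is w x)"
  by (rule sum.cong[OF refl]) (simp add: partial_derivs_cong[of V u w x])

lemma smooth_on_partial_derivs: "smooth_on S u \<Longrightarrow> smooth_on S (partial_derivs is u)"
  by (induction "is") (simp_all add: partial_derivs_def smooth_on_partial_deriv)

lemma DO_in_chart:
  assumes P: "P \<in> DO_le A p" and c: "(U, \<phi>) \<in> charts_of A"
  obtains d where "\<And>is. smooth_on (\<phi> ` U) (d is)"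
    and "locally_given P U \<phi> (\<lambda>u x. \<Sum>is | length is \<le> p. d is x * partial_derivs is u x)"
proof -
  note cc = chart_is_chart[OF atlas c]
  have "\<exists>a. (\<forall>is. a is \<in> C_inf A U) \<and> (\<forall>f\<in>C_inf A UNIV. \<forall>m\<in>U.
      P f m = (\<Sum>is | length is \<le> p. a is m * partial_derivs is (f \<circ> inv_into U \<phi>) (\<phi> m)))"
    using P[unfolded DO_le_def, THEN CollectD, THEN bspec, OF c] by (simp only: prod.case)
  then obtain a where "\<forall>is. a is \<in> C_inf A U" and "\<forall>f\<in>C_inf A UNIV. \<forall>m\<in>U.
      P f m = (\<Sum>is | length is \<le> p. a is m * partial_derivs is (f \<circ> inv_into U \<phi>) (\<phi> m))"
    by (elim exE conjE)
  then have a: "\<And>is. a is \<in> C_inf A U" "\<And>f m. f \<in> C_inf A UNIV \<Longrightarrow> m \<in> U \<Longrightarrow>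
      P f m = (\<Sum>is | length is \<le> p. a is m * partial_derivs is (f \<circ> inv_into U \<phi>) (\<phi> m))"
    by simp_all
  show ?thesis
  proof (rule that)
    show "smooth_on (\<phi> ` U) (a is \<circ> inv_into U \<phi>)" for "is"
      using C_inf_chart[OF a(1) chart_homeomorphism(1)[OF cc] c] by simp
    show "locally_given P U \<phi> (\<lambda>u x. \<Sum>is | length is \<le> p. (a is \<circ> inv_into U \<phi>) x * partial_derivs is u x)"
      unfolding locally_given_def
    proof (intro conjI ballI allI impI)
      show "P f m = (\<Sum>is | length is \<le> p. (a is \<circ> inv_into U \<phi>) (\<phi> m) * partial_derivs is (f \<circ> inv_into U \<phi>) (\<phi> m))"
        if "f \<in> C_inf A UNIV" "m \<in> U" for f m
        using a(2)[OF that] chart_inverse(1)[OF cc that(2)] by simp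
    qed (rule partial_derivs_sum_local)
  qed
qed

lemma DO_preserves_C_inf:
  assumes P: "P \<in> DO_le A p" and f: "f \<in> C_inf A UNIV"
  shows "P f \<in> C_inf A UNIV"
proof (rule C_inf_local)
  fix m :: 'a
  obtain W \<theta> where W: "(W, \<theta>) \<in> A" "m \<in> W" and Wc: "(W, \<theta>) \<in> charts_of A"
      using exists_chart[OF atlas] by blast
  note ww = chart_is_chart[OF atlas Wc]
  obtain d where d: "\<And>is. smooth_on (\<theta> ` W) (d is)"
    and Q: "locally_given P W \<theta> (\<lambda>u x. \<Sum>is | length is \<le> p. d is x * partial_derivs is u x)"
    using DO_in_chart[OF P Wc] by blast
  have o: "open (\<theta> ` W)" by (rule chart_homeomorphism(2)[OF ww])
  have u: "smooth_on (\<theta> ` W) (f \<circ> inv_into W \<theta>)" using C_inf_chart[OF f open_UNIV Wc] by simp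
  have "smooth_on (\<theta> ` W) (\<lambda>x. \<Sum>is | length is \<le> p. d is x * partial_derivs is (f \<circ> inv_into W \<theta>) x)"
    by (intro smooth_intros o d smooth_on_partial_derivs u)
  then have "smooth_on (\<theta> ` W) (P f \<circ> inv_into W \<theta>)"
    by (rule smooth_on_cong[OF o, THEN iffD1, rotated])
      (use Q f chart_inverse[OF ww] in \<open>auto simp: locally_given_def\<close>)
  then show "\<exists>V \<psi> N. (V, \<psi>) \<in> charts_of A \<and> open N \<and> m \<in> N \<and> N \<subseteq> V \<and> smooth_on (\<psi> ` N) (P f \<circ> inv_into V \<psi>)"
    using Wc W chart_homeomorphism(1)[OF ww] by blast
qed simp

lemma new_chart:
  assumes c: "(U, \<phi>) \<in> charts_of A" and N: "open N" "N \<subseteq> \<phi> ` U" and o: "open (\<Psi> ` N)"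
    and h: "homeomorphism N (\<Psi> ` N) \<Psi> \<Phi>" and \<Psi>: "smooth_on N \<Psi>" and \<Phi>: "smooth_on (\<Psi> ` N) \<Phi>"
  shows "(inv_into U \<phi> ` N, \<Psi> \<circ> \<phi>) \<in> charts_of A"
    and "z \<in> N \<Longrightarrow> inv_into (inv_into U \<phi> ` N) (\<Psi> \<circ> \<phi>) (\<Psi> z) = inv_into U \<phi> z"
proof -
  note cc = chart_is_chart[OF atlas c]
  note inv = chart_inverse[OF cc]
  let ?V = "inv_into U \<phi> ` N"
  have im: "\<phi> ` ?V = N" and VU: "?V \<subseteq> U" by (rule chart_image_preimage[OF cc N(2)])+
  have oV: "open ?V" by (rule chart_open_preimage[OF cc N])
  have "homeomorphism ?V N \<phi> (inv_into U \<phi>)"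
    by (rule homeomorphism_of_subsets[OF chart_homeomorphism(3)[OF cc]]) (use im VU N(2) in auto)
  from homeomorphism_compose[OF this h]
  have hom: "homeomorphism ?V (\<Psi> ` N) (\<Psi> \<circ> \<phi>) (inv_into U \<phi> \<circ> \<Phi>)" .
  have im2: "(\<Psi> \<circ> \<phi>) ` ?V = \<Psi> ` N" by (simp only: image_comp[symmetric] im)
  have chart: "is_chart (?V, \<Psi> \<circ> \<phi>)"
    unfolding is_chart_def using oV o hom im2 by auto
  have \<Phi>\<Psi>: "\<Phi> (\<Psi> z) = z" if "z \<in> N" for z using h that by (auto simp: homeomorphism_def)
  have inv2: "inv_into ?V (\<Psi> \<circ> \<phi>) (\<Psi> z) = inv_into U \<phi> z" if "z \<in> N" for z
    using chart_inverse(1)[OF chart, of "inv_into U \<phi> z"] that inv(3)[of z] N(2) by auto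
  then show "z \<in> N \<Longrightarrow> inv_into ?V (\<Psi> \<circ> \<phi>) (\<Psi> z) = inv_into U \<phi> z" .
  have "compatible (?V, \<Psi> \<circ> \<phi>) (W, \<theta>)" if "(W, \<theta>) \<in> A" for W \<theta>
  proof -
    have Wc: "(W, \<theta>) \<in> charts_of A" using that atlas_subset_charts[OF atlas] by blast
    note ww = chart_is_chart[OF atlas Wc]
    let ?X = "?V \<inter> W"
    have oX: "open ?X" using oV chart_homeomorphism(1)[OF ww] by blast
    have o1: "open ((\<Psi> \<circ> \<phi>) ` ?X)" "open (\<phi> ` ?X)" "open (\<theta> ` ?X)"
      using chart_open_image[OF chart oX] chart_open_image[OF cc oX] chart_open_image[OF ww oX] VU by auto
    have X: "\<phi> ` ?X \<subseteq> N" using im by auto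
    have XD: "\<exists>m\<in>?X. y = \<Psi> (\<phi> m) \<and> \<phi> m \<in> N" if "y \<in> (\<Psi> \<circ> \<phi>) ` ?X" for y
      using that X by fastforce
    have "smooth_on ((\<Psi> \<circ> \<phi>) ` ?X) (\<lambda>y. (\<theta> \<circ> inv_into U \<phi>) (\<Phi> y))"
    proof (rule smooth_on_compose[where f = \<Phi> and g = "\<theta> \<circ> inv_into U \<phi>", OF o1(1,2)])
      show "smooth_on ((\<Psi> \<circ> \<phi>) ` ?X) \<Phi>" by (rule smooth_on_subset[OF \<Phi>]) (use X in auto)
      show "smooth_on (\<phi> ` ?X) (\<theta> \<circ> inv_into U \<phi>)"
        by (rule smooth_on_subset[OF transition_smooth[OF c Wc]]) (use VU in auto)
      show "\<Phi> ` ((\<Psi> \<circ> \<phi>) ` ?X) \<subseteq> \<phi> ` ?X"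
        by (rule image_subsetI) (metis XD \<Phi>\<Psi> imageI)
    qed
    then have 1: "smooth_on ((\<Psi> \<circ> \<phi>) ` ?X) (\<theta> \<circ> inv_into ?V (\<Psi> \<circ> \<phi>))"
      by (rule smooth_on_cong[OF o1(1), THEN iffD1, rotated]) (use XD inv2 \<Phi>\<Psi> in \<open>fastforce simp: comp_apply\<close>)
    have "smooth_on (\<theta> ` ?X) (\<lambda>y. \<Psi> ((\<phi> \<circ> inv_into W \<theta>) y))"
    proof (rule smooth_on_compose[where f = "\<phi> \<circ> inv_into W \<theta>" and g = \<Psi>, OF o1(3) N(1)])
      show "smooth_on (\<theta> ` ?X) (\<phi> \<circ> inv_into W \<theta>)"
        by (rule smooth_on_subset[OF transition_smooth[OF Wc c]]) (use VU in auto)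
      show "(\<phi> \<circ> inv_into W \<theta>) ` \<theta> ` ?X \<subseteq> N" using chart_inverse[OF ww] X by auto
    qed (rule \<Psi>)
    then have 2: "smooth_on (\<theta> ` ?X) ((\<Psi> \<circ> \<phi>) \<circ> inv_into W \<theta>)" by (simp add: comp_def)
    show ?thesis using 1 2 by (simp add: compatible_def)
  qed
  then show "(?V, \<Psi> \<circ> \<phi>) \<in> charts_of A" using chart by (auto simp: charts_of_def)
qed

end

lemma vf_local:
  "\<forall>V u w x. open V \<longrightarrow> (\<forall>y\<in>V. u y = w y) \<longrightarrow> x \<in> V \<longrightarrow> vf X u x = vf X w x"
  using vf_cong by blast

lemma smooth_on_vf_pow:
  "open S \<Longrightarrow> (\<And>i. smooth_on S (X i)) \<Longrightarrow> smooth_on S u \<Longrightarrow> smooth_on S ((vf X ^^ j) u)"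
  by (induction j) (auto intro: smooth_on_vf)

text \<open>
  If \<open>L\<close> vanished on all functions in all charts, it would be an operator of order zero. In a chart, its
  term of order zero is the value on the constant function \<open>1\<close>.
\<close>

lemma first_order_homogeneous_chart:
  fixes A :: "('a::{t2_space,second_countable_topology}, 2) chart set"
  assumes atlas: "smooth_atlas A" and L: "first_order_homogeneous A L"
  obtains U \<phi> X x k where "(U, \<phi>) \<in> charts_of A" "\<And>k. smooth_on (\<phi> ` U) (X k)"
    "locally_given A L U \<phi> (vf X)" "x \<in> \<phi> ` U" "X k x \<noteq> 0"
proof -
  have L1: "L \<in> DO_le A 1" and L0: "L \<notin> DO_le A 0" and hom: "\<And>m. L (\<lambda>_. 1) m = 0"
    using L unfolding first_order_homogeneous_def by blast+
  have "\<exists>U \<phi>. (U, \<phi>) \<in> charts_of A \<and> (\<exists>f\<in>C_inf A UNIV. \<exists>m\<in>U. L f m \<noteq> 0)"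
  proof (rule ccontr)
    assume no: "\<not> ?thesis"
    have "\<exists>a. (\<forall>is. a is \<in> C_inf A U) \<and> (\<forall>f\<in>C_inf A UNIV. \<forall>m\<in>U.
        L f m = (\<Sum>is | length is \<le> 0. a is m * partial_derivs is (f \<circ> inv_into U \<phi>) (\<phi> m)))"
      if c: "(U, \<phi>) \<in> charts_of A" for U \<phi>
    proof (rule exI[of _ "\<lambda>_ _. 0"], intro conjI allI ballI)
      have "smooth_on (\<psi> ` (U \<inter> V)) ((\<lambda>_. 0 :: complex) \<circ> inv_into V \<psi>)" if "(V, \<psi>) \<in> A" for V \<psi>
      proof (rule smooth_on_subset)
        show "smooth_on (\<psi> ` (UNIV \<inter> V)) ((\<lambda>_. 0 :: complex) \<circ> inv_into V \<psi>)"
          by (rule C_inf_chart[OF atlas C_inf_const[OF atlas] open_UNIV])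
            (use that atlas_subset_charts[OF atlas] in blast)
      qed auto
      then show "(\<lambda>_. 0) \<in> C_inf A U" by (auto simp: C_inf_def)
      show "L f m = (\<Sum>is | length is \<le> 0. 0 * partial_derivs is (f \<circ> inv_into U \<phi>) (\<phi> m))"
        if "f \<in> C_inf A UNIV" "m \<in> U" for f m
        using no c that by auto
    qed
    then have "L \<in> DO_le A 0" unfolding DO_le_def by blast
    then show False using L0 by blast
  qed
  then obtain U \<phi> f m where c: "(U, \<phi>) \<in> charts_of A" and f: "f \<in> C_inf A UNIV" and m: "m \<in> U" and nz: "L f m \<noteq> 0"
    by blast
  note cc = chart_is_chart[OF atlas c]
  obtain d where d: "\<And>is. smooth_on (\<phi> ` U) (d is)"
    and Q: "locally_given A L U \<phi> (\<lambda>u x. \<Sum>is | length is \<le> 1. d is x * partial_derivs is u x)"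
    using DO_in_chart[OF atlas L1 c] by blast
  have lists: "{is :: 2 list. length is \<le> 1} = {[], [1], [2]}"
  proof -
    have "is = [] \<or> is = [1] \<or> is = [2]" if "length is \<le> 1" for "is" :: "2 list"
      using that exhaust_2 by (cases "is") auto
    then show ?thesis by auto
  qed
  define X where "X k = d [k]" for k :: 2
  have sum1: "(\<Sum>is | length is \<le> 1. d is x * partial_derivs is u x) = d [] x * u x + vf X u x" for u x
    unfolding lists by (simp add: partial_derivs_def vf_def sum_2 X_def)
  have d0: "d [] x = 0" if x: "x \<in> \<phi> ` U" for x
  proof -
    obtain m where m: "m \<in> U" "x = \<phi> m" using x by blast
    have "0 = L (\<lambda>_. 1) m" by (simp add: hom)
    also have "\<dots> = d [] x * 1 + vf X (\<lambda>_. 1) x"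
      using Q C_inf_const[OF atlas, of 1] m unfolding locally_given_def[OF atlas] sum1 by (simp add: comp_def)
    finally show ?thesis by (simp add: vf_const)
  qed
  have Q': "locally_given A L U \<phi> (vf X)"
    using Q vf_local[of X] d0 unfolding locally_given_def[OF atlas] sum1 by auto
  then have "vf X (f \<circ> inv_into U \<phi>) (\<phi> m) \<noteq> 0"
    using f m nz unfolding locally_given_def[OF atlas] by auto
  then have "\<exists>k. X k (\<phi> m) \<noteq> 0"
    unfolding vf_def by (metis (no_types, lifting) mult_zero_left sum.neutral)
  then obtain k where "X k (\<phi> m) \<noteq> 0" ..
  then show ?thesis using that[OF c _ Q'] d m by (auto simp: X_def)
qed

section \<open>Existence of a separated solution\<close>

theorem theorem3:
  fixes A :: "('a::{t2_space,second_countable_topology}, 2) chart set"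
    and D L :: "('a \<Rightarrow> complex) \<Rightarrow> 'a \<Rightarrow> complex"
  assumes "smooth_atlas A"
    and "D \<in> DO A"
    and "L \<in> DO A"
    and "first_order_homogeneous A L"
    and "simple_symmetry A D L"
    and "\<not> generates A L D"
  shows "\<exists>m U \<psi>. m \<in> U \<and> (U, \<psi>) \<in> charts_of A \<and>
           (\<exists>f. \<not> f constant_on U \<and> separated_solution A D (U, \<psi>) f)"
proof -
  note atlas = assms(1)
  obtain U \<phi> X x k where c: "(U, \<phi>) \<in> charts_of A" and X: "\<And>k. smooth_on (\<phi> ` U) (X k)"
    and QL: "locally_given A L U \<phi> (vf X)" and x: "x \<in> \<phi> ` U" "X k x \<noteq> 0"
    using first_order_homogeneous_chart[OF atlas assms(4)] by metis
  note cc = chart_is_chart[OF atlas c]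
  note inv = chart_inverse[OF cc]
  let ?S = "\<phi> ` U" and ?i = "inv_into U \<phi>"
  have S: "open ?S" by (rule chart_homeomorphism(2)[OF cc])
  obtain n where Dn: "D \<in> DO_le A n" using assms(2) by (auto simp: DO_def)
  have L1: "L \<in> DO_le A 1" using assms(4) by (simp add: first_order_homogeneous_def)
  obtain d where d: "\<And>is. smooth_on ?S (d is)"
    and QD: "locally_given A D U \<phi> (\<lambda>u x. \<Sum>is | length is \<le> n. d is x * partial_derivs is u x)"
    using DO_in_chart[OF atlas Dn c] by blast
  define D' where "D' u x = (\<Sum>is | length is \<le> n. d is x * partial_derivs is u x)" for u x
  have QD': "locally_given A D U \<phi> D'" using QD by (simp add: D'_def[abs_def])
  have D'_local: "D' u x = D' w x" if "open V" "\<And>y. y \<in> V \<Longrightarrow> u y = w y" "x \<in> V" for V u w x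
    using QD' that unfolding locally_given_def[OF atlas] by blast
  \<comment> \<open>Commutation is given for global functions only, but each function is near a point the germ of one.\<close>
  have comm: "D' (vf X u) z = vf X (D' u) z" if T: "open T" "T \<subseteq> ?S" and u: "smooth_on T u" and z: "z \<in> T" for T u z
  proof -
    obtain g V where g: "g \<in> C_inf A UNIV" and V: "open V" "z \<in> V" "V \<subseteq> T" "\<And>z. z \<in> V \<Longrightarrow> g (?i z) = u z"
      using global_extension[OF atlas c T u z] by blast
    have VS: "V \<subseteq> ?S" using V T by blast
    have gu: "(g \<circ> ?i) y = u y" if "y \<in> V" for y using V(4)[OF that] by simp
    have Lg: "L g \<in> C_inf A UNIV" and Dg: "D g \<in> C_inf A UNIV"
      using DO_preserves_C_inf[OF atlas] L1 Dn g by blast+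
    have zU: "?i z \<in> U" "\<phi> (?i z) = z" using inv(2,3)[of z] V VS by auto
    have app: "P f (?i y) = Q (f \<circ> ?i) y" if "locally_given A P U \<phi> Q" "f \<in> C_inf A UNIV" "y \<in> V" for P Q f y
      using that inv(2,3)[of y] VS unfolding locally_given_def[OF atlas] by auto
    have e1: "(L g \<circ> ?i) y = vf X u y" if y: "y \<in> V" for y
      using app[OF QL g y] vf_cong[OF V(1) y gu] by simp
    have DL: "D (L g) (?i z) = D' (vf X u) z"
      unfolding app[OF QD' Lg V(2)] by (rule D'_local[OF V(1) e1 V(2)])
    have e2: "(D g \<circ> ?i) y = D' u y" if y: "y \<in> V" for y
      using app[OF QD' g y] D'_local[OF V(1) gu y] by simp
    have LD: "L (D g) (?i z) = vf X (D' u) z"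
      unfolding app[OF QL Dg V(2)] by (rule vf_cong[OF V(1,2) e2])
    have "D (L g) (?i z) - L (D g) (?i z) = 0"
      using assms(5) g by (simp add: simple_symmetry_def)
    then show ?thesis by (simp add: DL LD)
  qed
  \<comment> \<open>A polynomial in \<open>X\<close> with local coefficients, pulled back to the manifold, would show that \<open>L\<close> generates \<open>D\<close>.\<close>
  have ngen: False if T: "open T" "T \<noteq> {}" "T \<subseteq> ?S" and cs: "\<And>i. smooth_on T (c' i)"
    and gen: "\<And>u x. smooth_on T u \<Longrightarrow> x \<in> T \<Longrightarrow> D' u x = (\<Sum>i\<le>n. c' i x * (vf X ^^ i) u x)" for T c'
  proof -
    let ?U = "?i ` T"
    have oU: "open ?U" and UU: "?U \<subseteq> U" and im: "\<phi> ` ?U = T"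
      using chart_open_preimage[OF cc T(1,3)] chart_image_preimage[OF cc T(3)] by auto
    have iT: "\<phi> m \<in> T" "?i (\<phi> m) = m" if "m \<in> ?U" for m using that im UU inv(1)[of m] by auto
    have sT: "smooth_on T (f \<circ> ?i)" if "f \<in> C_inf A ?U" for f
    proof -
      have "\<phi> ` (?U \<inter> U) = T" using im UU by (simp add: Int_absorb2)
      then show ?thesis using C_inf_chart[OF atlas that oU c] by simp
    qed
    have pow: "(restrict_op A L ?U ^^ i) f \<in> C_inf A ?U \<and>
        (\<forall>y\<in>T. (restrict_op A L ?U ^^ i) f (?i y) = (vf X ^^ i) (f \<circ> ?i) y)" if f: "f \<in> C_inf A ?U" for f i
    proof (induction i)
      case (Suc i)
      let ?f = "(restrict_op A L ?U ^^ i) f"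
      have eq: "restrict_op A L ?U ?f (?i y) = (vf X ^^ Suc i) (f \<circ> ?i) y" if y: "y \<in> T" for y
      proof -
        have "restrict_op A L ?U ?f (?i y) = vf X (?f \<circ> ?i) (\<phi> (?i y))"
          using restrict_op_in_chart[OF atlas c QL oU UU] Suc y by blast
        also have "\<phi> (?i y) = y" using inv(3)[of y] y T by auto
        also have "vf X (?f \<circ> ?i) y = vf X ((vf X ^^ i) (f \<circ> ?i)) y"
          by (rule vf_cong[OF T(1) y], subst comp_apply) (use Suc in blast)
        finally show ?thesis by simp
      qed
      have sp: "smooth_on T ((vf X ^^ j) (f \<circ> ?i))" for j
        by (rule smooth_on_vf_pow[OF T(1) smooth_on_subset[OF X T(3)] sT[OF f]])
      have "restrict_op A L ?U ?f \<in> C_inf A ?U"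
        by (rule C_inf_pullback[OF atlas c T(1,3) sp eq])
      moreover have "(restrict_op A L ?U ^^ Suc i) f = restrict_op A L ?U ?f" by simp
      ultimately show ?case using eq by (simp only:) blast
    next
      case 0
      show ?case using f by (simp only: funpow_0) simp
    qed
    have "generates A L D"
      unfolding generates_def
    proof (intro exI[of _ ?U] exI[of _ n] exI[of _ "\<lambda>i. c' i \<circ> \<phi>"] conjI allI impI ballI)
      show "open ?U" by (fact oU)
      show "?U \<noteq> {}" using T by simp
      show "c' i \<circ> \<phi> \<in> C_inf A ?U" for i
        by (rule C_inf_pullback[OF atlas c T(1,3) cs]) (use inv(3) T(3) in \<open>simp add: subset_iff\<close>)
      fix f m assume f: "f \<in> C_inf A ?U" and m: "m \<in> ?U"
      have "restrict_op A D ?U f m = D' (f \<circ> ?i) (\<phi> m)"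
        by (rule restrict_op_in_chart[OF atlas c QD' oU UU f m])
      also have "\<dots> = (\<Sum>i\<le>n. c' i (\<phi> m) * (vf X ^^ i) (f \<circ> ?i) (\<phi> m))"
        by (rule gen[OF sT[OF f] iT(1)[OF m]])
      also have "\<dots> = (\<Sum>i\<le>n. (c' i \<circ> \<phi>) m * (restrict_op A L ?U ^^ i) f m)"
        using pow[OF f] iT[OF m] by (intro sum.cong refl) (metis comp_apply)
      finally show "restrict_op A D ?U f m = (\<Sum>i\<le>n. (c' i \<circ> \<phi>) m * (restrict_op A L ?U ^^ i) f m)" .
    qed
    then show False using assms(6) by blast
  qed
  have "\<exists>x0 r f. r > 0 \<and> ball x0 r \<subseteq> ?S \<and> smooth_on (ball x0 r) f \<and> (\<forall>x\<in>ball x0 r. D' f x = 0) \<and>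
    f x0 \<noteq> 0 \<and> (\<exists>k. partial_deriv k f x0 \<noteq> 0)"
    unfolding D'_def
    by (rule exists_local_solution[OF S X d comm[unfolded D'_def] x ngen[unfolded D'_def]])
  then obtain x0 r f k where r: "r > 0" "ball x0 r \<subseteq> ?S" and f: "smooth_on (ball x0 r) f"
    "\<And>x. x \<in> ball x0 r \<Longrightarrow> D' f x = 0" "f x0 \<noteq> 0" "partial_deriv k f x0 \<noteq> 0" by blast
  have x0: "x0 \<in> ball x0 r" using r by simp
  obtain N and \<Psi> \<Phi> :: "real^2 \<Rightarrow> real^2" and g h where N: "open N" "N \<noteq> {}" "N \<subseteq> ball x0 r" and \<Psi>: "open (\<Psi> ` N)" "homeomorphism N (\<Psi> ` N) \<Psi> \<Phi>"
      "smooth_on N \<Psi>" "smooth_on (\<Psi> ` N) \<Phi>" and gh: "smooth_on N g" "smooth_on N h" "\<forall>x\<in>N. f x = g x * h x"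
    and g2: "\<forall>x\<in>N. \<forall>y\<in>N. \<Psi> x $ 2 = \<Psi> y $ 2 \<longrightarrow> g x = g y" and h1: "\<forall>x\<in>N. \<forall>y\<in>N. \<Psi> x $ 1 = \<Psi> y $ 1 \<longrightarrow> h x = h y"
    and nc: "\<not> f constant_on N"
    using separated_chart[OF open_ball f(1) x0 f(3,4)] by (elim exE conjE)
  have NS: "N \<subseteq> ?S" using N(3) r(2) by blast
  define V where "V = ?i ` N"
  \<comment> \<open>The new chart follows the old one by the coordinates in which the solution is separated.\<close>
  define \<psi> where "\<psi> = \<Psi> \<circ> \<phi>"
  have chart: "(V, \<psi>) \<in> charts_of A" and inv2: "\<And>z. z \<in> N \<Longrightarrow> inv_into V \<psi> (\<Psi> z) = ?i z"
    unfolding V_def \<psi>_def using new_chart[OF atlas c N(1) NS \<Psi>] by blast+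
  have oV: "open V" and VU: "V \<subseteq> U" and im: "\<phi> ` V = N"
    unfolding V_def using chart_open_preimage[OF cc N(1) NS] chart_image_preimage[OF cc NS] by auto
  have pull: "w \<circ> \<phi> \<in> C_inf A V" if "smooth_on N w" for w
    unfolding V_def by (rule C_inf_pullback[OF atlas c N(1) NS that]) (use inv(3) NS in \<open>simp add: subset_iff\<close>)
  have ev: "(w \<circ> \<phi> \<circ> inv_into V \<psi>) (\<Psi> z) = w z" if "z \<in> N" for w :: "real^2 \<Rightarrow> complex" and z
    using inv2[OF that] inv(3)[of z] that NS by auto
  have img: "\<psi> ` V = \<Psi> ` N" unfolding \<psi>_def image_comp[symmetric] im ..
  have "restrict_op A D V (f \<circ> \<phi>) m = 0" if m: "m \<in> V" for m
  proof -
    have mN: "\<phi> m \<in> N" using m im by blast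
    have "restrict_op A D V (f \<circ> \<phi>) m = D' (f \<circ> \<phi> \<circ> ?i) (\<phi> m)"
      by (rule restrict_op_in_chart[OF atlas c QD' oV VU pull[OF smooth_on_subset[OF f(1) N(3)]] m])
    also have "\<dots> = D' f (\<phi> m)"
      by (rule D'_local[OF N(1) _ mN]) (use inv(3) NS in \<open>simp add: subset_iff\<close>)
    finally show ?thesis using f(2) mN N(3) by auto
  qed
  then have sol: "solution A D V (f \<circ> \<phi>)"
    using pull[OF smooth_on_subset[OF f(1) N(3)]] by (simp add: solution_def)
  have "separated_solution A D (V, \<psi>) (f \<circ> \<phi>)"
    unfolding separated_solution_def prod.case
  proof (rule conjI[OF sol], rule exI[of _ 1], rule exI[of _ "g \<circ> \<phi>"], rule exI[of _ "h \<circ> \<phi>"],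
      intro conjI pull gh(1,2))
    show "\<forall>m\<in>V. (f \<circ> \<phi>) m = (g \<circ> \<phi>) m * (h \<circ> \<phi>) m" using gh(3) im by auto
    show "indep_first 1 (V, \<psi>) (g \<circ> \<phi>)"
      unfolding indep_first_def prod.case img
    proof (intro ballI impI)
      fix y z assume "y \<in> \<Psi> ` N" "z \<in> \<Psi> ` N" and yz: "\<forall>i\<in>{1<..CARD(2)}. y $ of_nat i = z $ of_nat i"
      then obtain y' z' where yz': "y' \<in> N" "z' \<in> N" "y = \<Psi> y'" "z = \<Psi> z'" by blast
      have "y $ 2 = z $ 2" using bspec[OF yz, of 2] by simp
      then have "g y' = g z'" using g2[rule_format, OF yz'(1,2)] yz'(3,4) by simp
      then show "(g \<circ> \<phi> \<circ> inv_into V \<psi>) y = (g \<circ> \<phi> \<circ> inv_into V \<psi>) z"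
        unfolding yz'(3,4) ev[OF yz'(1)] ev[OF yz'(2)] .
    qed
    show "indep_last (CARD(2) - 1) (V, \<psi>) (h \<circ> \<phi>)"
      unfolding indep_last_def prod.case img
    proof (intro ballI impI)
      fix y z assume "y \<in> \<Psi> ` N" "z \<in> \<Psi> ` N" and yz: "\<forall>i\<in>{1..CARD(2) - (CARD(2) - 1)}. y $ of_nat i = z $ of_nat i"
      then obtain y' z' where yz': "y' \<in> N" "z' \<in> N" "y = \<Psi> y'" "z = \<Psi> z'" by blast
      have "y $ 1 = z $ 1" using bspec[OF yz, of 1] by simp
      then have "h y' = h z'" using h1[rule_format, OF yz'(1,2)] yz'(3,4) by simp
      then show "(h \<circ> \<phi> \<circ> inv_into V \<psi>) y = (h \<circ> \<phi> \<circ> inv_into V \<psi>) z"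
        unfolding yz'(3,4) ev[OF yz'(1)] ev[OF yz'(2)] .
    qed
  qed simp_all
  moreover have "\<not> (f \<circ> \<phi>) constant_on V"
    using nc im unfolding constant_on_def by (metis comp_apply image_eqI image_iff)
  moreover obtain m where "m \<in> V" using N(2) im by blast
  ultimately show ?thesis using chart by blast
qed

end
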